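(* Let $a>0$, $k\in\mathbb{R}$, $\sigma>0$, $v=2a/\sigma^2>0$, $T>0$ and $\nu\in\mathbb{N}^*$. Let $(\tilde Z_i)_{i\in\mathbb{N}}$ be a family of positive random variables for which there are real coefficients $\delta^Z_{j,L}(v)$ such that for all $i\in\mathbb{N}$ and $L\in\mathbb{N}^*$ $$\mathbb{E}[\tilde Z_i^L]=\sum_{j=0}^L\delta^Z_{j,L}(v)\,i^*_j,\qquad\text{where }\ \delta^Z_{j,L}(v)=\delta^{cir}_{j,L}(v)\ \text{ for all } j\in\{(L-\nu)\vee0,\dots,L\}.$$ For $t\in(0,T]$ let $Z_i=\frac{2}{c_t}\tilde Z_i$ for all $i\in\mathbb{N}$, and let $\hat X^{x,Z}_t$ be a random variable distributed as $Z_P$, where $P$ is a Poisson random variable with parameter $d_tx/2$, independent of $(\tilde Z_i)_{i\in\mathbb N}$. Then for all $L\in\mathbb{N}^*$ there is a constant $C$ such that for all $f\in\mathfrak{P}_L(\mathbb{R})$ and $t\in(0,T]$, $$\big\|\mathbb{E}[f(\hat X^{\cdot,Z}_t)]-\mathbb{E}[f(X^{\cdot}_t)]\big\|\le Ct^{\nu+1}\|f\|.$$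
   Context: $\mathbb{N}^*=\mathbb{N}\setminus\{0\}$, $\mathbb{R}_+=[0,\infty)$. The CIR process solves $dX^x_t=(a-kX^x_t)dt+\sigma\sqrt{X^x_t}\,dW_t$, $X^x_0=x\ge0$. $\psi_k(t)=\frac{1-e^{-kt}}{k}$ for $k\ne0$, $\psi_0(t)=t$; $c_t=\frac{4}{\sigma^2\psi_k(t)}$ and $d_t=c_te^{-kt}$. $i^*_j=i(i-1)\cdots(i-j+1)$ with $i^*_0=1$. $\delta^{cir}_{j,L}(v)=\binom Lj\prod_{q=j}^{L-1}(q+v)$ (empty products equal $1$). $\mathfrak{P}_L(\mathbb{R})$ is the space of polynomial functions $f(x)=\sum_{j=0}^La_jx^j$ on $\mathbb{R}_+$ of degree at most $L$, with norm $\|f\|=\sum_{j=0}^L|a_j|$. $\mathbb{E}[f(X^\cdot_t)]$ denotes $x\mapsto\mathbb{E}[f(X^x_t)]$ and similarly for $\hat X^{\cdot,Z}_t$; both are polynomial functions of $x$. *)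

theory Defs
  imports "HOL-Probability.Probability" "HOL-Computational_Algebra.Polynomial"
begin

section \<open>Convergence in probability, filtrations, Brownian motion\<close>

definition conv_in_prob :: "'a measure \<Rightarrow> (nat \<Rightarrow> 'a \<Rightarrow> real) \<Rightarrow> ('a \<Rightarrow> real) \<Rightarrow> bool" where
  "conv_in_prob M Y Z \<longleftrightarrow>
     (\<forall>n. Y n \<in> borel_measurable M) \<and> Z \<in> borel_measurable M \<and>
     (\<forall>\<epsilon>>0. (\<lambda>n. measure M {\<omega> \<in> space M. \<bar>Y n \<omega> - Z \<omega>\<bar> > \<epsilon>}) \<longlonglongrightarrow> 0)"

text \<open>Time runs through \<open>[0, \<infinity>)\<close>; the values of processes and filtrations at
  negative indices are never used.\<close>

definition filtration_on :: "'a measure \<Rightarrow> (real \<Rightarrow> 'a measure) \<Rightarrow> bool" where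
  "filtration_on M F \<longleftrightarrow>
     (\<forall>t\<ge>0. subalgebra M (F t)) \<and> (\<forall>s\<ge>0. \<forall>t\<ge>s. subalgebra (F t) (F s))"

definition adapted :: "(real \<Rightarrow> 'a measure) \<Rightarrow> (real \<Rightarrow> 'a \<Rightarrow> real) \<Rightarrow> bool" where
  "adapted F H \<longleftrightarrow> (\<forall>t\<ge>0. H t \<in> borel_measurable (F t))"

definition jointly_measurable :: "'a measure \<Rightarrow> (real \<Rightarrow> 'a \<Rightarrow> real) \<Rightarrow> bool" where
  "jointly_measurable M H \<longleftrightarrow>
     (\<lambda>(t, \<omega>). H t \<omega>) \<in> borel_measurable (restrict_space borel {0..} \<Otimes>\<^sub>M M)"

definition brownian_motion ::
  "'a measure \<Rightarrow> (real \<Rightarrow> 'a measure) \<Rightarrow> (real \<Rightarrow> 'a \<Rightarrow> real) \<Rightarrow> bool" where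
  "brownian_motion M F W \<longleftrightarrow>
     adapted F W \<and>
     (AE \<omega> in M. W 0 \<omega> = 0) \<and>
     (AE \<omega> in M. continuous_on {0..} (\<lambda>t. W t \<omega>)) \<and>
     (\<forall>s\<ge>0. \<forall>t>s.
        prob_space.indep_set M (sets (F s))
          (sets (vimage_algebra (space M) (\<lambda>\<omega>. W t \<omega> - W s \<omega>) borel)) \<and>
        distributed M lborel (\<lambda>\<omega>. W t \<omega> - W s \<omega>) (normal_density 0 (sqrt (t - s))))"


section \<open>The It\^o integral\<close>

text \<open>A list of triples \<open>(s, u, \<xi>)\<close> represents the elementary process
  \<open>\<Sum> \<xi> 1\<^bsub>(s,u]\<^esub>\<close>.\<close>

type_synonym 'a elementary = "(real \<times> real \<times> ('a \<Rightarrow> real)) list"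

definition elementary_wrt :: "'a measure \<Rightarrow> (real \<Rightarrow> 'a measure) \<Rightarrow> 'a elementary \<Rightarrow> bool" where
  "elementary_wrt M F e \<longleftrightarrow>
     (\<forall>(s, u, \<xi>) \<in> set e. 0 \<le> s \<and> s \<le> u \<and> \<xi> \<in> borel_measurable (F s) \<and>
        (\<exists>B. \<forall>\<omega> \<in> space M. \<bar>\<xi> \<omega>\<bar> \<le> B))"

definition elementary_process :: "'a elementary \<Rightarrow> real \<Rightarrow> 'a \<Rightarrow> real" where
  "elementary_process e r \<omega> = (\<Sum>(s, u, \<xi>) \<leftarrow> e. \<xi> \<omega> * indicator {s<..u} r)"

definition elementary_integral ::
  "(real \<Rightarrow> 'a \<Rightarrow> real) \<Rightarrow> 'a elementary \<Rightarrow> real \<Rightarrow> 'a \<Rightarrow> real" where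
  "elementary_integral W e t \<omega> =
     (\<Sum>(s, u, \<xi>) \<leftarrow> e. \<xi> \<omega> * (W (min t u) \<omega> - W (min t s) \<omega>))"

definition approximates ::
  "'a measure \<Rightarrow> (real \<Rightarrow> 'a measure) \<Rightarrow> (nat \<Rightarrow> 'a elementary) \<Rightarrow> (real \<Rightarrow> 'a \<Rightarrow> real) \<Rightarrow> bool" where
  "approximates M F e H \<longleftrightarrow>
     (\<forall>n. elementary_wrt M F (e n)) \<and>
     (\<forall>t\<ge>0. conv_in_prob M
        (\<lambda>n \<omega>. LINT r:{0..t}|lborel. (elementary_process (e n) r \<omega> - H r \<omega>)\<^sup>2) (\<lambda>_. 0))"

text \<open>The It\^o integral of an adapted measurable process with almost surely locally square
  integrable paths: the common limit in probability of the integrals of the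
  approximating sequences of elementary processes.  Each \<open>I t\<close> is determined up to a null set.\<close>

definition ito_integral ::
  "'a measure \<Rightarrow> (real \<Rightarrow> 'a measure) \<Rightarrow> (real \<Rightarrow> 'a \<Rightarrow> real) \<Rightarrow> (real \<Rightarrow> 'a \<Rightarrow> real) \<Rightarrow>
     (real \<Rightarrow> 'a \<Rightarrow> real) \<Rightarrow> bool" where
  "ito_integral M F W H I \<longleftrightarrow>
     adapted F H \<and> jointly_measurable M H \<and>
     (\<forall>t\<ge>0. AE \<omega> in M. set_integrable lborel {0..t} (\<lambda>r. (H r \<omega>)\<^sup>2)) \<and>
     (\<exists>e. approximates M F e H) \<and>
     (\<forall>e. approximates M F e H \<longrightarrow>
        (\<forall>t\<ge>0. conv_in_prob M (\<lambda>n. elementary_integral W (e n) t) (I t)))"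


section \<open>The CIR process\<close>

definition cir_process ::
  "'a measure \<Rightarrow> (real \<Rightarrow> 'a measure) \<Rightarrow> (real \<Rightarrow> 'a \<Rightarrow> real) \<Rightarrow> real \<Rightarrow> real \<Rightarrow> real \<Rightarrow> real \<Rightarrow>
     (real \<Rightarrow> 'a \<Rightarrow> real) \<Rightarrow> bool" where
  "cir_process M F W a k \<sigma> x X \<longleftrightarrow>
     adapted F X \<and> jointly_measurable M X \<and>
     (AE \<omega> in M. continuous_on {0..} (\<lambda>t. X t \<omega>)) \<and>
     (AE \<omega> in M. \<forall>t\<ge>0. 0 \<le> X t \<omega>) \<and>
     (AE \<omega> in M. X 0 \<omega> = x) \<and>
     (\<exists>I. ito_integral M F W (\<lambda>s \<omega>. sqrt (X s \<omega>)) I \<and>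
        (\<forall>t\<ge>0. AE \<omega> in M.
           X t \<omega> = x + (LINT s:{0..t}|lborel. a - k * X s \<omega>) + \<sigma> * I t \<omega>))"

definition psi :: "real \<Rightarrow> real \<Rightarrow> real" where
  "psi k t = (if k = 0 then t else (1 - exp (- k * t)) / k)"

definition cc :: "real \<Rightarrow> real \<Rightarrow> real \<Rightarrow> real" where
  "cc k \<sigma> t = 4 / (\<sigma>\<^sup>2 * psi k t)"

definition dd :: "real \<Rightarrow> real \<Rightarrow> real \<Rightarrow> real" where
  "dd k \<sigma> t = cc k \<sigma> t * exp (- k * t)"

definition falling_fact :: "nat \<Rightarrow> nat \<Rightarrow> real" where
  "falling_fact i j = (\<Prod>q<j. real i - real q)"

definition delta_cir :: "nat \<Rightarrow> nat \<Rightarrow> real \<Rightarrow> real" where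
  "delta_cir j L v = real (L choose j) * (\<Prod>q\<in>{j..<L}. real q + v)"


section \<open>Poisson variables, polynomials\<close>

text \<open>The library's \<open>poisson_pmf\<close> needs a positive rate; here rate \<open>0\<close> (the case \<open>x = 0\<close>)
  is the point mass at \<open>0\<close>, since \<open>0 ^ 0 = 1\<close>.\<close>

definition poisson_distributed :: "'b measure \<Rightarrow> ('b \<Rightarrow> nat) \<Rightarrow> real \<Rightarrow> bool" where
  "poisson_distributed N P r \<longleftrightarrow>
     P \<in> measurable N (count_space UNIV) \<and>
     (\<forall>n. measure N {\<omega> \<in> space N. P \<omega> = n} = exp (- r) * r ^ n / fact n)"

definition indep_of_family :: "'b measure \<Rightarrow> ('b \<Rightarrow> nat) \<Rightarrow> (nat \<Rightarrow> 'b \<Rightarrow> real) \<Rightarrow> bool" where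
  "indep_of_family N P Z \<longleftrightarrow>
     prob_space.indep_set N
       (sets (vimage_algebra (space N) P (count_space UNIV)))
       (sets (vimage_algebra (space N) (\<lambda>\<omega> i. Z i \<omega>) (\<Pi>\<^sub>M i\<in>UNIV. borel)))"

text \<open>A polynomial function on \<open>[0, \<infinity>)\<close> is identified with the unique polynomial inducing it.\<close>

definition poly_norm :: "real poly \<Rightarrow> real" where
  "poly_norm f = (\<Sum>j\<le>degree f. \<bar>coeff f j\<bar>)"

text \<open>\<open>g\<close> is the polynomial function \<open>x \<mapsto> E[f(Y\<^sup>x)]\<close>, \<open>x \<ge> 0\<close>, the expectations
  being well defined.\<close>

definition mean_poly ::
  "'a measure \<Rightarrow> (real \<Rightarrow> 'a \<Rightarrow> real) \<Rightarrow> real poly \<Rightarrow> real poly \<Rightarrow> bool" where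
  "mean_poly M Y f g \<longleftrightarrow>
     (\<forall>x\<ge>0. has_bochner_integral M (\<lambda>\<omega>. poly f (Y x \<omega>)) (poly g x))"

end

(*
The moments of the CIR process are obtained without the Ito formula and without stopping times.
If theta solves the Riccati equation theta' = k theta - sigma^2/2 theta^2 on [0,t], then
exp(theta_t X_t - theta_0 x - a int_0^t theta) is the stochastic exponential of
sigma int theta sqrt(X) dW.  Replacing sqrt(X) by left-point step processes and theta by a step
function turns it into a product of Gaussian factors whose expectation is exactly 1.  Fatou's lemma
in the limit gives E <= 1 for both, hence exponential moments of X; these bound the
approximating products in L^2, so that no mass is lost and E = 1 for small theta.
Solving the Riccati equation yields E[exp(u X_t)] for small u >= 0, and comparing coefficients of
the power series in u gives, with g = 2/c_t,
  E[X_t^L] = sum_j delta^cir_{j,L}(v) g^(L-j) (e^(-kt) x)^j.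
The factorial moments of the Poisson law give the same formula for hat X with delta^Z.  The
difference involves only j < L - nu, where g^(L-j) = O(t^(nu+1)).
*)

theory Submission
  imports Defs
begin

section \<open>Exponentials of Brownian sums\<close>

text \<open>The integral \<open>I\<close> is known only at single times, up to null sets, as a limit
  in probability for the integrand sqrt(X) alone. This forces two meshes. On each of m+1 coarse
  intervals \<theta> is frozen, so the stochastic part is \<theta> times an increment of
  \<open>I\<close> between two grid times; each coarse interval is cut into n+1 pieces on which
  sqrt(X) is frozen. The limit in n involves finitely many values of \<open>I\<close>, hence one
  almost sure subsequence. The limit in m is pathwise calculus: X is merely continuous, but \<theta>
  is smooth, so summation by parts takes the place of the Ito formula.

  The L^2 bound needs exponential moments of X, which seems circular. It is not: Fatou's bound holds
  at a fixed exponent \<open>u\<^sub>0\<close>, while the exponent that the L^2 bound requires is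
  quadratic in \<theta>, hence below \<open>u\<^sub>0\<close> for small u. Only u >= 0 is used, so
  the exponential series has nonnegative terms and may be integrated termwise; a one-sided interval
  of u still determines the coefficients.\<close>

lemma nn_integral_exp_normal_density:
  fixes z s :: real
  assumes "s > 0"
  shows "(\<integral>\<^sup>+ y. ennreal (normal_density 0 s y) * ennreal (exp (z * y - z\<^sup>2 * s\<^sup>2 / 2)) \<partial>lborel) = 1"
proof -
  have "normal_density 0 s y * exp (z * y - z\<^sup>2 * s\<^sup>2 / 2) = normal_density (z * s\<^sup>2) s y" for y
  proof -
    have "- (y - 0)\<^sup>2 / (2 * s\<^sup>2) + (z * y - z\<^sup>2 * s\<^sup>2 / 2) = - (y - z * s\<^sup>2)\<^sup>2 / (2 * s\<^sup>2)"
      using assms by (simp add: field_simps power2_eq_square)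
    then show ?thesis
      unfolding normal_density_def by (simp add: exp_add [symmetric])
  qed
  then have "(\<integral>\<^sup>+ y. ennreal (normal_density 0 s y) * ennreal (exp (z * y - z\<^sup>2 * s\<^sup>2 / 2)) \<partial>lborel)
      = (\<integral>\<^sup>+ y. ennreal (normal_density (z * s\<^sup>2) s y) \<partial>lborel)"
    by (simp add: ennreal_mult' [symmetric])
  also have "\<dots> = emeasure (density lborel (normal_density (z * s\<^sup>2) s)) UNIV"
    by (simp add: emeasure_density)
  also have "\<dots> = 1"
    using prob_space.emeasure_space_1 [OF prob_space_normal_density [OF assms, of "z * s\<^sup>2"]] by simp
  finally show ?thesis .
qed

text \<open>Rectangles generate the product sigma-algebra, so checking them suffices. The form with
  sigma-algebras fits both applications: a Brownian increment against the past, and the Poisson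
  index (through \<open>G\<close>) against the family of the Z_i.\<close>

lemma (in prob_space) distr_pair_of_indep_set:
  assumes sub: "subalgebra M G"
    and ind: "indep_set (sets G) (sets (vimage_algebra (space M) D R))"
    and D [measurable]: "D \<in> measurable M R"
    and Y: "Y \<in> measurable G S"
  shows "distr M S Y \<Otimes>\<^sub>M distr M R D = distr M (S \<Otimes>\<^sub>M R) (\<lambda>\<omega>. (Y \<omega>, D \<omega>))"
proof -
  have Y' [measurable]: "Y \<in> measurable M S"
    using measurable_from_subalg [OF sub Y] .
  have sG: "space G = space M"
    using sub by (auto simp: subalgebra_def)
  interpret P: prob_space "distr M S Y" by (rule prob_space_distr) simp
  interpret Q: prob_space "distr M R D" by (rule prob_space_distr) simp
  show ?thesis
  proof (rule pair_measure_eqI)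
    fix A B assume A: "A \<in> sets (distr M S Y)" and B: "B \<in> sets (distr M R D)"
    then have [measurable]: "A \<in> sets S" "B \<in> sets R" by auto
    have "Y -` A \<inter> space M \<in> sets G"
      using measurable_sets [OF Y, of A] sG by simp
    moreover have "D -` B \<inter> space M \<in> sets (vimage_algebra (space M) D R)"
      by (rule in_vimage_algebra) simp
    ultimately have "prob ((Y -` A \<inter> space M) \<inter> (D -` B \<inter> space M))
        = prob (Y -` A \<inter> space M) * prob (D -` B \<inter> space M)"
      by (rule indep_setD [OF ind])
    moreover have "(\<lambda>\<omega>. (Y \<omega>, D \<omega>)) -` (A \<times> B) \<inter> space M
        = (Y -` A \<inter> space M) \<inter> (D -` B \<inter> space M)"
      by auto
    ultimately show "emeasure (distr M S Y) A * emeasure (distr M R D) B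
        = emeasure (distr M (S \<Otimes>\<^sub>M R) (\<lambda>\<omega>. (Y \<omega>, D \<omega>))) (A \<times> B)"
      by (simp add: emeasure_distr emeasure_eq_measure ennreal_mult')
  qed (auto intro!: P.sigma_finite_measure_axioms Q.sigma_finite_measure_axioms)
qed

text \<open>Given \<open>G\<close>, the exponential factor has mean 1, because \<open>z\<close> is
  then frozen and \<open>D\<close> is an independent Gaussian. Fubini for the joint law of
  (\<open>g\<close>, \<open>z\<close>) and \<open>D\<close> replaces conditional expectations;
  working in \<open>ennreal\<close> lets \<open>g\<close> and \<open>z\<close> be unbounded.\<close>

lemma (in prob_space) nn_integral_exp_gaussian_increment:
  assumes sub: "subalgebra M G"
    and ind: "indep_set (sets G) (sets (vimage_algebra (space M) D borel))"
    and D: "distributed M lborel D (normal_density 0 s)"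
    and s: "s > 0"
    and g: "g \<in> borel_measurable G" and z: "z \<in> borel_measurable G"
  shows "(\<integral>\<^sup>+ \<omega>. g \<omega> * ennreal (exp (z \<omega> * D \<omega> - (z \<omega>)\<^sup>2 * s\<^sup>2 / 2)) \<partial>M)
       = (\<integral>\<^sup>+ \<omega>. g \<omega> \<partial>M)"
proof -
  have D': "D \<in> borel_measurable M"
    using distributed_measurable [OF D] by simp
  have zM [measurable]: "z \<in> borel_measurable M" and gM [measurable]: "g \<in> borel_measurable M"
    using measurable_from_subalg [OF sub] g z by auto
  have Y: "(\<lambda>\<omega>. (g \<omega>, z \<omega>)) \<in> measurable G (borel \<Otimes>\<^sub>M borel)"
    using g z by measurable
  define P where "P = distr M (borel \<Otimes>\<^sub>M borel) (\<lambda>\<omega>. (g \<omega>, z \<omega>))"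
  define Q where "Q = distr M borel D"
  have eq: "P \<Otimes>\<^sub>M Q = distr M ((borel \<Otimes>\<^sub>M borel) \<Otimes>\<^sub>M borel) (\<lambda>\<omega>. ((g \<omega>, z \<omega>), D \<omega>))"
    unfolding P_def Q_def by (rule distr_pair_of_indep_set [OF sub ind D' Y])
  have Qd: "Q = density lborel (normal_density 0 s)"
    using distributed_distr_eq_density [OF D] unfolding Q_def
    by (simp cong: distr_cong)
  interpret Q: prob_space Q
    unfolding Q_def by (rule prob_space_distr) (use D' in simp)
  have [simp]: "sets P = sets (borel \<Otimes>\<^sub>M borel)" "sets Q = sets borel"
    by (auto simp: P_def Q_def)
  have [measurable_cong]: "sets P = sets (borel \<Otimes>\<^sub>M borel)" "sets Q = sets borel"
    by auto
  have inner: "(\<integral>\<^sup>+ y. fst p * ennreal (exp (snd p * y - (snd p)\<^sup>2 * s\<^sup>2 / 2)) \<partial>Q) = fst p"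
    for p :: "ennreal \<times> real"
  proof -
    have "(\<integral>\<^sup>+ y. fst p * ennreal (exp (snd p * y - (snd p)\<^sup>2 * s\<^sup>2 / 2)) \<partial>Q)
        = fst p * (\<integral>\<^sup>+ y. ennreal (exp (snd p * y - (snd p)\<^sup>2 * s\<^sup>2 / 2)) \<partial>Q)"
      by (intro nn_integral_cmult) measurable
    also have "(\<integral>\<^sup>+ y. ennreal (exp (snd p * y - (snd p)\<^sup>2 * s\<^sup>2 / 2)) \<partial>Q) = 1"
      unfolding Qd using nn_integral_exp_normal_density [OF s, of "snd p"]
      by (subst nn_integral_density) auto
    finally show ?thesis by simp
  qed
  have "(\<integral>\<^sup>+ \<omega>. g \<omega> * ennreal (exp (z \<omega> * D \<omega> - (z \<omega>)\<^sup>2 * s\<^sup>2 / 2)) \<partial>M)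
     = (\<integral>\<^sup>+ q. fst (fst q) * ennreal (exp (snd (fst q) * snd q - (snd (fst q))\<^sup>2 * s\<^sup>2 / 2)) \<partial>(P \<Otimes>\<^sub>M Q))"
    unfolding eq using D' by (subst nn_integral_distr) (auto simp: case_prod_beta)
  also have "\<dots> = (\<integral>\<^sup>+ p. (\<integral>\<^sup>+ y. fst p * ennreal (exp (snd p * y - (snd p)\<^sup>2 * s\<^sup>2 / 2)) \<partial>Q) \<partial>P)"
    by (subst Q.nn_integral_fst [symmetric]) (auto simp: case_prod_beta)
  also have "\<dots> = (\<integral>\<^sup>+ p. fst p \<partial>P)"
    by (simp only: inner)
  also have "\<dots> = (\<integral>\<^sup>+ \<omega>. g \<omega> \<partial>M)"
    unfolding P_def by (subst nn_integral_distr) auto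
  finally show ?thesis .
qed

text \<open>The last factor is peeled off: all earlier factors, and its own coefficient, are
  measurable at the time where its increment starts.\<close>

lemma brownian_nn_integral_exp:
  assumes "prob_space M" and filt: "filtration_on M F" and bm: "brownian_motion M F W"
    and h: "h > 0"
    and z: "\<And>j. z j \<in> borel_measurable (F (real j * h))"
  shows "(\<integral>\<^sup>+ \<omega>. ennreal (exp (\<Sum>j<n. z j \<omega> * (W (real (Suc j) * h) \<omega> - W (real j * h) \<omega>)
            - (z j \<omega>)\<^sup>2 * h / 2)) \<partial>M) = 1"
proof -
  interpret prob_space M by fact
  have subF: "subalgebra M (F s)" if "s \<ge> 0" for s
    using filt that by (auto simp: filtration_on_def)
  have subFF: "subalgebra (F t) (F s)" if "0 \<le> s" "s \<le> t" for s t
    using filt that by (auto simp: filtration_on_def)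
  have WF: "W s \<in> borel_measurable (F t)" if "0 \<le> s" "s \<le> t" for s t
    using bm that measurable_from_subalg [OF subFF [OF that]]
    by (auto simp: brownian_motion_def adapted_def)
  have zF: "z j \<in> borel_measurable (F t)" if "real j * h \<le> t" for j t
    using h that by (intro measurable_from_subalg [OF subFF z]) auto
  show ?thesis
  proof (induction n)
    case 0
    show ?case by (simp add: emeasure_space_1)
  next
    case (Suc n)
    define E where "E \<omega> = (\<Sum>j<n. z j \<omega> * (W (real (Suc j) * h) \<omega> - W (real j * h) \<omega>)
            - (z j \<omega>)\<^sup>2 * h / 2)" for \<omega>
    let ?s = "real n * h" and ?t = "real (Suc n) * h"
    let ?D = "\<lambda>\<omega>. W ?t \<omega> - W ?s \<omega>"
    have st: "0 \<le> ?s" "?s < ?t" and ts: "?t - ?s = h"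
      using h by (auto simp: algebra_simps)
    have E: "E \<in> borel_measurable (F ?s)"
      unfolding E_def using h
      by (intro borel_measurable_sum borel_measurable_diff borel_measurable_times borel_measurable_divide
          borel_measurable_power borel_measurable_const zF WF mult_right_mono)
         auto
    have b: "indep_set (sets (F ?s)) (sets (vimage_algebra (space M) ?D borel))"
            "distributed M lborel ?D (normal_density 0 (sqrt h))"
      using bm st ts unfolding brownian_motion_def by metis+
    have "(\<integral>\<^sup>+ \<omega>. ennreal (exp (\<Sum>j<Suc n. z j \<omega> * (W (real (Suc j) * h) \<omega> - W (real j * h) \<omega>)
            - (z j \<omega>)\<^sup>2 * h / 2)) \<partial>M)
        = (\<integral>\<^sup>+ \<omega>. ennreal (exp (E \<omega>)) *
             ennreal (exp (z n \<omega> * ?D \<omega> - (z n \<omega>)\<^sup>2 * (sqrt h)\<^sup>2 / 2)) \<partial>M)"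
      using h by (simp add: E_def ennreal_mult' [symmetric] exp_add [symmetric] algebra_simps del: of_nat_Suc)
    also have "\<dots> = (\<integral>\<^sup>+ \<omega>. ennreal (exp (E \<omega>)) \<partial>M)"
      using E h by (intro nn_integral_exp_gaussian_increment [OF subF [OF st(1)] b]) (auto intro: z)
    also have "\<dots> = 1"
      using Suc.IH by (simp add: E_def)
    finally show ?case .
  qed
qed

section \<open>Limits of expectations\<close>

lemma (in prob_space) conv_in_prob_of_AE:
  assumes [measurable]: "\<And>n. Y n \<in> borel_measurable M" "Z \<in> borel_measurable M"
    and AE: "AE \<omega> in M. (\<lambda>n. Y n \<omega>) \<longlonglongrightarrow> Z \<omega>"
  shows "conv_in_prob M Y Z"
  unfolding conv_in_prob_def
proof (intro conjI allI impI)
  fix e :: real assume e: "e > 0"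
  let ?A = "\<lambda>n. {\<omega> \<in> space M. \<bar>Y n \<omega> - Z \<omega>\<bar> > e}"
  have "(\<lambda>n. \<integral>\<omega>. indicator (?A n) \<omega> \<partial>M) \<longlonglongrightarrow> (\<integral>\<omega>. (0::real) \<partial>M)"
  proof (rule integral_dominated_convergence [where w = "\<lambda>_. 1"])
    show "AE \<omega> in M. (\<lambda>n. indicator (?A n) \<omega> :: real) \<longlonglongrightarrow> 0"
      using AE
    proof eventually_elim
      case (elim \<omega>)
      have "eventually (\<lambda>n. \<bar>Y n \<omega> - Z \<omega>\<bar> < e) sequentially"
        using tendstoD [OF elim e] by (simp add: dist_real_def)
      then have "eventually (\<lambda>n. indicator (?A n) \<omega> = (0::real)) sequentially"
        by eventually_elim (auto simp: indicator_def)
      then show ?case by (rule tendsto_eventually)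
    qed
  qed (auto simp: indicator_def)
  then show "(\<lambda>n. measure M (?A n)) \<longlonglongrightarrow> 0" by simp
qed auto

text \<open>Convergence in probability makes the truncated distances
  \<open>min 1 \<bar>Y - Z\<bar>\<close> tend to 0 in L^1; summing them over \<open>A\<close> yields
  one subsequence that serves all indices at once.\<close>

lemma (in prob_space) conv_in_prob_AE_subseq:
  assumes "finite A" and conv: "\<And>i. i \<in> A \<Longrightarrow> conv_in_prob M (Y i) (Z i)"
  shows "\<exists>r::nat \<Rightarrow> nat. strict_mono r \<and> (AE \<omega> in M. \<forall>i\<in>A. (\<lambda>n. Y i (r n) \<omega>) \<longlonglongrightarrow> Z i \<omega>)"
proof -
  define u where "u n \<omega> = (\<Sum>i\<in>A. min 1 \<bar>Y i n \<omega> - Z i \<omega>\<bar>)" for n \<omega>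
  have Y [measurable]: "\<And>i n. i \<in> A \<Longrightarrow> Y i n \<in> borel_measurable M"
    and Z [measurable]: "\<And>i. i \<in> A \<Longrightarrow> Z i \<in> borel_measurable M"
    using conv by (auto simp: conv_in_prob_def)
  have int1: "integrable M (\<lambda>\<omega>. min 1 \<bar>Y i n \<omega> - Z i \<omega>\<bar>)" if "i \<in> A" for i n
    using that by (intro integrable_const_bound [where B = 1]) auto
  have lim1: "(\<lambda>n. \<integral>\<omega>. min 1 \<bar>Y i n \<omega> - Z i \<omega>\<bar> \<partial>M) \<longlonglongrightarrow> 0" if i: "i \<in> A" for i
  proof (rule LIMSEQ_I)
    fix e :: real assume e: "e > 0"
    define B where "B n = {\<omega> \<in> space M. \<bar>Y i n \<omega> - Z i \<omega>\<bar> > e / 2}" for n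
    have [measurable]: "B n \<in> events" for n
      unfolding B_def using i by measurable
    have "(\<lambda>n. measure M (B n)) \<longlonglongrightarrow> 0"
      using conv [OF i] half_gt_zero [OF e] unfolding conv_in_prob_def B_def by blast
    then obtain n0 where n0: "\<And>n. n \<ge> n0 \<Longrightarrow> norm (measure M (B n) - 0) < e / 2"
      using LIMSEQ_D [OF _ half_gt_zero [OF e]] by blast
    have "norm ((\<integral>\<omega>. min 1 \<bar>Y i n \<omega> - Z i \<omega>\<bar> \<partial>M) - 0) < e" if n: "n \<ge> n0" for n
    proof -
      have "(\<integral>\<omega>. min 1 \<bar>Y i n \<omega> - Z i \<omega>\<bar> \<partial>M) \<le> (\<integral>\<omega>. e / 2 + indicator (B n) \<omega> \<partial>M)"
      proof (rule integral_mono [OF int1 [OF i]])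
        show "integrable M (\<lambda>\<omega>. e / 2 + indicator (B n) \<omega>)"
          by (intro Bochner_Integration.integrable_add integrable_const integrable_real_indicator)
            (auto simp: emeasure_eq_measure)
        show "min 1 \<bar>Y i n \<omega> - Z i \<omega>\<bar> \<le> e / 2 + indicator (B n) \<omega>" if "\<omega> \<in> space M" for \<omega>
          using that e by (auto simp: B_def min_def indicator_def)
      qed
      also have "\<dots> = e / 2 + measure M (B n)"
        by (subst Bochner_Integration.integral_add) (auto simp: prob_space emeasure_eq_measure intro!: integrable_real_indicator)
      finally have "(\<integral>\<omega>. min 1 \<bar>Y i n \<omega> - Z i \<omega>\<bar> \<partial>M) \<le> e / 2 + measure M (B n)" .
      moreover have "0 \<le> (\<integral>\<omega>. min 1 \<bar>Y i n \<omega> - Z i \<omega>\<bar> \<partial>M)"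
        by (intro integral_nonneg_AE) auto
      ultimately show ?thesis
        using n0 [OF n] by simp
    qed
    then show "\<exists>n0. \<forall>n\<ge>n0. norm ((\<integral>\<omega>. min 1 \<bar>Y i n \<omega> - Z i \<omega>\<bar> \<partial>M) - 0) < e" by blast
  qed
  have nn: "u n \<omega> \<ge> 0" for n \<omega>
    unfolding u_def by (intro sum_nonneg) auto
  have "(\<lambda>n. \<Sum>i\<in>A. \<integral>\<omega>. min 1 \<bar>Y i n \<omega> - Z i \<omega>\<bar> \<partial>M) \<longlonglongrightarrow> (\<Sum>i\<in>A. 0)"
    by (intro tendsto_sum lim1)
  moreover have "(\<integral>\<omega>. u n \<omega> \<partial>M) = (\<Sum>i\<in>A. \<integral>\<omega>. min 1 \<bar>Y i n \<omega> - Z i \<omega>\<bar> \<partial>M)" for n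
    unfolding u_def by (intro Bochner_Integration.integral_sum int1)
  ultimately have "(\<lambda>n. \<integral>\<omega>. norm (u n \<omega>) \<partial>M) \<longlonglongrightarrow> 0"
    using nn by simp
  moreover have "integrable M (u n)" for n
    unfolding u_def using int1 by (intro Bochner_Integration.integrable_sum) auto
  ultimately obtain r where r: "strict_mono r" "AE \<omega> in M. (\<lambda>n. u (r n) \<omega>) \<longlonglongrightarrow> 0"
    using tendsto_L1_AE_subseq [of M u] by auto
  have "AE \<omega> in M. \<forall>i\<in>A. (\<lambda>n. Y i (r n) \<omega>) \<longlonglongrightarrow> Z i \<omega>"
    using r(2)
  proof eventually_elim
    case (elim \<omega>)
    show ?case
    proof
      fix i assume i: "i \<in> A"
      have le: "min 1 \<bar>Y i (r n) \<omega> - Z i \<omega>\<bar> \<le> u (r n) \<omega>" for n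
        unfolding u_def using \<open>finite A\<close> i
        by (intro member_le_sum [where f = "\<lambda>i. min 1 \<bar>Y i (r n) \<omega> - Z i \<omega>\<bar>"]) auto
      show "(\<lambda>n. Y i (r n) \<omega>) \<longlonglongrightarrow> Z i \<omega>"
      proof (rule LIMSEQ_I)
        fix e :: real assume e: "e > 0"
        obtain n0 where "\<And>n. n \<ge> n0 \<Longrightarrow> norm (u (r n) \<omega> - 0) < min 1 e"
          using LIMSEQ_D [OF elim, of "min 1 e"] e by auto
        then have "norm (Y i (r n) \<omega> - Z i \<omega>) < e" if "n \<ge> n0" for n
          using le [of n] that by (fastforce simp: min_def split: if_splits)
        then show "\<exists>n0. \<forall>n\<ge>n0. norm (Y i (r n) \<omega> - Z i \<omega>) < e" by blast
      qed
    qed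
  qed
  with r(1) show ?thesis by blast
qed

lemma nn_integral_AE_lim_le:
  fixes Y :: "nat \<Rightarrow> 'a \<Rightarrow> real"
  assumes [measurable]: "\<And>n. Y n \<in> borel_measurable M"
    and AE: "AE \<omega> in M. (\<lambda>n. Y n \<omega>) \<longlonglongrightarrow> Z \<omega>"
    and le: "\<And>n. (\<integral>\<^sup>+ \<omega>. ennreal (Y n \<omega>) \<partial>M) \<le> B"
  shows "(\<integral>\<^sup>+ \<omega>. ennreal (Z \<omega>) \<partial>M) \<le> B"
proof -
  have "(\<integral>\<^sup>+ \<omega>. ennreal (Z \<omega>) \<partial>M) = (\<integral>\<^sup>+ \<omega>. liminf (\<lambda>n. ennreal (Y n \<omega>)) \<partial>M)"
  proof (rule nn_integral_cong_AE, use AE in eventually_elim)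
    case (elim \<omega>)
    show ?case
      using lim_imp_Liminf [OF _ tendsto_ennrealI [OF elim]] by simp
  qed
  also have "\<dots> \<le> liminf (\<lambda>n. \<integral>\<^sup>+ \<omega>. ennreal (Y n \<omega>) \<partial>M)"
    by (rule nn_integral_liminf) simp
  also have "\<dots> \<le> liminf (\<lambda>n::nat. B)"
    by (intro Liminf_mono always_eventually allI le)
  also have "\<dots> = B"
    by (simp add: Liminf_const)
  finally show ?thesis .
qed

text \<open>Boundedness in \<open>L\<^sup>2\<close> excludes the loss of mass that Fatou's lemma permits.\<close>

lemma (in prob_space) nn_integral_AE_lim_eq_1:
  fixes Y :: "nat \<Rightarrow> 'a \<Rightarrow> real"
  assumes [measurable]: "\<And>n. Y n \<in> borel_measurable M" "Z \<in> borel_measurable M"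
    and nn: "\<And>n \<omega>. 0 \<le> Y n \<omega>" "\<And>\<omega>. 0 \<le> Z \<omega>"
    and AE: "AE \<omega> in M. (\<lambda>n. Y n \<omega>) \<longlonglongrightarrow> Z \<omega>"
    and one: "\<And>n. (\<integral>\<^sup>+ \<omega>. ennreal (Y n \<omega>) \<partial>M) = 1"
    and sq: "\<And>n. (\<integral>\<^sup>+ \<omega>. ennreal ((Y n \<omega>)\<^sup>2) \<partial>M) \<le> ennreal B" and B: "B \<ge> 0"
  shows "(\<integral>\<^sup>+ \<omega>. ennreal (Z \<omega>) \<partial>M) = 1"
proof -
  have le: "(\<integral>\<^sup>+ \<omega>. ennreal (Z \<omega>) \<partial>M) \<le> 1"
    by (rule nn_integral_AE_lim_le [OF _ AE]) (auto simp: one)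
  have iY: "integrable M (Y n)" for n
    using one [of n] nn by (intro integrableI_nonneg) auto
  have EY: "expectation (Y n) = 1" for n
    using one [of n] nn by (subst integral_eq_nn_integral) auto
  have iY2: "integrable M (\<lambda>\<omega>. (Y n \<omega>)\<^sup>2)" for n
    using sq [of n] by (intro integrableI_nonneg) (auto simp: top_unique less_top [symmetric])
  have EY2: "expectation (\<lambda>\<omega>. (Y n \<omega>)\<^sup>2) \<le> B" for n
    using sq [of n] B by (subst integral_eq_nn_integral) (auto intro: enn2real_leI)
  have iZ: "integrable M Z"
    using le nn by (intro integrableI_nonneg) (auto simp: top_unique less_top [symmetric])
  have imin: "integrable M (\<lambda>\<omega>. min (Y n \<omega>) K)" "integrable M (\<lambda>\<omega>. min (Z \<omega>) K)" if "K > 0" for n K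
    using that nn by (auto intro!: integrable_const_bound [where B = K])
  \<comment> \<open>Truncation at \<open>K\<close> loses at most B/K of the mass, uniformly in n.
    The truncated variables converge by domination, and \<open>K\<close> tends to infinity at the
    end.\<close>
  have low: "1 - B / K \<le> expectation Z" if K: "K > 0" for K
  proof -
    have "1 - B / K \<le> expectation (\<lambda>\<omega>. min (Y n \<omega>) K)" for n
    proof -
      have pw: "Y n \<omega> \<le> min (Y n \<omega>) K + (Y n \<omega>)\<^sup>2 / K" for \<omega>
      proof (cases "Y n \<omega> \<le> K")
        case False
        then have "Y n \<omega> * K \<le> (Y n \<omega>)\<^sup>2"
          using K by (simp add: power2_eq_square)
        then have "Y n \<omega> \<le> (Y n \<omega>)\<^sup>2 / K"
          using K by (simp add: field_simps)
        with False K show ?thesis by simp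
      qed (use K in auto)
      have "1 = expectation (Y n)"
        by (simp add: EY)
      also have "\<dots> \<le> expectation (\<lambda>\<omega>. min (Y n \<omega>) K + (Y n \<omega>)\<^sup>2 / K)"
        using iY imin [OF K] iY2 pw by (intro integral_mono) auto
      also have "\<dots> = expectation (\<lambda>\<omega>. min (Y n \<omega>) K) + expectation (\<lambda>\<omega>. (Y n \<omega>)\<^sup>2) / K"
        using imin [OF K] iY2 by simp
      also have "\<dots> \<le> expectation (\<lambda>\<omega>. min (Y n \<omega>) K) + B / K"
        using EY2 K by (intro add_left_mono divide_right_mono) auto
      finally show ?thesis by simp
    qed
    moreover have "(\<lambda>n. expectation (\<lambda>\<omega>. min (Y n \<omega>) K)) \<longlonglongrightarrow> expectation (\<lambda>\<omega>. min (Z \<omega>) K)"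
    proof (rule integral_dominated_convergence [where w = "\<lambda>_. K"])
      show "AE \<omega> in M. (\<lambda>n. min (Y n \<omega>) K) \<longlonglongrightarrow> min (Z \<omega>) K"
        using AE by eventually_elim (intro tendsto_intros)
    qed (use K nn in auto)
    ultimately have "1 - B / K \<le> expectation (\<lambda>\<omega>. min (Z \<omega>) K)"
      by (intro LIMSEQ_le_const) auto
    also have "\<dots> \<le> expectation Z"
      using imin [OF K] iZ by (intro integral_mono) auto
    finally show ?thesis .
  qed
  have "(\<lambda>n. 1 - B / real (Suc n)) \<longlonglongrightarrow> 1 - 0"
    by (intro tendsto_intros LIMSEQ_Suc [OF lim_const_over_n])
  then have "1 - 0 \<le> expectation Z"
    by (rule LIMSEQ_le_const2) (use low in auto)
  then have "1 \<le> (\<integral>\<^sup>+ \<omega>. ennreal (Z \<omega>) \<partial>M)"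
    using iZ nn by (subst nn_integral_eq_integral) auto
  with le show ?thesis by (rule antisym)
qed

section \<open>Riemann sums and the Riccati equation\<close>

lemma integral_sum_grid:
  fixes g :: "real \<Rightarrow> real"
  assumes g: "continuous_on {c..c + real n * h} g" and h: "h \<ge> 0"
  shows "integral {c..c + real n * h} g = (\<Sum>j<n. integral {c + real j * h..c + real (Suc j) * h} g)"
  using g
proof (induction n)
  case (Suc n)
  have le: "c + real n * h \<le> c + real (Suc n) * h"
    using h by (simp add: algebra_simps)
  have "g integrable_on {c..c + real (Suc n) * h}"
    by (rule integrable_continuous_interval [OF Suc.prems])
  then have "integral {c..c + real n * h} g + integral {c + real n * h..c + real (Suc n) * h} g
      = integral {c..c + real (Suc n) * h} g"
    using h le by (intro Henstock_Kurzweil_Integration.integral_combine) auto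
  moreover have "continuous_on {c..c + real n * h} g"
    using le by (intro continuous_on_subset [OF Suc.prems]) auto
  ultimately show ?case
    using Suc.IH by simp
qed simp

lemma riemann_sum_tendsto_integral:
  fixes g :: "real \<Rightarrow> real"
  assumes g: "continuous_on {c..c + l} g" and l: "l > 0"
  shows "(\<lambda>n. l / real (Suc n) * (\<Sum>j<Suc n. g (c + real j * (l / real (Suc n)))))
           \<longlonglongrightarrow> integral {c..c + l} g"
proof (rule LIMSEQ_I)
  fix e :: real assume e: "e > 0"
  have "uniformly_continuous_on {c..c + l} g"
    by (intro compact_uniformly_continuous g compact_Icc)
  then obtain d where d: "d > 0"
      "\<And>x y. x \<in> {c..c + l} \<Longrightarrow> y \<in> {c..c + l} \<Longrightarrow> dist y x < d \<Longrightarrow> dist (g y) (g x) < e / (2 * l)"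
    unfolding uniformly_continuous_on_def using e l by (metis divide_pos_pos mult_pos_pos zero_less_numeral)
  have "(\<lambda>n. l / real (Suc n)) \<longlonglongrightarrow> 0"
    by (intro LIMSEQ_Suc [OF lim_const_over_n])
  then obtain n0 where n0: "\<And>n. n \<ge> n0 \<Longrightarrow> norm (l / real (Suc n) - 0) < d"
    using LIMSEQ_D d(1) by blast
  have "norm (l / real (Suc n) * (\<Sum>j<Suc n. g (c + real j * (l / real (Suc n)))) - integral {c..c + l} g) < e"
    if n: "n \<ge> n0" for n
  proof -
    define h where "h = l / real (Suc n)"
    have h: "h > 0" "h < d" "real (Suc n) * h = l"
      using n0 [OF n] l by (auto simp: h_def)
    have piece: "\<bar>h * g (c + real j * h) - integral {c + real j * h..c + real (Suc j) * h} g\<bar> \<le> h * (e / (2 * l))"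
      if j: "j < Suc n" for j
    proof -
      have "real (Suc j) * h \<le> real (Suc n) * h"
        using j h by (intro mult_right_mono) auto
      then have sub: "{c + real j * h..c + real (Suc j) * h} \<subseteq> {c..c + l}"
        using h by auto
      have Sj: "real (Suc j) * h = real j * h + h" by (simp add: algebra_simps)
      have int: "g integrable_on {c + real j * h..c + real (Suc j) * h}"
        by (intro integrable_continuous_interval continuous_on_subset [OF g] sub)
      have "((\<lambda>s. g (c + real j * h) - g s) has_integral
          (h * g (c + real j * h) - integral {c + real j * h..c + real (Suc j) * h} g))
          (cbox (c + real j * h) (c + real (Suc j) * h))"
        using has_integral_diff [OF has_integral_const_real [of "g (c + real j * h)"] integrable_integral [OF int]] h Sj
        by simp
      then have "norm (h * g (c + real j * h) - integral {c + real j * h..c + real (Suc j) * h} g)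
          \<le> e / (2 * l) * measure lborel (cbox (c + real j * h) (c + real (Suc j) * h))"
      proof (rule has_integral_bound [rotated])
        fix s assume s: "s \<in> cbox (c + real j * h) (c + real (Suc j) * h)"
        then have "dist (c + real j * h) s < d"
          using h Sj by (auto simp: dist_real_def)
        moreover have "s \<in> {c..c + l}" "c + real j * h \<in> {c..c + l}"
          using s sub h Sj by (auto simp: subset_iff)
        ultimately show "norm (g (c + real j * h) - g s) \<le> e / (2 * l)"
          using d(2) [of s "c + real j * h"] by (simp add: dist_real_def)
      qed (use e l in auto)
      then show ?thesis
        using h Sj by (simp add: mult.commute)
    qed
    have "integral {c..c + l} g = (\<Sum>j<Suc n. integral {c + real j * h..c + real (Suc j) * h} g)"
      using integral_sum_grid [of c "Suc n" h g] g h by simp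
    then have "\<bar>h * (\<Sum>j<Suc n. g (c + real j * h)) - integral {c..c + l} g\<bar>
        = \<bar>\<Sum>j<Suc n. h * g (c + real j * h) - integral {c + real j * h..c + real (Suc j) * h} g\<bar>"
      by (simp only: sum_subtractf sum_distrib_left)
    also have "\<dots> \<le> (\<Sum>j<Suc n. h * (e / (2 * l)))"
      by (rule order_trans [OF sum_abs]) (intro sum_mono piece, simp)
    also have "\<dots> = e / 2"
      using h l by (simp add: field_simps)
    also have "\<dots> < e" using e by simp
    finally show ?thesis by (simp add: h_def)
  qed
  then show "\<exists>n0. \<forall>n\<ge>n0. norm (l / real (Suc n) * (\<Sum>j<Suc n. g (c + real j * (l / real (Suc n))))
      - integral {c..c + l} g) < e" by blast
qed

text \<open>The Riccati equation for \<open>\<theta>\<close> makes the integrand of the error vanish on the diagonal.\<close>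

lemma riccati_exponent_tendsto:
  fixes X \<theta> A :: "real \<Rightarrow> real" and a b k t :: real
  defines "p \<equiv> \<lambda>m i. real i * (t / real (Suc m))"
  assumes t: "t > 0" and X: "continuous_on {0..t} X"
    and \<theta>: "\<And>s. s \<in> {0..t} \<Longrightarrow> (\<theta> has_real_derivative (k * \<theta> s - b * (\<theta> s)\<^sup>2)) (at s within {0..t})"
    and A: "\<And>s. s \<in> {0..t} \<Longrightarrow> (A has_real_derivative (a * \<theta> s)) (at s within {0..t})"
  shows "(\<lambda>m. \<Sum>i<Suc m. \<theta> (p m i) * (X (p m (Suc i)) - X (p m i))
            - \<theta> (p m i) * integral {p m i..p m (Suc i)} (\<lambda>s. a - k * X s)
            - b * (\<theta> (p m i))\<^sup>2 * integral {p m i..p m (Suc i)} X)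
         \<longlonglongrightarrow> \<theta> t * X t - \<theta> 0 * X 0 - (A t - A 0)"
proof (rule LIMSEQ_I)
  fix e :: real assume e: "e > 0"
  have c\<theta>: "continuous_on {0..t} \<theta>"
    using \<theta> by (intro DERIV_continuous_on) auto
  \<comment> \<open>Here r and q are the end points of a grid interval and s is the integration
    variable. Since \<theta>_r (X_q - X_r) = (\<theta>_q X_q - \<theta>_r X_r) - X_q (\<theta>_q -
    \<theta>_r), each summand minus the increment of \<open>R\<close> = \<theta> X - A is the
    integral of \<Phi>(r, s, q) over [r, q]. Uniform continuity makes \<Phi> small on short
    intervals, and the increments of \<open>R\<close> telescope to the limit.\<close>
  define \<Phi> where "\<Phi> = (\<lambda>(r, s, q). a * \<theta> s - a * \<theta> r + k * \<theta> r * X s - b * (\<theta> r)\<^sup>2 * X s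
      - X q * (k * \<theta> s - b * (\<theta> s)\<^sup>2))"
  have "continuous_on ({0..t} \<times> {0..t} \<times> {0..t}) \<Phi>"
    unfolding \<Phi>_def case_prod_beta
    by (intro continuous_intros continuous_on_compose2 [OF X] continuous_on_compose2 [OF c\<theta>]) auto
  then have "uniformly_continuous_on ({0..t} \<times> {0..t} \<times> {0..t}) \<Phi>"
    by (intro compact_uniformly_continuous compact_Times compact_Icc)
  then obtain d where d: "d > 0"
      "\<And>x y. x \<in> {0..t} \<times> {0..t} \<times> {0..t} \<Longrightarrow> y \<in> {0..t} \<times> {0..t} \<times> {0..t} \<Longrightarrow> dist y x < d
         \<Longrightarrow> dist (\<Phi> y) (\<Phi> x) < e / (2 * t)"
    unfolding uniformly_continuous_on_def using e t by (metis divide_pos_pos mult_pos_pos zero_less_numeral)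
  have small: "\<bar>\<Phi> (r, s, q)\<bar> \<le> e / (2 * t)"
    if "r \<in> {0..t}" "s \<in> {0..t}" "q \<in> {0..t}" "\<bar>r - s\<bar> < d / 2" "\<bar>q - s\<bar> < d / 2" for r s q
  proof -
    have "dist (r, s, q) (s, s, s) \<le> \<bar>r - s\<bar> + \<bar>q - s\<bar>"
      using sqrt_sum_squares_le_sum_abs [of "r - s" "q - s"]
      by (simp add: dist_prod_def dist_real_def)
    also have "\<dots> < d" using that by simp
    finally have "dist (\<Phi> (r, s, q)) (\<Phi> (s, s, s)) < e / (2 * t)"
      using that by (intro d(2)) auto
    moreover have "\<Phi> (s, s, s) = 0"
      by (simp add: \<Phi>_def algebra_simps)
    ultimately show ?thesis by (simp add: dist_real_def)
  qed
  have "(\<lambda>m. t / real (Suc m)) \<longlonglongrightarrow> 0"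
    by (intro LIMSEQ_Suc [OF lim_const_over_n])
  then obtain m0 where m0: "\<And>m. m \<ge> m0 \<Longrightarrow> norm (t / real (Suc m) - 0) < d / 2"
    using LIMSEQ_D d(1) by (metis half_gt_zero)
  let ?T = "\<lambda>m i. \<theta> (p m i) * (X (p m (Suc i)) - X (p m i))
            - \<theta> (p m i) * integral {p m i..p m (Suc i)} (\<lambda>s. a - k * X s)
            - b * (\<theta> (p m i))\<^sup>2 * integral {p m i..p m (Suc i)} X"
  have "norm ((\<Sum>i<Suc m. ?T m i) - (\<theta> t * X t - \<theta> 0 * X 0 - (A t - A 0))) < e" if m: "m \<ge> m0" for m
  proof -
    define h where "h = t / real (Suc m)"
    have h: "h > 0" "h < d / 2" "real (Suc m) * h = t"
      using m0 [OF m] t by (auto simp: h_def)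
    have p: "p m i = real i * h" for i
      by (simp add: p_def h_def)
    define R where "R i = \<theta> (p m i) * X (p m i) - A (p m i)" for i
    have piece: "\<bar>?T m i - (R (Suc i) - R i)\<bar> \<le> h * (e / (2 * t))" if i: "i < Suc m" for i
    proof -
      let ?r = "p m i" and ?q = "p m (Suc i)"
      have "?q \<le> real (Suc m) * h"
        unfolding p using i h by (intro mult_right_mono) auto
      then have rq: "?q = ?r + h" "0 \<le> ?r" "?q \<le> t"
        using h by (auto simp: p algebra_simps)
      then have sub: "{?r..?q} \<subseteq> {0..t}" by auto
      have iX: "(X has_integral integral {?r..?q} X) {?r..?q}"
        by (intro integrable_integral integrable_continuous_interval continuous_on_subset [OF X] sub)
      have iaX: "((\<lambda>s. a - k * X s) has_integral integral {?r..?q} (\<lambda>s. a - k * X s)) {?r..?q}"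
        by (intro integrable_integral integrable_continuous_interval continuous_intros
            continuous_on_subset [OF X] sub)
      have i\<theta>: "((\<lambda>s. k * \<theta> s - b * (\<theta> s)\<^sup>2) has_integral (\<theta> ?q - \<theta> ?r)) {?r..?q}"
        using rq h sub by (intro fundamental_theorem_of_calculus)
          (auto simp: has_real_derivative_iff_has_vector_derivative [symmetric] intro!: DERIV_subset [OF \<theta>])
      have iA: "((\<lambda>s. a * \<theta> s) has_integral (A ?q - A ?r)) {?r..?q}"
        using rq h sub by (intro fundamental_theorem_of_calculus)
          (auto simp: has_real_derivative_iff_has_vector_derivative [symmetric] intro!: DERIV_subset [OF A])
      have "((\<lambda>s. a * \<theta> s - \<theta> ?r * (a - k * X s) - b * (\<theta> ?r)\<^sup>2 * X s - X ?q * (k * \<theta> s - b * (\<theta> s)\<^sup>2))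
          has_integral ((A ?q - A ?r) - \<theta> ?r * integral {?r..?q} (\<lambda>s. a - k * X s)
            - b * (\<theta> ?r)\<^sup>2 * integral {?r..?q} X - X ?q * (\<theta> ?q - \<theta> ?r))) {?r..?q}"
        by (intro has_integral_diff has_integral_mult_right iX iaX i\<theta> iA)
      moreover have "(A ?q - A ?r) - \<theta> ?r * integral {?r..?q} (\<lambda>s. a - k * X s)
            - b * (\<theta> ?r)\<^sup>2 * integral {?r..?q} X - X ?q * (\<theta> ?q - \<theta> ?r) = ?T m i - (R (Suc i) - R i)"
        by (simp add: R_def algebra_simps)
      moreover have "(\<lambda>s. a * \<theta> s - \<theta> ?r * (a - k * X s) - b * (\<theta> ?r)\<^sup>2 * X s - X ?q * (k * \<theta> s - b * (\<theta> s)\<^sup>2))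
          = (\<lambda>s. \<Phi> (?r, s, ?q))"
        by (simp add: \<Phi>_def algebra_simps)
      ultimately have "((\<lambda>s. \<Phi> (?r, s, ?q)) has_integral (?T m i - (R (Suc i) - R i))) (cbox ?r ?q)"
        by simp
      then have "norm (?T m i - (R (Suc i) - R i)) \<le> e / (2 * t) * measure lborel (cbox ?r ?q)"
      proof (rule has_integral_bound [rotated])
        fix s assume "s \<in> cbox ?r ?q"
        then have s: "s \<in> {0..t}" "?r \<in> {0..t}" "?q \<in> {0..t}" "\<bar>?r - s\<bar> < d / 2" "\<bar>?q - s\<bar> < d / 2"
          using rq h(1,2) by auto
        show "norm (\<Phi> (?r, s, ?q)) \<le> e / (2 * t)"
          using small [OF s(2,1,3,4,5)] by simp
      qed (use e t in auto)
      then show ?thesis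
        using rq h by (simp add: mult.commute)
    qed
    have tele: "(\<Sum>i<Suc m. R (Suc i) - R i) = R (Suc m) - R 0"
      by (rule sum_lessThan_telescope)
    have "R (Suc m) - R 0 = \<theta> t * X t - \<theta> 0 * X 0 - (A t - A 0)"
      unfolding R_def p using h(3) by simp
    then have "\<bar>(\<Sum>i<Suc m. ?T m i) - (\<theta> t * X t - \<theta> 0 * X 0 - (A t - A 0))\<bar>
        = \<bar>\<Sum>i<Suc m. ?T m i - (R (Suc i) - R i)\<bar>"
      using tele by (simp only: sum_subtractf)
    also have "\<dots> \<le> (\<Sum>i<Suc m. h * (e / (2 * t)))"
      by (rule order_trans [OF sum_abs]) (intro sum_mono piece, simp)
    also have "\<dots> = e / 2"
      using h t by (simp add: field_simps)
    also have "\<dots> < e" using e by simp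
    finally show ?thesis by simp
  qed
  then show "\<exists>m0. \<forall>m\<ge>m0. norm ((\<Sum>i<Suc m. ?T m i) - (\<theta> t * X t - \<theta> 0 * X 0 - (A t - A 0))) < e"
    by blast
qed

section \<open>Left-point approximation of the integrand\<close>

text \<open>The absolute value is there because \<open>X\<close> may be negative on a null set; the cut-off makes the
  coefficient bounded, as \<^const>\<open>elementary_wrt\<close> demands.\<close>

definition lp_coeff :: "(real \<Rightarrow> 'a \<Rightarrow> real) \<Rightarrow> real \<Rightarrow> nat \<Rightarrow> nat \<Rightarrow> 'a \<Rightarrow> real" where
  "lp_coeff X h n j \<omega> = min (sqrt \<bar>X (real j * h) \<omega>\<bar>) (real (Suc n))"

definition lp_elementary :: "(real \<Rightarrow> 'a \<Rightarrow> real) \<Rightarrow> real \<Rightarrow> nat \<Rightarrow> nat \<Rightarrow> 'a elementary" where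
  "lp_elementary X h n J = map (\<lambda>j. (real j * h, real (Suc j) * h, lp_coeff X h n j)) [0..<J]"

lemma lp_coeff_bounds: "0 \<le> lp_coeff X h n j \<omega>" "(lp_coeff X h n j \<omega>)\<^sup>2 \<le> \<bar>X (real j * h) \<omega>\<bar>"
proof -
  show nn: "0 \<le> lp_coeff X h n j \<omega>" by (simp add: lp_coeff_def)
  have "lp_coeff X h n j \<omega> \<le> sqrt \<bar>X (real j * h) \<omega>\<bar>" by (simp add: lp_coeff_def)
  from power_mono [OF this nn, of 2] show "(lp_coeff X h n j \<omega>)\<^sup>2 \<le> \<bar>X (real j * h) \<omega>\<bar>" by simp
qed

lemma elementary_process_lp:
  "elementary_process (lp_elementary X h n J) r \<omega> =
     (\<Sum>j<J. lp_coeff X h n j \<omega> * indicator {real j * h<..real (Suc j) * h} r)"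
  by (simp add: elementary_process_def lp_elementary_def comp_def interv_sum_list_conv_sum_set_nat
      atLeast0LessThan)

lemma elementary_integral_lp:
  assumes "h \<ge> 0" "n \<le> J"
  shows "elementary_integral W (lp_elementary X h l J) (real n * h) \<omega> =
     (\<Sum>j<n. lp_coeff X h l j \<omega> * (W (real (Suc j) * h) \<omega> - W (real j * h) \<omega>))"
proof -
  let ?f = "\<lambda>j. lp_coeff X h l j \<omega> *
      (W (min (real n * h) (real (Suc j) * h)) \<omega> - W (min (real n * h) (real j * h)) \<omega>)"
  have "elementary_integral W (lp_elementary X h l J) (real n * h) \<omega> = (\<Sum>j<J. ?f j)"
    by (simp add: elementary_integral_def lp_elementary_def comp_def interv_sum_list_conv_sum_set_nat
        atLeast0LessThan)
  also have "\<dots> = (\<Sum>j<n. ?f j)"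
  proof (rule sum.mono_neutral_right)
    show "\<forall>j\<in>{..<J} - {..<n}. ?f j = 0"
    proof
      fix j assume "j \<in> {..<J} - {..<n}"
      then have "real n * h \<le> real j * h" "real n * h \<le> real (Suc j) * h"
        using assms by (auto intro!: mult_right_mono)
      then show "?f j = 0" by (simp add: min_def)
    qed
  qed (use assms in auto)
  also have "\<dots> = (\<Sum>j<n. lp_coeff X h l j \<omega> * (W (real (Suc j) * h) \<omega> - W (real j * h) \<omega>))"
  proof (rule sum.cong)
    fix j assume "j \<in> {..<n}"
    then have "real j * h \<le> real n * h" "real (Suc j) * h \<le> real n * h"
      using assms by (auto intro!: mult_right_mono)
    then show "?f j = lp_coeff X h l j \<omega> * (W (real (Suc j) * h) \<omega> - W (real j * h) \<omega>)"
      by (simp add: min_def del: of_nat_Suc)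
  qed simp
  finally show ?thesis .
qed

text \<open>The intervals are open on the left, so a grid point belongs to the interval that ends
  there; hence the index of the interval around r is the ceiling minus 1 and not the floor.\<close>

lemma elementary_process_lp_eq:
  assumes h: "h > 0" and r: "0 < r"
  shows "elementary_process (lp_elementary X h n J) r \<omega> =
     (if r \<le> real J * h then lp_coeff X h n (nat (\<lceil>r / h\<rceil> - 1)) \<omega> else 0)"
    and "real (nat (\<lceil>r / h\<rceil> - 1)) * h < r" and "r - h \<le> real (nat (\<lceil>r / h\<rceil> - 1)) * h"
proof -
  define i where "i = nat (\<lceil>r / h\<rceil> - 1)"
  have c: "\<lceil>r / h\<rceil> \<ge> 1"
    using r h by simp
  then have ri: "real i = of_int \<lceil>r / h\<rceil> - 1"
    by (simp add: i_def)
  have "real i < r / h" "r / h \<le> real i + 1"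
    unfolding ri by linarith+
  then have i: "real i * h < r" "r \<le> real (Suc i) * h"
    using h by (auto simp: field_simps)
  then show "real (nat (\<lceil>r / h\<rceil> - 1)) * h < r" "r - h \<le> real (nat (\<lceil>r / h\<rceil> - 1)) * h"
    unfolding i_def [symmetric] by (auto simp: algebra_simps)
  have uniq: "j = i" if "real j * h < r" "r \<le> real (Suc j) * h" for j
  proof -
    have "real j * h < real (Suc i) * h" "real i * h < real (Suc j) * h"
      using i that by linarith+
    then show ?thesis
      using h by (auto simp: mult_less_cancel_right_pos simp del: of_nat_Suc)
  qed
  have "(\<Sum>j<J. lp_coeff X h n j \<omega> * indicator {real j * h<..real (Suc j) * h} r)
      = (\<Sum>j<J. if j = i then lp_coeff X h n j \<omega> else 0)"
  proof (intro sum.cong refl)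
    fix j
    show "lp_coeff X h n j \<omega> * indicator {real j * h<..real (Suc j) * h} r
        = (if j = i then lp_coeff X h n j \<omega> else 0)"
    proof (cases "j = i")
      case False
      then have "r \<notin> {real j * h<..real (Suc j) * h}" using uniq [of j] by auto
      with False show ?thesis by simp
    qed (use i in simp)
  qed
  also have "\<dots> = (if i < J then lp_coeff X h n i \<omega> else 0)"
    by simp
  also have "i < J \<longleftrightarrow> r \<le> real J * h"
  proof
    assume "i < J"
    then have "real (Suc i) * h \<le> real J * h"
      using h by (intro mult_right_mono) auto
    with i show "r \<le> real J * h" by linarith
  next
    assume "r \<le> real J * h"
    with i have "real i * h < real J * h" by linarith
    then show "i < J" using h by simp
  qed
  finally show "elementary_process (lp_elementary X h n J) r \<omega> =
     (if r \<le> real J * h then lp_coeff X h n (nat (\<lceil>r / h\<rceil> - 1)) \<omega> else 0)"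
    unfolding elementary_process_lp i_def .
qed

text \<open>The grid point before r tends to r. Eventually the cut-off n+1 exceeds the values taken
  and the grid reaches r, so neither restriction affects the limit.\<close>

lemma lp_process_tendsto:
  assumes X: "continuous_on {0..} (\<lambda>s. X s \<omega>)" and r: "0 < r"
    and h: "\<And>n. h n > 0" "h \<longlonglongrightarrow> 0"
    and J: "\<And>n. real (J n) * h n \<ge> c * real (Suc n)" and c: "c > 0"
    and nn: "X r \<omega> \<ge> 0"
  shows "(\<lambda>n. elementary_process (lp_elementary X (h n) n (J n)) r \<omega>) \<longlonglongrightarrow> sqrt (X r \<omega>)"
proof -
  define p where "p n = real (nat (\<lceil>r / h n\<rceil> - 1)) * h n" for n
  have p: "0 \<le> p n" "r - h n \<le> p n" "p n \<le> r" for n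
    using elementary_process_lp_eq(2,3) [OF h(1)[of n] r] h(1)[of n] by (auto simp: p_def less_imp_le)
  have "(\<lambda>n. r - h n) \<longlonglongrightarrow> r - 0"
    by (intro tendsto_intros h)
  then have "p \<longlonglongrightarrow> r"
    by (intro tendsto_sandwich [of "\<lambda>n. r - h n" p sequentially "\<lambda>_. r" r]) (use p in auto)
  then have "(\<lambda>n. X (p n) \<omega>) \<longlonglongrightarrow> X r \<omega>"
    using r p by (intro continuous_on_tendsto_compose [OF X]) auto
  then have lim: "(\<lambda>n. sqrt \<bar>X (p n) \<omega>\<bar>) \<longlonglongrightarrow> sqrt (X r \<omega>)"
    using nn tendsto_real_sqrt [OF tendsto_rabs] by fastforce
  have top: "filterlim (\<lambda>n. real (Suc n)) at_top sequentially"
    by (intro filterlim_compose [OF filterlim_real_sequentially filterlim_Suc])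
  have "eventually (\<lambda>n. sqrt \<bar>X (p n) \<omega>\<bar> < sqrt (X r \<omega>) + 1) sequentially"
    using order_tendstoD(2) [OF lim, of "sqrt (X r \<omega>) + 1"] by simp
  moreover have "eventually (\<lambda>n. real (Suc n) \<ge> sqrt (X r \<omega>) + 1) sequentially"
    using top by (simp add: filterlim_at_top del: of_nat_Suc)
  moreover have "eventually (\<lambda>n. real (Suc n) \<ge> r / c) sequentially"
    using top by (simp add: filterlim_at_top del: of_nat_Suc)
  ultimately have "eventually (\<lambda>n. sqrt \<bar>X (p n) \<omega>\<bar>
      = elementary_process (lp_elementary X (h n) n (J n)) r \<omega>) sequentially"
  proof eventually_elim
    case (elim n)
    have "r \<le> c * real (Suc n)" using elim(3) c by (simp add: field_simps)
    then have "r \<le> real (J n) * h n" using J [of n] by linarith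
    then have "elementary_process (lp_elementary X (h n) n (J n)) r \<omega>
        = min (sqrt \<bar>X (p n) \<omega>\<bar>) (real (Suc n))"
      by (simp add: elementary_process_lp_eq(1) [OF h(1) r] lp_coeff_def p_def)
    then show ?case using elim(1,2) by (simp add: min_def)
  qed
  then show ?thesis
    using lim by (rule Lim_transform_eventually [rotated])
qed

lemma lp_process_bound:
  assumes h: "h > 0" and r: "0 < r" "r \<le> R"
    and S: "\<And>s. s \<in> {0..R} \<Longrightarrow> sqrt \<bar>X s \<omega>\<bar> \<le> S"
  shows "\<bar>elementary_process (lp_elementary X h n J) r \<omega>\<bar> \<le> S"
proof -
  define i where "i = nat (\<lceil>r / h\<rceil> - 1)"
  have i: "0 \<le> real i * h" "real i * h \<le> R"
    using elementary_process_lp_eq(2,3) [OF h r(1)] h r(2) by (auto simp: i_def)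
  have "lp_coeff X h n i \<omega> \<le> sqrt \<bar>X (real i * h) \<omega>\<bar>" by (simp add: lp_coeff_def)
  also have "\<dots> \<le> S" using i by (intro S) auto
  finally have "lp_coeff X h n i \<omega> \<le> S" .
  with lp_coeff_bounds(1) [of X h n i \<omega>] show ?thesis
    by (simp add: elementary_process_lp_eq(1) [OF h r(1)] i_def)
qed

lemma lp_L2_error_tendsto:
  assumes X: "continuous_on {0..} (\<lambda>s. X s \<omega>)" and nn: "\<And>s. s \<ge> 0 \<Longrightarrow> X s \<omega> \<ge> 0"
    and h: "\<And>n. h n > 0" "h \<longlonglongrightarrow> 0"
    and J: "\<And>n. real (J n) * h n \<ge> c * real (Suc n)" and c: "c > 0" and R: "R \<ge> 0"
  shows "(\<lambda>n. LINT r:{0..R}|lborel.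
      (elementary_process (lp_elementary X (h n) n (J n)) r \<omega> - sqrt (X r \<omega>))\<^sup>2) \<longlonglongrightarrow> 0"
proof -
  have cX: "continuous_on {0..R} (\<lambda>s. sqrt \<bar>X s \<omega>\<bar>)"
    by (intro continuous_intros continuous_on_subset [OF X]) auto
  obtain S where "\<forall>s\<in>{0..R}. sqrt \<bar>X s \<omega>\<bar> \<le> S"
    using compact_continuous_image [OF cX compact_Icc, THEN compact_imp_bounded]
    by (auto simp: bounded_real)
  then have S: "\<And>s. s \<in> {0..R} \<Longrightarrow> sqrt \<bar>X s \<omega>\<bar> \<le> S" by blast
  have [measurable]: "(\<lambda>r. elementary_process (lp_elementary X (h n) n (J n)) r \<omega>) \<in> borel_measurable borel" for n
    unfolding elementary_process_lp by measurable
  have S0: "S \<ge> 0" using order_trans [OF real_sqrt_ge_zero S [of 0]] R by simp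
  have [measurable]: "(\<lambda>r. indicator {0..R} r * sqrt (X r \<omega>)) \<in> borel_measurable lborel"
  proof -
    have "continuous_on {0..R} (\<lambda>s. sqrt (X s \<omega>))"
      by (intro continuous_intros continuous_on_subset [OF X]) auto
    then show ?thesis
      using borel_measurable_continuous_on_indicator [of "{0..R}" "\<lambda>s. sqrt (X s \<omega>)"] by simp
  qed
  \<comment> \<open>The inner indicator does not change the integrand, thanks to the outer one, but
    makes it measurable: nothing is known about \<open>X r \<omega>\<close> for negative r.\<close>
  have "(\<lambda>n. \<integral>r. indicator {0..R} r * (elementary_process (lp_elementary X (h n) n (J n)) r \<omega>
          - indicator {0..R} r * sqrt (X r \<omega>))\<^sup>2 \<partial>lborel) \<longlonglongrightarrow> (\<integral>r. 0 \<partial>(lborel :: real measure))"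
  proof (rule integral_dominated_convergence [where w = "\<lambda>r. indicator {0..R} r * (2 * S)\<^sup>2"])
    show "integrable lborel (\<lambda>r. indicator {0..R} r * (2 * S)\<^sup>2)"
      using R by (intro integrable_mult_left integrable_real_indicator) auto
    show "AE r in lborel. (\<lambda>n. indicator {0..R} r * (elementary_process (lp_elementary X (h n) n (J n)) r \<omega>
          - indicator {0..R} r * sqrt (X r \<omega>))\<^sup>2) \<longlonglongrightarrow> 0"
      \<comment> \<open>At r = 0 the elementary process vanishes, its intervals being open on the
        left, so this one point is discarded.\<close>
      using AE_lborel_singleton [of 0]
    proof eventually_elim
      case (elim r)
      show ?case
      proof (cases "r \<in> {0..R}")
        case True
        with elim have r: "r > 0" by auto
        have "(\<lambda>n. (elementary_process (lp_elementary X (h n) n (J n)) r \<omega> - sqrt (X r \<omega>))\<^sup>2)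
            \<longlonglongrightarrow> (sqrt (X r \<omega>) - sqrt (X r \<omega>))\<^sup>2"
          using r nn [of r] by (intro tendsto_intros lp_process_tendsto [where X = X and h = h and J = J and c = c, OF X r h J c]) auto
        with True show ?thesis by simp
      qed simp
    qed
    show "AE r in lborel. norm (indicator {0..R} r * (elementary_process (lp_elementary X (h n) n (J n)) r \<omega>
          - indicator {0..R} r * sqrt (X r \<omega>))\<^sup>2) \<le> indicator {0..R} r * (2 * S)\<^sup>2" for n
      using AE_lborel_singleton [of 0]
    proof eventually_elim
      case (elim r)
      show ?case
      proof (cases "r \<in> {0..R}")
        case True
        with elim have r: "r > 0" "r \<le> R" by auto
        have "\<bar>elementary_process (lp_elementary X (h n) n (J n)) r \<omega> - sqrt (X r \<omega>)\<bar> \<le> 2 * S"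
          using lp_process_bound [where X = X and R = R, OF h(1) r S] S [OF True] nn [of r] r
          by (smt (verit) real_sqrt_ge_zero)
        then have "(elementary_process (lp_elementary X (h n) n (J n)) r \<omega> - sqrt (X r \<omega>))\<^sup>2 \<le> (2 * S)\<^sup>2"
          using power_mono [of "\<bar>elementary_process (lp_elementary X (h n) n (J n)) r \<omega> - sqrt (X r \<omega>)\<bar>"
              "2 * S" 2] by (simp only: power2_abs abs_ge_zero)
        with True show ?thesis by simp
      qed simp
    qed
  qed simp_all
  moreover have "(\<integral>r. indicator {0..R} r * (elementary_process (lp_elementary X (h n) n (J n)) r \<omega>
          - indicator {0..R} r * sqrt (X r \<omega>))\<^sup>2 \<partial>lborel)
     = (LINT r:{0..R}|lborel.
      (elementary_process (lp_elementary X (h n) n (J n)) r \<omega> - sqrt (X r \<omega>))\<^sup>2)" for n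
    unfolding set_lebesgue_integral_def
    by (intro Bochner_Integration.integral_cong) (auto simp: indicator_def)
  ultimately show ?thesis by simp
qed

text \<open>Since \<open>ito_integral\<close> speaks about every approximating sequence, this
  identifies the integral as the limit along explicit left-point sums. The growth condition on
  \<open>J\<close> makes the grid outrun every time horizon, as \<open>approximates\<close>
  requires.\<close>

lemma approximates_lp:
  assumes M: "prob_space M" and filt: "filtration_on M F"
    and ad: "adapted F X" and jm: "jointly_measurable M X"
    and cont: "AE \<omega> in M. continuous_on {0..} (\<lambda>t. X t \<omega>)"
    and nn: "AE \<omega> in M. \<forall>t\<ge>0. 0 \<le> X t \<omega>"
    and h: "\<And>n. h n > 0" "h \<longlonglongrightarrow> 0"
    and J: "\<And>n. real (J n) * h n \<ge> c * real (Suc n)" and c: "c > 0"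
  shows "approximates M F (\<lambda>n. lp_elementary X (h n) n (J n)) (\<lambda>s \<omega>. sqrt (X s \<omega>))"
proof -
  interpret prob_space M by fact
  have XF: "X s \<in> borel_measurable (F s)" if "s \<ge> 0" for s
    using ad that by (auto simp: adapted_def)
  have XM: "X s \<in> borel_measurable M" if "s \<ge> 0" for s
    using XF [OF that] filt that by (auto simp: filtration_on_def intro: measurable_from_subalg)
  have coeffF: "lp_coeff X g n j \<in> borel_measurable (F (real j * g))" if "g > 0" for g n j
    unfolding lp_coeff_def using XF [of "real j * g"] that by simp
  have coeffM [measurable]: "lp_coeff X (h n) n j \<in> borel_measurable M" for n j
    unfolding lp_coeff_def using XM [of "real j * h n"] h(1) [of n] by simp
  have elem: "elementary_wrt M F (lp_elementary X (h n) n (J n))" for n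
  proof -
    have "\<bar>lp_coeff X (h n) n j \<omega>\<bar> \<le> real (Suc n)" for j \<omega>
      using lp_coeff_bounds(1) [of X "h n" n j \<omega>] by (simp add: lp_coeff_def)
    then show ?thesis
      unfolding elementary_wrt_def lp_elementary_def
      using coeffF [OF h(1) [of n]] h(1) [of n]
      by (auto intro!: mult_right_mono simp: less_imp_le simp del: of_nat_Suc)
  qed
  \<comment> \<open>Joint measurability is given only for times in [0, infinity). Clipping the time
    at 0 extends it to the line and changes nothing under the indicator of
    \<open>{0..R}\<close>.\<close>
  have sm [measurable]: "(\<lambda>z. X (max 0 (snd z)) (fst z)) \<in> borel_measurable (M \<Otimes>\<^sub>M lborel)"
  proof -
    have "(\<lambda>z :: 'a \<times> real. (max 0 (snd z), fst z)) \<in> measurable (M \<Otimes>\<^sub>M lborel) (restrict_space borel {0..} \<Otimes>\<^sub>M M)"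
      by (intro measurable_Pair measurable_restrict_space2) auto
    from measurable_compose [OF this jm [unfolded jointly_measurable_def]]
    show ?thesis by (simp add: case_prod_beta)
  qed
  have meas: "(\<lambda>\<omega>. LINT r:{0..R}|lborel.
      (elementary_process (lp_elementary X (h n) n (J n)) r \<omega> - sqrt (X r \<omega>))\<^sup>2) \<in> borel_measurable M" for n R
  proof -
    have eq: "(LINT r:{0..R}|lborel.
      (elementary_process (lp_elementary X (h n) n (J n)) r \<omega> - sqrt (X r \<omega>))\<^sup>2)
      = (\<integral>r. indicator {0..R} r *
      ((\<Sum>j<J n. lp_coeff X (h n) n j \<omega> * indicator {real j * h n<..real (Suc j) * h n} r)
         - sqrt (X (max 0 r) \<omega>))\<^sup>2 \<partial>lborel)" for \<omega>
      unfolding set_lebesgue_integral_def elementary_process_lp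
      by (intro Bochner_Integration.integral_cong) (auto simp: indicator_def)
    show ?thesis
      unfolding eq
      by (intro lborel.borel_measurable_lebesgue_integral, unfold case_prod_beta) measurable
  qed
  have "conv_in_prob M (\<lambda>n \<omega>. LINT r:{0..R}|lborel.
      (elementary_process (lp_elementary X (h n) n (J n)) r \<omega> - sqrt (X r \<omega>))\<^sup>2) (\<lambda>_. 0)"
    if R: "R \<ge> 0" for R
  proof (rule conv_in_prob_of_AE [OF meas borel_measurable_const])
    show "AE \<omega> in M. (\<lambda>n. LINT r:{0..R}|lborel.
      (elementary_process (lp_elementary X (h n) n (J n)) r \<omega> - sqrt (X r \<omega>))\<^sup>2) \<longlonglongrightarrow> 0"
      using cont nn
    proof eventually_elim
      case (elim \<omega>)
      show ?case
        by (rule lp_L2_error_tendsto [where X = X and h = h and J = J and c = c, OF elim(1) _ h J c R])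
          (use elim(2) in blast)
    qed
  qed
  with elem show ?thesis
    unfolding approximates_def by simp
qed

section \<open>Exponential martingales of the CIR process\<close>

text \<open>With S the stochastic sum and Q = h times the sum of the squares of the z_j, the square
  is exp(2 S - Q) = exp(2 S - 4 Q) * exp(3 Q), and a product is at most half the sum of the squares.
  The first square, exp(4 S - 8 Q), is an exponential of the same kind for the coefficients 4 z_j
  and has mean 1; the second is the source of the 6.\<close>

lemma brownian_nn_integral_exp_square_le:
  assumes M: "prob_space M" and filt: "filtration_on M F" and bm: "brownian_motion M F W"
    and h: "h > 0"
    and z: "\<And>j. z j \<in> borel_measurable (F (real j * h))"
  shows "(\<integral>\<^sup>+ \<omega>. ennreal ((exp (\<Sum>j<n. z j \<omega> * (W (real (Suc j) * h) \<omega> - W (real j * h) \<omega>)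
            - (z j \<omega>)\<^sup>2 * h / 2))\<^sup>2) \<partial>M)
     \<le> ennreal (1 / 2) * (1 + (\<integral>\<^sup>+ \<omega>. ennreal (exp (6 * h * (\<Sum>j<n. (z j \<omega>)\<^sup>2))) \<partial>M))"
proof -
  have subF: "subalgebra M (F s)" if "s \<ge> 0" for s
    using filt that by (auto simp: filtration_on_def)
  have zM [measurable]: "z j \<in> borel_measurable M" for j
    using h by (intro measurable_from_subalg [OF subF z]) auto
  have WM: "W s \<in> borel_measurable M" if "s \<ge> 0" for s
    using bm that measurable_from_subalg [OF subF [OF that]] by (auto simp: brownian_motion_def adapted_def)
  have [measurable]: "W (real j * h) \<in> borel_measurable M" "W (real (Suc j) * h) \<in> borel_measurable M" for j
    using h by (auto intro!: WM simp del: of_nat_Suc)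
  define S where "S \<omega> = (\<Sum>j<n. z j \<omega> * (W (real (Suc j) * h) \<omega> - W (real j * h) \<omega>))" for \<omega>
  define Q where "Q \<omega> = h * (\<Sum>j<n. (z j \<omega>)\<^sup>2)" for \<omega>
  have [measurable]: "S \<in> borel_measurable M" "Q \<in> borel_measurable M"
    unfolding S_def Q_def by measurable
  have L: "(\<Sum>j<n. z j \<omega> * (W (real (Suc j) * h) \<omega> - W (real j * h) \<omega>) - (z j \<omega>)\<^sup>2 * h / 2) = S \<omega> - Q \<omega> / 2" for \<omega>
    by (simp add: S_def Q_def sum_subtractf sum_distrib_left sum_divide_distrib mult.commute)
  have L4: "(\<Sum>j<n. 4 * z j \<omega> * (W (real (Suc j) * h) \<omega> - W (real j * h) \<omega>) - (4 * z j \<omega>)\<^sup>2 * h / 2)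
      = 4 * S \<omega> - 8 * Q \<omega>" for \<omega>
    by (simp add: S_def Q_def sum_subtractf sum_distrib_left mult_ac power_mult_distrib)
  have E4: "(\<integral>\<^sup>+ \<omega>. ennreal (exp (4 * S \<omega> - 8 * Q \<omega>)) \<partial>M) = 1"
    using brownian_nn_integral_exp [OF M filt bm h, of "\<lambda>j \<omega>. 4 * z j \<omega>" n] z
    unfolding L4 by simp
  have pw: "(exp (S \<omega> - Q \<omega> / 2))\<^sup>2 \<le> 1 / 2 * (exp (4 * S \<omega> - 8 * Q \<omega>) + exp (6 * Q \<omega>))" for \<omega>
  proof -
    have "2 * exp (2 * S \<omega> - 4 * Q \<omega>) * exp (3 * Q \<omega>) \<le> (exp (2 * S \<omega> - 4 * Q \<omega>))\<^sup>2 + (exp (3 * Q \<omega>))\<^sup>2"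
      by (rule sum_squares_bound)
    then show ?thesis
      by (simp add: exp_double [symmetric] exp_add [symmetric] algebra_simps)
  qed
  have "(\<integral>\<^sup>+ \<omega>. ennreal ((exp (S \<omega> - Q \<omega> / 2))\<^sup>2) \<partial>M)
      \<le> (\<integral>\<^sup>+ \<omega>. ennreal (1 / 2) * (ennreal (exp (4 * S \<omega> - 8 * Q \<omega>)) + ennreal (exp (6 * Q \<omega>))) \<partial>M)"
  proof (rule nn_integral_mono)
    fix \<omega>
    have "ennreal ((exp (S \<omega> - Q \<omega> / 2))\<^sup>2) \<le> ennreal (1 / 2 * (exp (4 * S \<omega> - 8 * Q \<omega>) + exp (6 * Q \<omega>)))"
      by (rule ennreal_leI [OF pw])
    also have "\<dots> = ennreal (1 / 2) * (ennreal (exp (4 * S \<omega> - 8 * Q \<omega>)) + ennreal (exp (6 * Q \<omega>)))"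
      by (subst ennreal_mult, simp, simp, subst ennreal_plus, simp_all)
    finally show "ennreal ((exp (S \<omega> - Q \<omega> / 2))\<^sup>2)
        \<le> ennreal (1 / 2) * (ennreal (exp (4 * S \<omega> - 8 * Q \<omega>)) + ennreal (exp (6 * Q \<omega>)))" .
  qed
  also have "\<dots> = ennreal (1 / 2) * (1 + (\<integral>\<^sup>+ \<omega>. ennreal (exp (6 * Q \<omega>)) \<partial>M))"
    by (simp add: nn_integral_cmult nn_integral_add E4)
  finally show ?thesis
    unfolding L by (simp add: Q_def mult.assoc)
qed

section \<open>Discretised stochastic exponentials of the CIR process\<close>

locale cir_solution = prob_space M
  for M :: "'a measure" and F :: "real \<Rightarrow> 'a measure" and W :: "real \<Rightarrow> 'a \<Rightarrow> real"
    and a k \<sigma> x :: real and X :: "real \<Rightarrow> 'a \<Rightarrow> real" +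
  assumes filt: "filtration_on M F" and bm: "brownian_motion M F W"
    and cir: "cir_process M F W a k \<sigma> x X"
begin

lemma X_adapted: "s \<ge> 0 \<Longrightarrow> X s \<in> borel_measurable (F s)"
  using cir by (auto simp: cir_process_def adapted_def)

lemma X_measurable: "s \<ge> 0 \<Longrightarrow> X s \<in> borel_measurable M"
  using X_adapted filt by (auto simp: filtration_on_def intro: measurable_from_subalg)

lemma X_continuous: "AE \<omega> in M. continuous_on {0..} (\<lambda>t. X t \<omega>)"
  and X_nonneg: "AE \<omega> in M. \<forall>t\<ge>0. 0 \<le> X t \<omega>"
  and X_0: "AE \<omega> in M. X 0 \<omega> = x"
  using cir by (auto simp: cir_process_def)

definition mesh :: "real \<Rightarrow> nat \<Rightarrow> nat \<Rightarrow> real" where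
  "mesh t m n = t / real (Suc m) / real (Suc n)"

text \<open>\<open>j div Suc n\<close> is the coarse interval that contains the fine interval j.
  Freezing \<theta> over whole coarse intervals lets the limit in n involve the Ito integral of
  sqrt(X) only, at the coarse grid times.\<close>

definition exp_coeff :: "(real \<Rightarrow> real) \<Rightarrow> real \<Rightarrow> nat \<Rightarrow> nat \<Rightarrow> nat \<Rightarrow> 'a \<Rightarrow> real" where
  "exp_coeff \<theta> t m n j \<omega> =
     \<sigma> * \<theta> (real (j div Suc n) * (t / real (Suc m))) * lp_coeff X (mesh t m n) n j \<omega>"

definition grid_exponent :: "(real \<Rightarrow> real) \<Rightarrow> real \<Rightarrow> nat \<Rightarrow> nat \<Rightarrow> 'a \<Rightarrow> real" where
  "grid_exponent \<theta> t m n \<omega> = (\<Sum>j<Suc m * Suc n.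
     exp_coeff \<theta> t m n j \<omega> * (W (real (Suc j) * mesh t m n) \<omega> - W (real j * mesh t m n) \<omega>)
       - (exp_coeff \<theta> t m n j \<omega>)\<^sup>2 * mesh t m n / 2)"

text \<open>This is the limit of \<open>grid_exponent\<close> in n: by the equation, \<sigma> times
  an increment of the Ito integral has become an increment of X minus its drift. The last term is
  half the quadratic variation.\<close>

definition step_exponent :: "(real \<Rightarrow> real) \<Rightarrow> real \<Rightarrow> nat \<Rightarrow> 'a \<Rightarrow> real" where
  "step_exponent \<theta> t m \<omega> = (\<Sum>i<Suc m.
     \<theta> (real i * (t / real (Suc m)))
         * (X (real (Suc i) * (t / real (Suc m))) \<omega> - X (real i * (t / real (Suc m))) \<omega>)
     - \<theta> (real i * (t / real (Suc m)))
         * integral {real i * (t / real (Suc m))..real (Suc i) * (t / real (Suc m))} (\<lambda>s. a - k * X s \<omega>)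
     - \<sigma>\<^sup>2 / 2 * (\<theta> (real i * (t / real (Suc m))))\<^sup>2
         * integral {real i * (t / real (Suc m))..real (Suc i) * (t / real (Suc m))} (\<lambda>s. X s \<omega>))"

lemma exp_coeff_adapted:
  assumes "t > 0"
  shows "exp_coeff \<theta> t m n j \<in> borel_measurable (F (real j * mesh t m n))"
proof -
  have [measurable]: "X (real j * mesh t m n) \<in> borel_measurable (F (real j * mesh t m n))"
    using assms by (intro X_adapted) (simp add: mesh_def)
  show ?thesis
    unfolding exp_coeff_def [abs_def] lp_coeff_def by measurable
qed

lemma mesh_pos: "t > 0 \<Longrightarrow> mesh t m n > 0"
  by (simp add: mesh_def)

lemma nn_integral_exp_grid_exponent:
  "t > 0 \<Longrightarrow> (\<integral>\<^sup>+ \<omega>. ennreal (exp (grid_exponent \<theta> t m n \<omega>)) \<partial>M) = 1"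
  unfolding grid_exponent_def
  by (intro brownian_nn_integral_exp [OF prob_space_axioms filt bm] exp_coeff_adapted mesh_pos)

lemma grid_exponent_measurable:
  assumes "t > 0"
  shows "grid_exponent \<theta> t m n \<in> borel_measurable M"
proof -
  have subF: "subalgebra M (F s)" if "s \<ge> 0" for s
    using filt that by (auto simp: filtration_on_def)
  have pos: "0 \<le> real j * mesh t m n" for j
    using mesh_pos [OF assms, of m n] by simp
  have [measurable]: "exp_coeff \<theta> t m n j \<in> borel_measurable M" for j
    by (rule measurable_from_subalg [OF subF [OF pos] exp_coeff_adapted [OF assms]])
  have [measurable]: "W (real j * mesh t m n) \<in> borel_measurable M" for j
    using bm pos [of j] measurable_from_subalg [OF subF [OF pos]]
    by (auto simp: brownian_motion_def adapted_def)
  show ?thesis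
    unfolding grid_exponent_def [abs_def] by measurable
qed

text \<open>Two limits for fixed m: the elementary integrals converge to \<open>I\<close> at the m+2
  coarse grid times, almost surely along one subsequence, and the squares form left Riemann sums of
  X, which converge on every continuous path. The equation for X then eliminates
  \<open>I\<close>.\<close>

lemma grid_exponent_tendsto:
  assumes t: "t > 0"
  shows "\<exists>r. strict_mono r \<and> (AE \<omega> in M. (\<lambda>n. grid_exponent \<theta> t m (r n) \<omega>) \<longlonglongrightarrow> step_exponent \<theta> t m \<omega>)"
proof -
  define l where "l = t / real (Suc m)"
  define p where "p i = real i * l" for i
  define h where "h n = mesh t m n" for n
  \<comment> \<open>The exponent uses only the first \<open>Suc m * Suc n\<close> intervals, but
    \<open>approximates\<close> demands convergence on all of [0, infinity); the extra factor makes
    the grid reach t (n+1).\<close>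
  define J where "J n = Suc m * Suc n * Suc n" for n
  define e where "e n = lp_elementary X (h n) n (J n)" for n
  have l: "l > 0" using t by (simp add: l_def)
  have h: "h n > 0" and hl: "h n = l / real (Suc n)" for n
    using t by (auto simp: h_def mesh_def l_def)
  have p_h: "p i = real (i * Suc n) * h n" for i n
    by (simp only: p_def hl of_nat_mult) (simp del: of_nat_Suc)
  have p_pos: "p i \<ge> 0" for i using l by (simp add: p_def)
  have h0: "h \<longlonglongrightarrow> 0"
    unfolding hl by (rule LIMSEQ_Suc [OF lim_const_over_n])
  have Jh: "real (J n) * h n \<ge> t * real (Suc n)" for n
    unfolding J_def hl l_def of_nat_mult by (simp add: field_simps del: of_nat_Suc)
  obtain I where I: "ito_integral M F W (\<lambda>s \<omega>. sqrt (X s \<omega>)) I"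
    and eqn: "\<And>s. s \<ge> 0 \<Longrightarrow> AE \<omega> in M. X s \<omega> = x + (LINT s:{0..s}|lborel. a - k * X s \<omega>) + \<sigma> * I s \<omega>"
    using cir by (auto simp: cir_process_def)
  have "approximates M F e (\<lambda>s \<omega>. sqrt (X s \<omega>))"
    unfolding e_def using cir h h0 Jh t
    by (intro approximates_lp [OF prob_space_axioms filt, where c = t]) (auto simp: cir_process_def)
  then have conv: "conv_in_prob M (\<lambda>n. elementary_integral W (e n) s) (I s)" if "s \<ge> 0" for s
    using I that by (auto simp: ito_integral_def)
  obtain r :: "nat \<Rightarrow> nat" where r: "strict_mono r"
    and lim: "AE \<omega> in M. \<forall>i\<in>{..Suc m}. (\<lambda>n. elementary_integral W (e (r n)) (p i) \<omega>) \<longlonglongrightarrow> I (p i) \<omega>"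
    using conv_in_prob_AE_subseq [of "{..Suc m}" "\<lambda>i n. elementary_integral W (e n) (p i)" "\<lambda>i. I (p i)"]
      conv [OF p_pos] by auto
  have eqn': "AE \<omega> in M. \<forall>i\<in>{..Suc m}. X (p i) \<omega> = x + (LINT s:{0..p i}|lborel. a - k * X s \<omega>) + \<sigma> * I (p i) \<omega>"
    using eqn [OF p_pos] by (intro AE_finite_allI) auto
  have "AE \<omega> in M. (\<lambda>n. grid_exponent \<theta> t m (r n) \<omega>) \<longlonglongrightarrow> step_exponent \<theta> t m \<omega>"
    using lim eqn' X_continuous X_nonneg
  proof eventually_elim
    case (elim \<omega>)
    note lim = elim(1) and eqn = elim(2) and cont = elim(3) and nn = elim(4)
    define c where "c n j = lp_coeff X (h n) n j \<omega>" for n j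
    define D where "D n j = W (real (Suc j) * h n) \<omega> - W (real j * h n) \<omega>" for n j
    \<comment> \<open>The fine intervals are grouped by coarse interval. There \<theta> is constant,
      so the stochastic part of a group is a difference of two values of one elementary
      integral.\<close>
    have split: "grid_exponent \<theta> t m n \<omega> =
        (\<Sum>i<Suc m. \<sigma> * \<theta> (p i) * (elementary_integral W (e n) (p (Suc i)) \<omega> - elementary_integral W (e n) (p i) \<omega>)
          - \<sigma>\<^sup>2 / 2 * (\<theta> (p i))\<^sup>2 * (h n * (\<Sum>j<Suc n. (c n (i * Suc n + j))\<^sup>2)))" for n
    proof -
      have eI: "elementary_integral W (e n) (p i) \<omega> = (\<Sum>j<i * Suc n. c n j * D n j)" if "i \<le> Suc m" for i
      proof -
        have "i * Suc n \<le> Suc m * Suc n" using that by (rule mult_le_mono1)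
        also have "\<dots> \<le> J n" unfolding J_def by simp
        finally have "i * Suc n \<le> J n" .
        then show ?thesis
          unfolding e_def p_h [of i n] c_def D_def
          using h [of n] by (intro elementary_integral_lp) auto
      qed
      let ?f = "\<lambda>j. \<sigma> * \<theta> (p (j div Suc n)) * c n j * D n j - (\<sigma> * \<theta> (p (j div Suc n)) * c n j)\<^sup>2 * h n / 2"
      have "grid_exponent \<theta> t m n \<omega> = (\<Sum>j<Suc m * Suc n. ?f j)"
        by (simp add: grid_exponent_def exp_coeff_def c_def D_def p_def l_def h_def)
      also have "\<dots> = (\<Sum>i<Suc m. \<Sum>j\<in>{i * Suc n..<i * Suc n + Suc n}. ?f j)"
        by (rule sum.nat_group [symmetric])
      also have "\<dots> = (\<Sum>i<Suc m. \<sigma> * \<theta> (p i) * (elementary_integral W (e n) (p (Suc i)) \<omega> - elementary_integral W (e n) (p i) \<omega>)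
          - \<sigma>\<^sup>2 / 2 * (\<theta> (p i))\<^sup>2 * (h n * (\<Sum>j<Suc n. (c n (i * Suc n + j))\<^sup>2)))"
      proof (rule sum.cong)
        fix i assume "i \<in> {..<Suc m}"
        then have i: "i \<le> Suc m" "Suc i \<le> Suc m" by auto
        let ?B = "{i * Suc n..<i * Suc n + Suc n}"
        have "(\<Sum>j\<in>?B. ?f j) = (\<Sum>j\<in>?B. \<sigma> * \<theta> (p i) * (c n j * D n j) - \<sigma>\<^sup>2 / 2 * (\<theta> (p i))\<^sup>2 * (h n * (c n j)\<^sup>2))"
        proof (rule sum.cong)
          fix j assume "j \<in> ?B"
          then have "j div Suc n = i"
            by (intro div_nat_eqI) (auto simp: mult.commute)
          then show "?f j = \<sigma> * \<theta> (p i) * (c n j * D n j) - \<sigma>\<^sup>2 / 2 * (\<theta> (p i))\<^sup>2 * (h n * (c n j)\<^sup>2)"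
            by (simp add: power_mult_distrib)
        qed simp
        also have "\<dots> = \<sigma> * \<theta> (p i) * (\<Sum>j\<in>?B. c n j * D n j) - \<sigma>\<^sup>2 / 2 * (\<theta> (p i))\<^sup>2 * (h n * (\<Sum>j\<in>?B. (c n j)\<^sup>2))"
          by (simp only: sum_subtractf sum_distrib_left)
        also have "(\<Sum>j\<in>?B. c n j * D n j) = (\<Sum>j<Suc i * Suc n. c n j * D n j) - (\<Sum>j<i * Suc n. c n j * D n j)"
        proof -
          have "{..<Suc i * Suc n} = {..<i * Suc n} \<union> ?B" by auto
          then show ?thesis by (simp add: sum.union_disjoint ivl_disj_int del: mult_Suc mult_Suc_right)
        qed
        also have "(\<Sum>j\<in>?B. (c n j)\<^sup>2) = (\<Sum>j<Suc n. (c n (i * Suc n + j))\<^sup>2)"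
          using sum.shift_bounds_nat_ivl [of "\<lambda>j. (c n j)\<^sup>2" 0 "i * Suc n" "Suc n"]
          by (simp add: atLeast0LessThan add.commute del: mult_Suc mult_Suc_right sum.lessThan_Suc)
        finally show "(\<Sum>j\<in>?B. ?f j) = \<sigma> * \<theta> (p i) * (elementary_integral W (e n) (p (Suc i)) \<omega> - elementary_integral W (e n) (p i) \<omega>)
          - \<sigma>\<^sup>2 / 2 * (\<theta> (p i))\<^sup>2 * (h n * (\<Sum>j<Suc n. (c n (i * Suc n + j))\<^sup>2))"
          unfolding eI [OF i(1)] eI [OF i(2)] .
      qed simp
      finally show ?thesis .
    qed
    have cX: "continuous_on {0..s} (\<lambda>s. X s \<omega>)" for s
      by (intro continuous_on_subset [OF cont]) auto
    have Slim: "(\<lambda>n. \<sigma> * \<theta> (p i) * (elementary_integral W (e (r n)) (p (Suc i)) \<omega> - elementary_integral W (e (r n)) (p i) \<omega>))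
        \<longlonglongrightarrow> \<theta> (p i) * (X (p (Suc i)) \<omega> - X (p i) \<omega>) - \<theta> (p i) * integral {p i..p (Suc i)} (\<lambda>s. a - k * X s \<omega>)"
      if i: "i < Suc m" for i
    proof -
      have pp: "p i \<le> p (Suc i)" using l by (simp add: p_def algebra_simps)
      have L: "(LINT s:{0..p j}|lborel. a - k * X s \<omega>) = integral {0..p j} (\<lambda>s. a - k * X s \<omega>)" for j
        by (intro set_borel_integral_eq_integral borel_integrable_atLeastAtMost' continuous_intros cX)
      have "integral {0..p i} (\<lambda>s. a - k * X s \<omega>) + integral {p i..p (Suc i)} (\<lambda>s. a - k * X s \<omega>)
          = integral {0..p (Suc i)} (\<lambda>s. a - k * X s \<omega>)"
        by (intro Henstock_Kurzweil_Integration.integral_combine p_pos pp integrable_continuous_interval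
            continuous_intros cX)
      moreover have "X (p i) \<omega> = x + (LINT s:{0..p i}|lborel. a - k * X s \<omega>) + \<sigma> * I (p i) \<omega>"
        "X (p (Suc i)) \<omega> = x + (LINT s:{0..p (Suc i)}|lborel. a - k * X s \<omega>) + \<sigma> * I (p (Suc i)) \<omega>"
        using eqn i by auto
      ultimately have "\<sigma> * (I (p (Suc i)) \<omega> - I (p i) \<omega>)
          = X (p (Suc i)) \<omega> - X (p i) \<omega> - integral {p i..p (Suc i)} (\<lambda>s. a - k * X s \<omega>)"
        by (simp add: L right_diff_distrib)
      then have "\<theta> (p i) * (\<sigma> * (I (p (Suc i)) \<omega> - I (p i) \<omega>))
          = \<theta> (p i) * (X (p (Suc i)) \<omega> - X (p i) \<omega> - integral {p i..p (Suc i)} (\<lambda>s. a - k * X s \<omega>))"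
        by (rule arg_cong)
      then have "\<sigma> * \<theta> (p i) * (I (p (Suc i)) \<omega> - I (p i) \<omega>)
          = \<theta> (p i) * (X (p (Suc i)) \<omega> - X (p i) \<omega>) - \<theta> (p i) * integral {p i..p (Suc i)} (\<lambda>s. a - k * X s \<omega>)"
        by (simp add: algebra_simps)
      moreover have "(\<lambda>n. \<sigma> * \<theta> (p i) * (elementary_integral W (e (r n)) (p (Suc i)) \<omega> - elementary_integral W (e (r n)) (p i) \<omega>))
          \<longlonglongrightarrow> \<sigma> * \<theta> (p i) * (I (p (Suc i)) \<omega> - I (p i) \<omega>)"
        using i lim by (intro tendsto_intros) auto
      ultimately show ?thesis by simp
    qed
    have Qlim: "(\<lambda>n. h n * (\<Sum>j<Suc n. (c n (i * Suc n + j))\<^sup>2)) \<longlonglongrightarrow> integral {p i..p (Suc i)} (\<lambda>s. X s \<omega>)"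
      for i
    proof -
      have pS: "p (Suc i) = p i + l" by (simp add: p_def algebra_simps)
      have ci: "continuous_on {p i..p i + l} (\<lambda>s. X s \<omega>)"
        using p_pos [of i] by (intro continuous_on_subset [OF cont]) auto
      obtain B where B: "\<forall>s\<in>{p i..p i + l}. \<bar>X s \<omega>\<bar> \<le> B"
        using compact_continuous_image [OF ci compact_Icc, THEN compact_imp_bounded]
        by (auto simp: bounded_real)
      have "filterlim (\<lambda>n. real (Suc n)) at_top sequentially"
        by (intro filterlim_compose [OF filterlim_real_sequentially filterlim_Suc])
      then have "eventually (\<lambda>n. real (Suc n) \<ge> sqrt B) sequentially"
        by (simp add: filterlim_at_top del: of_nat_Suc)
      \<comment> \<open>The path is bounded by \<open>B\<close> on the compact interval; once n+1 >=
        sqrt B the cut-off in \<open>lp_coeff\<close> is inactive and the squares are exact values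
        of X.\<close>
      then have "eventually (\<lambda>n. l / real (Suc n) * (\<Sum>j<Suc n. X (p i + real j * (l / real (Suc n))) \<omega>)
          = h n * (\<Sum>j<Suc n. (c n (i * Suc n + j))\<^sup>2)) sequentially"
      proof eventually_elim
        case (elim n)
        have "(c n (i * Suc n + j))\<^sup>2 = X (p i + real j * (l / real (Suc n))) \<omega>" if j: "j < Suc n" for j
        proof -
          have q: "real (i * Suc n + j) * h n = p i + real j * (l / real (Suc n))"
            unfolding p_h [of i n] hl [symmetric] of_nat_add by (rule distrib_right)
          have "real j * h n \<le> real (Suc n) * h n"
            using j h [of n] by (intro mult_right_mono) auto
          then have "real j * (l / real (Suc n)) \<le> l" "0 \<le> real j * (l / real (Suc n))"
            using l by (simp_all add: hl del: of_nat_Suc)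
          then have s: "p i + real j * (l / real (Suc n)) \<in> {p i..p i + l}" by auto
          then have "sqrt \<bar>X (p i + real j * (l / real (Suc n))) \<omega>\<bar> \<le> sqrt B"
            using B by (intro real_sqrt_le_mono) blast
          then have "c n (i * Suc n + j) = sqrt \<bar>X (p i + real j * (l / real (Suc n))) \<omega>\<bar>"
            unfolding c_def lp_coeff_def q using elim by (intro min_absorb1) linarith
          moreover have "X (p i + real j * (l / real (Suc n))) \<omega> \<ge> 0"
            using nn s p_pos [of i] by auto
          ultimately show ?thesis by simp
        qed
        then show ?case by (simp add: hl del: of_nat_Suc sum.lessThan_Suc)
      qed
      then show ?thesis
        unfolding pS by (rule Lim_transform_eventually [OF riemann_sum_tendsto_integral [OF ci l]])
    qed
    have "(\<lambda>n. grid_exponent \<theta> t m (r n) \<omega>) \<longlonglongrightarrow> (\<Sum>i<Suc m. \<theta> (p i) * (X (p (Suc i)) \<omega> - X (p i) \<omega>)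
        - \<theta> (p i) * integral {p i..p (Suc i)} (\<lambda>s. a - k * X s \<omega>)
        - \<sigma>\<^sup>2 / 2 * (\<theta> (p i))\<^sup>2 * integral {p i..p (Suc i)} (\<lambda>s. X s \<omega>))"
      unfolding split
      by (intro tendsto_sum tendsto_diff Slim tendsto_mult_left LIMSEQ_subseq_LIMSEQ [OF Qlim r, unfolded comp_def]) auto
    then show ?case
      by (simp only: step_exponent_def p_def l_def)
  qed
  with r show ?thesis by blast
qed

end

section \<open>Elementary calculus of \<open>psi\<close>\<close>

lemma psi_0 [simp]: "psi k 0 = 0"
  by (simp add: psi_def)

lemma psi_has_derivative: "(psi k has_real_derivative exp (- k * q)) (at q within S)"
proof (cases "k = 0")
  case True
  then have "psi k = (\<lambda>q. q)" by (auto simp: psi_def)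
  then show ?thesis using True by (auto intro!: derivative_eq_intros)
next
  case False
  then have "psi k = (\<lambda>q. (1 - exp (- k * q)) / k)" by (auto simp: psi_def)
  then show ?thesis using False by (auto intro!: derivative_eq_intros)
qed

lemma psi_strict_mono:
  assumes "p < q" shows "psi k p < psi k q"
proof (rule DERIV_pos_imp_increasing [OF assms])
  fix s show "\<exists>y. (psi k has_real_derivative y) (at s) \<and> 0 < y"
    using psi_has_derivative [of k s UNIV] by (intro exI [of _ "exp (- k * s)"]) simp
qed

lemma psi_mono: "p \<le> q \<Longrightarrow> psi k p \<le> psi k q"
  using psi_strict_mono [of p q k] by (cases "p = q") auto

lemma psi_pos: "t > 0 \<Longrightarrow> psi k t > 0"
  using psi_strict_mono [of 0 t k] by simp

lemma exp_mult_le_exp_abs: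
  fixes k q t :: real
  assumes "0 \<le> q" "q \<le> t"
  shows "exp (- k * q) \<le> exp (\<bar>k\<bar> * t)"
proof -
  have "- k * q \<le> \<bar>k\<bar> * q" using assms by (intro mult_right_mono) auto
  also have "\<dots> \<le> \<bar>k\<bar> * t" using assms by (intro mult_left_mono) auto
  finally show ?thesis by simp
qed

context cir_solution
begin

text \<open>\<open>step_exponent\<close> itself need not be measurable: on the null set of discontinuous paths its
  integrals are uncontrolled.\<close>

lemma step_exponent_measurable_versions:
  assumes t: "t > 0"
    and \<theta>: "\<And>s. s \<in> {0..t} \<Longrightarrow> (\<theta> has_real_derivative (k * \<theta> s - \<sigma>\<^sup>2 / 2 * (\<theta> s)\<^sup>2)) (at s within {0..t})"
    and A: "\<And>s. s \<in> {0..t} \<Longrightarrow> (A has_real_derivative (a * \<theta> s)) (at s within {0..t})"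
  shows "\<exists>Y. (\<forall>m. Y m \<in> borel_measurable M) \<and> (\<forall>m. AE \<omega> in M. Y m \<omega> = step_exponent \<theta> t m \<omega>)
    \<and> (AE \<omega> in M. (\<lambda>m. Y m \<omega>) \<longlonglongrightarrow> \<theta> t * X t \<omega> - \<theta> 0 * x - (A t - A 0))"
proof -
  have "\<exists>Y. Y \<in> borel_measurable M \<and> (AE \<omega> in M. Y \<omega> = step_exponent \<theta> t m \<omega>)" for m
  proof -
    obtain r where r: "AE \<omega> in M. (\<lambda>n. grid_exponent \<theta> t m (r n) \<omega>) \<longlonglongrightarrow> step_exponent \<theta> t m \<omega>"
      using grid_exponent_tendsto [OF t] by blast
    \<comment> \<open>\<open>lim\<close> is measurable on the whole space, including the paths on
      which the sequence diverges, and agrees with \<open>step_exponent\<close> almost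
      surely.\<close>
    have "(\<lambda>\<omega>. lim (\<lambda>n. grid_exponent \<theta> t m (r n) \<omega>)) \<in> borel_measurable M"
      by (intro borel_measurable_lim_metric grid_exponent_measurable t)
    moreover have "AE \<omega> in M. lim (\<lambda>n. grid_exponent \<theta> t m (r n) \<omega>) = step_exponent \<theta> t m \<omega>"
      using r by eventually_elim (rule limI)
    ultimately show ?thesis by blast
  qed
  then obtain Y where Y: "\<And>m. Y m \<in> borel_measurable M"
      and eq: "\<And>m. AE \<omega> in M. Y m \<omega> = step_exponent \<theta> t m \<omega>"
    by metis
  have "AE \<omega> in M. \<forall>m. Y m \<omega> = step_exponent \<theta> t m \<omega>"
    using eq by (simp add: AE_all_countable)
  then have "AE \<omega> in M. (\<lambda>m. Y m \<omega>) \<longlonglongrightarrow> \<theta> t * X t \<omega> - \<theta> 0 * x - (A t - A 0)"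
    using X_continuous X_0
  proof eventually_elim
    case (elim \<omega>)
    have "continuous_on {0..t} (\<lambda>s. X s \<omega>)"
      by (intro continuous_on_subset [OF elim(2)]) auto
    from riccati_exponent_tendsto [OF t this \<theta> A]
    have "(\<lambda>m. step_exponent \<theta> t m \<omega>) \<longlonglongrightarrow> \<theta> t * X t \<omega> - \<theta> 0 * X 0 \<omega> - (A t - A 0)"
      by (simp only: step_exponent_def)
    with elim show ?case by simp
  qed
  with Y eq show ?thesis by blast
qed

text \<open>Fatou's lemma is applied twice, in n and then in m. Mass may be lost, but no bound on
  moments of X enters, so this is the source of the first exponential moments.\<close>

lemma nn_integral_exp_le_1:
  assumes t: "t > 0"
    and \<theta>: "\<And>s. s \<in> {0..t} \<Longrightarrow> (\<theta> has_real_derivative (k * \<theta> s - \<sigma>\<^sup>2 / 2 * (\<theta> s)\<^sup>2)) (at s within {0..t})"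
    and A: "\<And>s. s \<in> {0..t} \<Longrightarrow> (A has_real_derivative (a * \<theta> s)) (at s within {0..t})"
  shows "(\<integral>\<^sup>+ \<omega>. ennreal (exp (\<theta> t * X t \<omega> - \<theta> 0 * x - (A t - A 0))) \<partial>M) \<le> 1"
proof -
  obtain Y where Y [measurable]: "\<And>m. Y m \<in> borel_measurable M"
    and eq: "\<And>m. AE \<omega> in M. Y m \<omega> = step_exponent \<theta> t m \<omega>"
    and lim: "AE \<omega> in M. (\<lambda>m. Y m \<omega>) \<longlonglongrightarrow> \<theta> t * X t \<omega> - \<theta> 0 * x - (A t - A 0)"
    using step_exponent_measurable_versions [OF t \<theta> A] by auto
  have step: "(\<integral>\<^sup>+ \<omega>. ennreal (exp (Y m \<omega>)) \<partial>M) \<le> 1" for m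
  proof -
    obtain r where r: "AE \<omega> in M. (\<lambda>n. grid_exponent \<theta> t m (r n) \<omega>) \<longlonglongrightarrow> step_exponent \<theta> t m \<omega>"
      using grid_exponent_tendsto [OF t] by blast
    have [measurable]: "grid_exponent \<theta> t m n \<in> borel_measurable M" for n
      by (rule grid_exponent_measurable [OF t])
    show ?thesis
    proof (rule nn_integral_AE_lim_le [where Y = "\<lambda>n \<omega>. exp (grid_exponent \<theta> t m (r n) \<omega>)"])
      show "AE \<omega> in M. (\<lambda>n. exp (grid_exponent \<theta> t m (r n) \<omega>)) \<longlonglongrightarrow> exp (Y m \<omega>)"
        using r eq [of m] by eventually_elim (auto intro: tendsto_exp)
      show "(\<integral>\<^sup>+ \<omega>. ennreal (exp (grid_exponent \<theta> t m (r n) \<omega>)) \<partial>M) \<le> 1" for n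
        by (simp only: nn_integral_exp_grid_exponent [OF t] order_refl)
    qed measurable
  qed
  show ?thesis
  proof (rule nn_integral_AE_lim_le [where Y = "\<lambda>m \<omega>. exp (Y m \<omega>)", OF _ _ step])
    show "AE \<omega> in M. (\<lambda>m. exp (Y m \<omega>)) \<longlonglongrightarrow> exp (\<theta> t * X t \<omega> - \<theta> 0 * x - (A t - A 0))"
      using lim by eventually_elim (rule tendsto_exp)
  qed measurable
qed

text \<open>The exponent 6 Q of the square estimate is at most the average over the N grid times of
  6 \<sigma>^2 \<Theta>^2 t |X|, hence of \<open>u\<^sub>0\<close> |X|. Jensen's inequality for exp
  bounds its exponential by the average of exponential moments, so the bound does not depend on m
  and n.\<close>

lemma nn_integral_exp_grid_exponent_square_le:
  assumes t: "t > 0"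
    and B: "\<And>s. s \<in> {0..t} \<Longrightarrow> (\<integral>\<^sup>+ \<omega>. ennreal (exp (u\<^sub>0 * X s \<omega>)) \<partial>M) \<le> ennreal B"
    and bd: "\<And>s. s \<in> {0..t} \<Longrightarrow> \<bar>\<theta> s\<bar> \<le> \<Theta>" and u0: "6 * \<sigma>\<^sup>2 * \<Theta>\<^sup>2 * t \<le> u\<^sub>0"
  shows "(\<integral>\<^sup>+ \<omega>. ennreal ((exp (grid_exponent \<theta> t m n \<omega>))\<^sup>2) \<partial>M) \<le> ennreal (1 / 2) * (1 + ennreal B)"
proof -
  define N where "N = Suc m * Suc n"
  define h where "h = mesh t m n"
  have N: "N > 0" by (simp add: N_def)
  have h: "h > 0" using mesh_pos [OF t] by (simp add: h_def)
  have hN: "h = t / real N" by (simp only: h_def mesh_def N_def of_nat_mult divide_divide_eq_left)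
  have in_t: "real j * h \<in> {0..t}" if "j < N" for j
  proof -
    have "real j * h \<le> real N * h" using that h by (intro mult_right_mono) auto
    moreover have "real N * h = t" using N by (simp add: hN)
    ultimately show ?thesis using h by simp
  qed
  have XM [measurable]: "X (real j * h) \<in> borel_measurable M" for j
    using h by (intro X_measurable) simp
  have coeff: "(exp_coeff \<theta> t m n j \<omega>)\<^sup>2 \<le> \<sigma>\<^sup>2 * \<Theta>\<^sup>2 * \<bar>X (real j * h) \<omega>\<bar>" if j: "j < N" for j \<omega>
  proof -
    have "j div Suc n < Suc m" using j by (simp add: N_def less_mult_imp_div_less)
    then have "real (j div Suc n) * (t / real (Suc m)) \<le> real (Suc m) * (t / real (Suc m))"
      using t by (intro mult_right_mono) auto
    then have "real (j div Suc n) * (t / real (Suc m)) \<in> {0..t}"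
      using t by (simp del: of_nat_Suc)
    then have "(\<theta> (real (j div Suc n) * (t / real (Suc m))))\<^sup>2 \<le> \<Theta>\<^sup>2"
      using power_mono [OF bd abs_ge_zero, of _ 2] by (simp only: power2_abs)
    then have "(\<theta> (real (j div Suc n) * (t / real (Suc m))))\<^sup>2 * (lp_coeff X h n j \<omega>)\<^sup>2
        \<le> \<Theta>\<^sup>2 * \<bar>X (real j * h) \<omega>\<bar>"
      by (intro mult_mono lp_coeff_bounds) auto
    then show ?thesis
      unfolding exp_coeff_def h_def [symmetric] power_mult_distrib mult.assoc
      by (intro mult_left_mono) auto
  qed
  have pw: "exp (6 * h * (\<Sum>j<N. (exp_coeff \<theta> t m n j \<omega>)\<^sup>2))
      \<le> (\<Sum>j<N. 1 / real N * exp (u\<^sub>0 * \<bar>X (real j * h) \<omega>\<bar>))" for \<omega>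
  proof -
    have "6 * h * (\<Sum>j<N. (exp_coeff \<theta> t m n j \<omega>)\<^sup>2)
        \<le> 6 * h * (\<Sum>j<N. \<sigma>\<^sup>2 * \<Theta>\<^sup>2 * \<bar>X (real j * h) \<omega>\<bar>)"
      using h coeff by (intro mult_left_mono sum_mono) auto
    also have "\<dots> = (\<Sum>j<N. 1 / real N * (6 * \<sigma>\<^sup>2 * \<Theta>\<^sup>2 * t * \<bar>X (real j * h) \<omega>\<bar>))"
      by (simp add: sum_distrib_left hN mult_ac)
    also have "\<dots> \<le> (\<Sum>j<N. 1 / real N * (u\<^sub>0 * \<bar>X (real j * h) \<omega>\<bar>))"
      using u0 by (intro sum_mono mult_left_mono mult_right_mono) auto
    finally have "exp (6 * h * (\<Sum>j<N. (exp_coeff \<theta> t m n j \<omega>)\<^sup>2))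
        \<le> exp (\<Sum>j<N. (1 / real N) *\<^sub>R (u\<^sub>0 * \<bar>X (real j * h) \<omega>\<bar>))"
      by simp
    also have "\<dots> \<le> (\<Sum>j<N. 1 / real N * exp (u\<^sub>0 * \<bar>X (real j * h) \<omega>\<bar>))"
      using N by (intro convex_on_sum [OF _ _ exp_convex]) auto
    finally show ?thesis .
  qed
  have "(\<integral>\<^sup>+ \<omega>. ennreal (exp (6 * h * (\<Sum>j<N. (exp_coeff \<theta> t m n j \<omega>)\<^sup>2))) \<partial>M)
      \<le> (\<integral>\<^sup>+ \<omega>. (\<Sum>j<N. ennreal (1 / real N) * ennreal (exp (u\<^sub>0 * \<bar>X (real j * h) \<omega>\<bar>))) \<partial>M)"
  proof (rule nn_integral_mono)
    fix \<omega>
    have "ennreal (exp (6 * h * (\<Sum>j<N. (exp_coeff \<theta> t m n j \<omega>)\<^sup>2)))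
        \<le> ennreal (\<Sum>j<N. 1 / real N * exp (u\<^sub>0 * \<bar>X (real j * h) \<omega>\<bar>))"
      by (rule ennreal_leI [OF pw])
    also have "\<dots> = (\<Sum>j<N. ennreal (1 / real N) * ennreal (exp (u\<^sub>0 * \<bar>X (real j * h) \<omega>\<bar>)))"
      by (subst sum_ennreal [symmetric]) (auto intro!: sum.cong simp: ennreal_mult' [symmetric])
    finally show "ennreal (exp (6 * h * (\<Sum>j<N. (exp_coeff \<theta> t m n j \<omega>)\<^sup>2)))
        \<le> (\<Sum>j<N. ennreal (1 / real N) * ennreal (exp (u\<^sub>0 * \<bar>X (real j * h) \<omega>\<bar>)))" .
  qed
  also have "\<dots> = (\<Sum>j<N. ennreal (1 / real N) * (\<integral>\<^sup>+ \<omega>. ennreal (exp (u\<^sub>0 * \<bar>X (real j * h) \<omega>\<bar>)) \<partial>M))"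
    by (subst nn_integral_sum) (auto simp: nn_integral_cmult)
  also have "\<dots> \<le> (\<Sum>j<N. ennreal (1 / real N) * ennreal B)"
  proof (intro sum_mono mult_left_mono)
    fix j assume "j \<in> {..<N}"
    then have j: "real j * h \<in> {0..t}" by (intro in_t) auto
    have "AE \<omega> in M. \<bar>X (real j * h) \<omega>\<bar> = X (real j * h) \<omega>"
      using X_nonneg by eventually_elim (use j in auto)
    then have "(\<integral>\<^sup>+ \<omega>. ennreal (exp (u\<^sub>0 * \<bar>X (real j * h) \<omega>\<bar>)) \<partial>M) = (\<integral>\<^sup>+ \<omega>. ennreal (exp (u\<^sub>0 * X (real j * h) \<omega>)) \<partial>M)"
      by (intro nn_integral_cong_AE) (auto elim: eventually_mono)
    then show "(\<integral>\<^sup>+ \<omega>. ennreal (exp (u\<^sub>0 * \<bar>X (real j * h) \<omega>\<bar>)) \<partial>M) \<le> ennreal B"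
      using B [OF j] by simp
  qed simp
  also have "\<dots> = ennreal (real N * (1 / real N)) * ennreal B"
    by (simp only: sum_constant card_lessThan mult.assoc [symmetric] ennreal_of_nat_eq_real_of_nat
        ennreal_mult' [OF of_nat_0_le_iff])
  also have "\<dots> = ennreal B" using N by simp
  finally have "(\<integral>\<^sup>+ \<omega>. ennreal (exp (6 * h * (\<Sum>j<N. (exp_coeff \<theta> t m n j \<omega>)\<^sup>2))) \<partial>M) \<le> ennreal B" .
  then have "ennreal (1 / 2) * (1 + (\<integral>\<^sup>+ \<omega>. ennreal (exp (6 * h * (\<Sum>j<N. (exp_coeff \<theta> t m n j \<omega>)\<^sup>2))) \<partial>M))
      \<le> ennreal (1 / 2) * (1 + ennreal B)"
    by (intro mult_left_mono add_left_mono) auto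
  moreover have "(\<integral>\<^sup>+ \<omega>. ennreal ((exp (grid_exponent \<theta> t m n \<omega>))\<^sup>2) \<partial>M)
     \<le> ennreal (1 / 2) * (1 + (\<integral>\<^sup>+ \<omega>. ennreal (exp (6 * h * (\<Sum>j<N. (exp_coeff \<theta> t m n j \<omega>)\<^sup>2))) \<partial>M))"
    unfolding grid_exponent_def h_def N_def
    by (intro brownian_nn_integral_exp_square_le [OF prob_space_axioms filt bm] exp_coeff_adapted mesh_pos t)
  ultimately show ?thesis by (rule order_trans [rotated])
qed

text \<open>The L^2 bound has to survive the limit in n in order to be available for the limit in m;
  Fatou's lemma for the squares transfers it to the \<open>Y m\<close>.\<close>

lemma nn_integral_exp_eq_1:
  assumes t: "t > 0"
    and \<theta>: "\<And>s. s \<in> {0..t} \<Longrightarrow> (\<theta> has_real_derivative (k * \<theta> s - \<sigma>\<^sup>2 / 2 * (\<theta> s)\<^sup>2)) (at s within {0..t})"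
    and A: "\<And>s. s \<in> {0..t} \<Longrightarrow> (A has_real_derivative (a * \<theta> s)) (at s within {0..t})"
    and B: "\<And>s. s \<in> {0..t} \<Longrightarrow> (\<integral>\<^sup>+ \<omega>. ennreal (exp (u\<^sub>0 * X s \<omega>)) \<partial>M) \<le> ennreal B" "B \<ge> 0"
    and bd: "\<And>s. s \<in> {0..t} \<Longrightarrow> \<bar>\<theta> s\<bar> \<le> \<Theta>" and u0: "6 * \<sigma>\<^sup>2 * \<Theta>\<^sup>2 * t \<le> u\<^sub>0"
  shows "(\<integral>\<^sup>+ \<omega>. ennreal (exp (\<theta> t * X t \<omega> - \<theta> 0 * x - (A t - A 0))) \<partial>M) = 1"
proof -
  obtain Y where Y [measurable]: "\<And>m. Y m \<in> borel_measurable M"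
    and eq: "\<And>m. AE \<omega> in M. Y m \<omega> = step_exponent \<theta> t m \<omega>"
    and lim: "AE \<omega> in M. (\<lambda>m. Y m \<omega>) \<longlonglongrightarrow> \<theta> t * X t \<omega> - \<theta> 0 * x - (A t - A 0)"
    using step_exponent_measurable_versions [OF t \<theta> A] by auto
  define B' where "B' = 1 / 2 * (1 + B)"
  have "B' \<ge> 0" using B(2) by (simp add: B'_def)
  moreover have "ennreal B' = ennreal (1 / 2) * (1 + ennreal B)"
    unfolding B'_def using B(2) by (subst ennreal_mult, simp, simp, subst ennreal_plus, simp_all)
  ultimately have B': "B' \<ge> 0" "ennreal B' = ennreal (1 / 2) * (1 + ennreal B)" .
  have step: "(\<integral>\<^sup>+ \<omega>. ennreal (exp (Y m \<omega>)) \<partial>M) = 1"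
      "(\<integral>\<^sup>+ \<omega>. ennreal ((exp (Y m \<omega>))\<^sup>2) \<partial>M) \<le> ennreal B'" for m
  proof -
    obtain r where r: "AE \<omega> in M. (\<lambda>n. grid_exponent \<theta> t m (r n) \<omega>) \<longlonglongrightarrow> step_exponent \<theta> t m \<omega>"
      using grid_exponent_tendsto [OF t] by blast
    have [measurable]: "grid_exponent \<theta> t m n \<in> borel_measurable M" for n
      by (rule grid_exponent_measurable [OF t])
    have g: "AE \<omega> in M. (\<lambda>n. exp (grid_exponent \<theta> t m (r n) \<omega>)) \<longlonglongrightarrow> exp (Y m \<omega>)"
      using r eq [of m] by eventually_elim (auto intro: tendsto_exp)
    have sq: "(\<integral>\<^sup>+ \<omega>. ennreal ((exp (grid_exponent \<theta> t m n \<omega>))\<^sup>2) \<partial>M) \<le> ennreal B'" for n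
      unfolding B'(2) by (rule nn_integral_exp_grid_exponent_square_le [OF t B(1) bd u0])
    show "(\<integral>\<^sup>+ \<omega>. ennreal (exp (Y m \<omega>)) \<partial>M) = 1"
      by (rule nn_integral_AE_lim_eq_1 [where Y = "\<lambda>n \<omega>. exp (grid_exponent \<theta> t m (r n) \<omega>)" and B = B'])
        (use g sq B'(1) nn_integral_exp_grid_exponent [OF t] in simp_all)
    show "(\<integral>\<^sup>+ \<omega>. ennreal ((exp (Y m \<omega>))\<^sup>2) \<partial>M) \<le> ennreal B'"
    proof (rule nn_integral_AE_lim_le [where Y = "\<lambda>n \<omega>. (exp (grid_exponent \<theta> t m (r n) \<omega>))\<^sup>2", OF _ _ sq])
      show "AE \<omega> in M. (\<lambda>n. (exp (grid_exponent \<theta> t m (r n) \<omega>))\<^sup>2) \<longlonglongrightarrow> (exp (Y m \<omega>))\<^sup>2"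
        using g by eventually_elim (rule tendsto_power)
    qed measurable
  qed
  have [measurable]: "X t \<in> borel_measurable M" using t by (intro X_measurable) simp
  show ?thesis
  proof (rule nn_integral_AE_lim_eq_1 [where Y = "\<lambda>m \<omega>. exp (Y m \<omega>)" and B = B'])
    show "AE \<omega> in M. (\<lambda>m. exp (Y m \<omega>)) \<longlonglongrightarrow> exp (\<theta> t * X t \<omega> - \<theta> 0 * x - (A t - A 0))"
      using lim by eventually_elim (rule tendsto_exp)
  qed (use step B'(1) in simp_all)
qed

section \<open>Explicit Riccati solution and moment generating function\<close>

definition laplace_denom :: "real \<Rightarrow> real \<Rightarrow> real" where
  "laplace_denom u q = 1 - u * \<sigma>\<^sup>2 * psi k q / 2"

text \<open>For u > 0 the reciprocal of \<theta> obeys a linear equation; this is the solution with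
  terminal value u at s = t. Its value at s = 0 becomes the coefficient of x in the logarithm of
  E[exp(u X_t)].\<close>

definition riccati :: "real \<Rightarrow> real \<Rightarrow> real \<Rightarrow> real" where
  "riccati u t s = u * exp (- k * (t - s)) / laplace_denom u (t - s)"

text \<open>The hypothesis keeps u below half the value at which the denominator vanishes at time t;
  as \<open>psi\<close> increases, there is no blow-up before t either.\<close>

lemma laplace_denom_bounds:
  assumes "0 \<le> u" "u * \<sigma>\<^sup>2 * psi k t \<le> 1" "0 \<le> q" "q \<le> t"
  shows "1 / 2 \<le> laplace_denom u q" "laplace_denom u q \<le> 1"
proof -
  have "u * \<sigma>\<^sup>2 * psi k q \<le> u * \<sigma>\<^sup>2 * psi k t"
    using assms by (intro mult_left_mono psi_mono) auto
  then show "1 / 2 \<le> laplace_denom u q"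
    using assms by (simp add: laplace_denom_def)
  have "0 \<le> u * \<sigma>\<^sup>2 * psi k q"
    using assms psi_mono [of 0 q k] by simp
  then show "laplace_denom u q \<le> 1" by (simp add: laplace_denom_def)
qed

lemma laplace_denom_derivative:
  "((\<lambda>s. laplace_denom u (t - s)) has_real_derivative (u * \<sigma>\<^sup>2 * exp (- k * (t - s)) / 2)) (at s within S)"
proof -
  have "((\<lambda>s. psi k (t - s)) has_real_derivative (exp (- k * (t - s)) * (0 - 1))) (at s within S)"
    by (intro DERIV_chain2 [OF psi_has_derivative] derivative_intros)
  then show ?thesis
    unfolding laplace_denom_def by (auto intro!: derivative_eq_intros)
qed

lemma riccati_derivative:
  assumes "laplace_denom u (t - s) > 0"
  shows "(riccati u t has_real_derivative (k * riccati u t s - \<sigma>\<^sup>2 / 2 * (riccati u t s)\<^sup>2)) (at s within S)"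
proof -
  define D where "D = laplace_denom u (t - s)"
  have D: "D > 0" using assms by (simp add: D_def)
  have "(riccati u t has_real_derivative
      ((u * (exp (- k * (t - s)) * k)) * D - u * exp (- k * (t - s)) * (u * \<sigma>\<^sup>2 * exp (- k * (t - s)) / 2)) / (D * D))
      (at s within S)"
    unfolding riccati_def [abs_def] D_def using assms
    by (intro DERIV_divide laplace_denom_derivative) (auto intro!: derivative_eq_intros)
  moreover have "((u * (exp (- k * (t - s)) * k)) * D - u * exp (- k * (t - s)) * (u * \<sigma>\<^sup>2 * exp (- k * (t - s)) / 2)) / (D * D)
      = k * riccati u t s - \<sigma>\<^sup>2 / 2 * (riccati u t s)\<^sup>2"
    unfolding riccati_def D_def [symmetric] using D
    by (simp add: field_simps power2_eq_square)
  ultimately show ?thesis by simp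
qed

text \<open>With D the denominator as a function of s, \<theta> = (2/\<sigma>^2) D'/D, so
  (2a/\<sigma>^2) ln D is a primitive of a \<theta>. This is where the exponent -v of the generating
  function comes from.\<close>

lemma ln_laplace_denom_derivative:
  assumes "laplace_denom u (t - s) > 0" and "\<sigma> > 0"
  shows "((\<lambda>s. 2 * a / \<sigma>\<^sup>2 * ln (laplace_denom u (t - s))) has_real_derivative (a * riccati u t s)) (at s within S)"
proof -
  have "((\<lambda>s. 2 * a / \<sigma>\<^sup>2 * ln (laplace_denom u (t - s))) has_real_derivative
      (2 * a / \<sigma>\<^sup>2 * (1 / laplace_denom u (t - s) * (u * \<sigma>\<^sup>2 * exp (- k * (t - s)) / 2)))) (at s within S)"
    by (intro DERIV_cmult DERIV_chain2 [OF DERIV_ln_divide] laplace_denom_derivative assms)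
  moreover have "2 * a / \<sigma>\<^sup>2 * (1 / laplace_denom u (t - s) * (u * \<sigma>\<^sup>2 * exp (- k * (t - s)) / 2)) = a * riccati u t s"
    using assms by (simp add: riccati_def field_simps)
  ultimately show ?thesis by simp
qed

text \<open>The deterministic part is factored out; \<open>laplace_denom u 0\<close> is 1, so only
  the logarithm at time t remains. The terms \<open>t - t\<close> and \<open>t - 0\<close> stay
  unsimplified so that the integral matches A t - A 0 in \<open>nn_integral_exp_le_1\<close> and
  \<open>nn_integral_exp_eq_1\<close>.\<close>

lemma mgf_exponent:
  assumes "laplace_denom u t > 0" and t: "t \<ge> 0"
  shows "(\<integral>\<^sup>+ \<omega>. ennreal (exp (u * X t \<omega>)) \<partial>M)
    = ennreal (laplace_denom u t powr (- (2 * a / \<sigma>\<^sup>2)) * exp (riccati u t 0 * x)) *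
      (\<integral>\<^sup>+ \<omega>. ennreal (exp (riccati u t t * X t \<omega> - riccati u t 0 * x
         - (2 * a / \<sigma>\<^sup>2 * ln (laplace_denom u (t - t)) - 2 * a / \<sigma>\<^sup>2 * ln (laplace_denom u (t - 0))))) \<partial>M)"
proof -
  have [measurable]: "X t \<in> borel_measurable M" using t by (rule X_measurable)
  have "exp (u * X t \<omega>) = laplace_denom u t powr (- (2 * a / \<sigma>\<^sup>2)) * exp (riccati u t 0 * x) *
      exp (riccati u t t * X t \<omega> - riccati u t 0 * x
         - (2 * a / \<sigma>\<^sup>2 * ln (laplace_denom u (t - t)) - 2 * a / \<sigma>\<^sup>2 * ln (laplace_denom u (t - 0))))" for \<omega>
    using assms by (simp add: powr_def exp_add [symmetric] riccati_def laplace_denom_def)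
  then show ?thesis
    by (simp only: ennreal_mult' mult_nonneg_nonneg powr_ge_zero exp_ge_zero)
      (intro nn_integral_cmult, measurable)
qed

lemma nn_integral_exp_le_mgf:
  assumes \<sigma>: "\<sigma> > 0" and t: "t > 0" and u: "0 \<le> u" "u * \<sigma>\<^sup>2 * psi k t \<le> 1"
  shows "(\<integral>\<^sup>+ \<omega>. ennreal (exp (u * X t \<omega>)) \<partial>M)
    \<le> ennreal (laplace_denom u t powr (- (2 * a / \<sigma>\<^sup>2)) * exp (riccati u t 0 * x))"
proof -
  have D: "laplace_denom u (t - s) > 0" if "s \<in> {0..t}" for s
    using laplace_denom_bounds(1) [OF u, of "t - s"] that by auto
  show ?thesis
    using D [of 0] t mult_left_mono [OF nn_integral_exp_le_1 [OF t riccati_derivative [OF D] ln_laplace_denom_derivative [OF D \<sigma>]],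
        of "ennreal (laplace_denom u t powr (- (2 * a / \<sigma>\<^sup>2)) * exp (riccati u t 0 * x))"]
    by (subst mgf_exponent) auto
qed

lemma nn_integral_exp_eq_mgf:
  assumes \<sigma>: "\<sigma> > 0" and a: "a > 0" and x: "x \<ge> 0" and t: "t > 0"
  shows "\<exists>\<epsilon>>0. \<forall>u\<in>{0..\<epsilon>}. u * \<sigma>\<^sup>2 * psi k t \<le> 1 \<and> (\<integral>\<^sup>+ \<omega>. ennreal (exp (u * X t \<omega>)) \<partial>M)
    = ennreal (laplace_denom u t powr (- (2 * a / \<sigma>\<^sup>2)) * exp (riccati u t 0 * x))"
proof -
  define v where "v = 2 * a / \<sigma>\<^sup>2"
  define E where "E = exp (\<bar>k\<bar> * t)"
  define u\<^sub>0 where "u\<^sub>0 = 1 / (\<sigma>\<^sup>2 * psi k t)"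
  define B where "B = (1 / 2) powr (- v) * exp (2 * u\<^sub>0 * E * x)"
  \<comment> \<open>With \<Theta> = 2 u E the required exponent 6 \<sigma>^2 \<Theta>^2 t is u * (u
    * c), whence 24 = 6 * 4. In \<epsilon>, the bound 1 removes one factor u,
    \<open>u\<^sub>0 / c\<close> gives u c <= \<open>u\<^sub>0\<close>, and \<open>u\<^sub>0\<close>
    protects the denominators.\<close>
  define c where "c = 24 * \<sigma>\<^sup>2 * E\<^sup>2 * t"
  define \<epsilon> where "\<epsilon> = min u\<^sub>0 (min 1 (u\<^sub>0 / c))"
  have v: "v > 0" using a \<sigma> by (simp add: v_def)
  have E1: "E \<ge> 1" using t by (simp add: E_def)
  have u0: "u\<^sub>0 > 0" using psi_pos [OF t] \<sigma> by (simp add: u\<^sub>0_def)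
  have u0t: "u\<^sub>0 * \<sigma>\<^sup>2 * psi k t = 1" using psi_pos [OF t, of k] \<sigma> by (simp add: u\<^sub>0_def)
  have c: "c > 0" using \<sigma> t E1 by (simp add: c_def)
  have B0: "B \<ge> 0" by (simp add: B_def)
  have ric: "0 \<le> riccati u s r \<and> riccati u s r \<le> 2 * u * E"
    if "0 \<le> u" "u * \<sigma>\<^sup>2 * psi k s \<le> 1" "0 \<le> r" "r \<le> s" "s \<le> t" for u s r
  proof -
    have D: "1 / 2 \<le> laplace_denom u (s - r)"
      using that by (intro laplace_denom_bounds [where t = s]) auto
    have "exp (- k * (s - r)) \<le> E"
      unfolding E_def using that by (intro exp_mult_le_exp_abs) auto
    then have "riccati u s r \<le> (u * E) / (1 / 2)"
      unfolding riccati_def using D that E1 by (intro frac_le mult_left_mono) auto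
    moreover have "0 \<le> riccati u s r"
      unfolding riccati_def using D that by simp
    ultimately show ?thesis by simp
  qed
  have bound: "(\<integral>\<^sup>+ \<omega>. ennreal (exp (u\<^sub>0 * X s \<omega>)) \<partial>M) \<le> ennreal B" if s: "s \<in> {0..t}" for s
  proof (cases "s = 0")
    case True
    have "(\<integral>\<^sup>+ \<omega>. ennreal (exp (u\<^sub>0 * X s \<omega>)) \<partial>M) = (\<integral>\<^sup>+ \<omega>. ennreal (exp (u\<^sub>0 * x)) \<partial>M)"
      using X_0 True by (intro nn_integral_cong_AE) auto
    also have "\<dots> = ennreal (exp (u\<^sub>0 * x))"
      by (simp add: emeasure_space_1)
    also have "\<dots> \<le> ennreal B"
    proof (rule ennreal_leI)
      have "(1 / 2) powr (- v) \<ge> (1::real)"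
        using v by (simp add: powr_minus powr_divide ge_one_powr_ge_zero)
      moreover have "u\<^sub>0 * x \<le> 2 * u\<^sub>0 * E * x"
        using u0 x E1 by (intro mult_right_mono) (auto simp: field_simps)
      ultimately show "exp (u\<^sub>0 * x) \<le> B"
        unfolding B_def using mult_mono [of 1 "(1 / 2) powr (- v)" "exp (u\<^sub>0 * x)" "exp (2 * u\<^sub>0 * E * x)"] by simp
    qed
    finally show ?thesis .
  next
    case False
    with s have s: "s > 0" "s \<le> t" by auto
    have us: "u\<^sub>0 * \<sigma>\<^sup>2 * psi k s \<le> 1"
      using u0t u0 psi_mono [OF s(2), of k] \<sigma> by (metis mult_left_mono less_imp_le mult_nonneg_nonneg zero_le_power2)
    have D: "1 / 2 \<le> laplace_denom u\<^sub>0 s"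
      using u0 us s by (intro laplace_denom_bounds [where t = s]) auto
    have "laplace_denom u\<^sub>0 s powr (- v) \<le> (1 / 2) powr (- v)"
      using D v by (intro powr_mono2') auto
    moreover have "exp (riccati u\<^sub>0 s 0 * x) \<le> exp (2 * u\<^sub>0 * E * x)"
      using ric [of u\<^sub>0 s 0] u0 us s x by (simp add: mult_right_mono)
    ultimately have "laplace_denom u\<^sub>0 s powr (- v) * exp (riccati u\<^sub>0 s 0 * x) \<le> B"
      unfolding B_def by (intro mult_mono) auto
    then show ?thesis
      using order_trans [OF nn_integral_exp_le_mgf [OF \<sigma> s(1) _ us] ennreal_leI] u0 by (simp add: v_def)
  qed
  have "\<epsilon> > 0" using u0 c by (simp add: \<epsilon>_def)
  moreover have "u * \<sigma>\<^sup>2 * psi k t \<le> 1 \<and> (\<integral>\<^sup>+ \<omega>. ennreal (exp (u * X t \<omega>)) \<partial>M)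
    = ennreal (laplace_denom u t powr (- (2 * a / \<sigma>\<^sup>2)) * exp (riccati u t 0 * x))" if u: "u \<in> {0..\<epsilon>}" for u
  proof -
    have u': "0 \<le> u" "u \<le> u\<^sub>0" "u \<le> 1" "u * c \<le> u\<^sub>0"
      using u c by (auto simp: \<epsilon>_def field_simps)
    have ut: "u * \<sigma>\<^sup>2 * psi k t \<le> 1"
    proof -
      have "u * (\<sigma>\<^sup>2 * psi k t) \<le> u\<^sub>0 * (\<sigma>\<^sup>2 * psi k t)"
        using u' psi_pos [OF t, of k] by (intro mult_right_mono) auto
      then show ?thesis using u0t by (simp add: mult.assoc)
    qed
    have D: "laplace_denom u (t - s) > 0" if "s \<in> {0..t}" for s
      using laplace_denom_bounds(1) [OF u'(1) ut, of "t - s"] that by auto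
    have bd: "\<bar>riccati u t s\<bar> \<le> 2 * u * E" if "s \<in> {0..t}" for s
      using ric [OF u'(1) ut, of s] that by auto
    have "6 * \<sigma>\<^sup>2 * (2 * u * E)\<^sup>2 * t = u * (u * c)"
      by (simp add: c_def power2_eq_square)
    also have "\<dots> \<le> 1 * (u * c)"
      using u' c by (intro mult_right_mono) auto
    finally have small: "6 * \<sigma>\<^sup>2 * (2 * u * E)\<^sup>2 * t \<le> u\<^sub>0"
      using u'(4) by simp
    show ?thesis
      using ut D [of 0] t nn_integral_exp_eq_1 [OF t riccati_derivative [OF D] ln_laplace_denom_derivative [OF D \<sigma>]
          bound B0 bd small]
      by (subst mgf_exponent) auto
  qed
  ultimately show ?thesis by blast
qed

end

section \<open>Moments of the CIR process\<close>

lemma sums_of_suminf_ennreal: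
  fixes g :: "nat \<Rightarrow> real"
  assumes "\<And>i. 0 \<le> g i" "(\<Sum>i. ennreal (g i)) = ennreal G" "0 \<le> G"
  shows "g sums G"
proof -
  have sm: "summable g"
    by (rule summable_suminf_not_top [OF assms(1)]) (simp add: assms(2))
  have "ennreal (suminf g) = ennreal G"
    using suminf_ennreal2 [OF assms(1) sm] assms(2) by (rule trans [OF sym])
  then have "suminf g = G"
    using assms(3) suminf_nonneg [OF sm assms(1)] by (simp only: ennreal_inj)
  with sm show ?thesis by (simp add: sums_iff)
qed

lemma suminf_ennreal_swap:
  fixes f :: "nat \<Rightarrow> nat \<Rightarrow> ennreal"
  shows "(\<Sum>i. \<Sum>j. f i j) = (\<Sum>j. \<Sum>i. f i j)"
proof -
  have "(\<Sum>i. \<Sum>j. f i j) = (\<integral>\<^sup>+ i. (\<Sum>j. f i j) \<partial>count_space UNIV)"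
    by (simp add: nn_integral_count_space_nat)
  also have "\<dots> = (\<Sum>j. \<integral>\<^sup>+ i. f i j \<partial>count_space UNIV)"
    by (intro nn_integral_suminf) simp
  finally show ?thesis by (simp add: nn_integral_count_space_nat)
qed

text \<open>The series are compared only for u >= 0. By induction the earlier coefficients of the
  difference vanish; after division by u^n the remaining series is continuous at 0 and zero along a
  sequence decreasing to 0, so its constant term is zero.\<close>

lemma powser_eq_imp_coeff_eq:
  fixes p q :: "nat \<Rightarrow> real"
  assumes \<epsilon>: "\<epsilon> > 0"
    and p: "\<And>u. u \<in> {0..\<epsilon>} \<Longrightarrow> (\<lambda>n. p n * u ^ n) sums G u"
    and q: "\<And>u. u \<in> {0..\<epsilon>} \<Longrightarrow> (\<lambda>n. q n * u ^ n) sums G u"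
  shows "p n = q n"
proof -
  define c where "c n = p n - q n" for n
  have c: "(\<lambda>n. c n * u ^ n) sums 0" if "u \<in> {0..\<epsilon>}" for u
    using sums_diff [OF p [OF that] q [OF that]] by (simp add: c_def left_diff_distrib)
  have "c n = 0"
  proof (induction n rule: less_induct)
    case (less n)
    have shift: "(\<lambda>i. c (i + n) * u ^ i) sums 0" if u: "u \<in> {0<..\<epsilon>}" for u
    proof -
      have "(\<lambda>i. c (i + n) * u ^ (i + n)) sums 0"
        using c [of u] u less.IH by (subst sums_zero_iff_shift) auto
      from sums_mult [OF this, of "inverse (u ^ n)"]
      have "(\<lambda>i. inverse (u ^ n) * (c (i + n) * u ^ (i + n))) sums 0"
        by simp
      moreover have "inverse (u ^ n) * (c (i + n) * u ^ (i + n)) = c (i + n) * u ^ i" for i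
        using u by (simp add: power_add)
      ultimately show ?thesis by simp
    qed
    define f where "f u = (\<Sum>i. c (i + n) * u ^ i)" for u
    have "isCont f 0"
      unfolding f_def using sums_summable [OF shift [of \<epsilon>]] \<epsilon> by (intro isCont_powser [where K = \<epsilon>]) simp_all
    moreover have lim: "(\<lambda>m. \<epsilon> / real (Suc m)) \<longlonglongrightarrow> 0"
      by (intro LIMSEQ_Suc [OF lim_const_over_n])
    ultimately have "(\<lambda>m. f (\<epsilon> / real (Suc m))) \<longlonglongrightarrow> f 0"
      by (rule isCont_tendsto_compose)
    moreover have "f (\<epsilon> / real (Suc m)) = 0" for m
    proof -
      have "\<epsilon> / real (Suc m) \<in> {0<..\<epsilon>}"
        using \<epsilon> by (simp add: field_simps)
      from sums_unique [OF shift [OF this]] show ?thesis by (simp only: f_def)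
    qed
    ultimately have "f 0 = 0"
      by (simp add: LIMSEQ_const_iff)
    moreover have "f 0 = c n"
      unfolding f_def using powser_sums_zero [of "\<lambda>i. c (i + n)"] by (simp add: sums_iff)
    ultimately show ?case by simp
  qed
  then show ?thesis by (simp add: c_def)
qed

lemma negative_binomial_sums:
  fixes w z :: real
  assumes "\<bar>w\<bar> < 1"
  shows "(\<lambda>m. pochhammer z m / fact m * w ^ m) sums (1 - w) powr (- z)"
proof -
  have "((- z) gchoose m) * (- w) ^ m = pochhammer z m / fact m * w ^ m" for m
  proof -
    have "((- z) gchoose m) * (- w) ^ m = pochhammer z m / fact m * ((- 1) ^ m * (- w) ^ m)"
      by (simp add: gbinomial_pochhammer)
    also have "(- 1) ^ m * (- w) ^ m = w ^ m"
      by (simp only: power_mult_distrib [symmetric]) simp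
    finally show ?thesis .
  qed
  then show ?thesis
    using gen_binomial_real [of "- w" "- z"] assms by simp
qed

section \<open>Exponential generating function of \<open>delta_cir\<close>\<close>

lemma delta_cir_pochhammer:
  assumes "j \<le> L"
  shows "delta_cir j L v = fact L / (fact j * fact (L - j)) * pochhammer (v + real j) (L - j)"
proof -
  have "(\<Prod>q\<in>{j..<L}. real q + v) = (\<Prod>i\<in>{0..<L - j}. real (i + j) + v)"
    using assms prod.shift_bounds_nat_ivl [of "\<lambda>q. real q + v" 0 j "L - j"] by simp
  then show ?thesis
    using assms by (simp add: delta_cir_def pochhammer_prod binomial_fact add_ac)
qed

lemma delta_cir_nonneg: "v \<ge> 0 \<Longrightarrow> delta_cir j L v \<ge> 0"
  unfolding delta_cir_def by (intro mult_nonneg_nonneg prod_nonneg) auto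

text \<open>A double series \<open>f L j\<close> of nonnegative terms is summed in both orders. Over
  j it gives the coefficients on the left; over L it gives negative binomial series with exponent v
  + j, whose sum over j is an exponential series in \<beta> u / (1 - w).\<close>

lemma delta_cir_exponential_generating_function:
  fixes v \<beta> \<gamma> u :: real
  assumes v: "v > 0" and \<beta>: "\<beta> \<ge> 0" and \<gamma>: "\<gamma> \<ge> 0" and u: "u \<ge> 0" "\<gamma> * u < 1"
  shows "(\<lambda>L. (\<Sum>j\<le>L. delta_cir j L v * \<gamma> ^ (L - j) * \<beta> ^ j) / fact L * u ^ L)
     sums ((1 - \<gamma> * u) powr (- v) * exp (\<beta> * u / (1 - \<gamma> * u)))"
proof -
  define w where "w = \<gamma> * u"
  have w: "0 \<le> w" "w < 1" using \<gamma> u by (auto simp: w_def)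
  define f where "f L j = (if j \<le> L then (\<beta> * u) ^ j / fact j *
      (pochhammer (v + real j) (L - j) / fact (L - j) * w ^ (L - j)) else 0)" for L j
  define g where "g L = (\<Sum>j\<le>L. delta_cir j L v * \<gamma> ^ (L - j) * \<beta> ^ j) / fact L * u ^ L" for L
  define G where "G = (1 - w) powr (- v) * exp (\<beta> * u / (1 - w))"
  have f0: "f L j \<ge> 0" for L j
    using v \<beta> u w by (auto simp: f_def intro!: mult_nonneg_nonneg divide_nonneg_nonneg pochhammer_nonneg)
  have g0: "g L \<ge> 0" for L
    using v \<beta> \<gamma> u unfolding g_def
    by (intro mult_nonneg_nonneg divide_nonneg_nonneg sum_nonneg delta_cir_nonneg) auto
  have inner: "(\<lambda>L. f L j) sums ((\<beta> * u) ^ j / fact j * (1 - w) powr (- (v + real j)))" for j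
  proof -
    have "(\<lambda>m. f (m + j) j) sums ((\<beta> * u) ^ j / fact j * (1 - w) powr (- (v + real j)))"
      unfolding f_def
      using w sums_mult [OF negative_binomial_sums [of w "v + real j"], of "(\<beta> * u) ^ j / fact j"] by simp
    then show ?thesis
      by (subst sums_zero_iff_shift [symmetric, of j]) (auto simp: f_def)
  qed
  have "(\<lambda>j. (1 - w) powr (- v) * (\<beta> * u / (1 - w)) ^ j /\<^sub>R fact j) sums
      ((1 - w) powr (- v) * exp (\<beta> * u / (1 - w)))"
    using sums_mult [OF exp_converges [of "\<beta> * u / (1 - w)"], of "(1 - w) powr (- v)"]
    by (simp add: mult_ac)
  moreover have "(1 - w) powr (- v) * (\<beta> * u / (1 - w)) ^ j /\<^sub>R fact j
      = (\<beta> * u) ^ j / fact j * (1 - w) powr (- (v + real j))" for j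
  proof -
    have "(1 - w) powr (- (v + real j)) = (1 - w) powr (- v) / (1 - w) ^ j"
      using w by (simp add: powr_diff powr_realpow)
    then show ?thesis by (simp add: power_divide) (simp add: divide_inverse mult_ac)
  qed
  ultimately have outer: "(\<lambda>j. (\<beta> * u) ^ j / fact j * (1 - w) powr (- (v + real j))) sums G"
    by (simp add: G_def)
  have "ennreal G = (\<Sum>j. ennreal ((\<beta> * u) ^ j / fact j * (1 - w) powr (- (v + real j))))"
    using \<beta> u by (intro suminf_ennreal_eq [symmetric, OF _ outer]) auto
  also have "\<dots> = (\<Sum>j. \<Sum>L. ennreal (f L j))"
    by (intro suminf_cong suminf_ennreal_eq [symmetric, OF _ inner] f0)
  also have "\<dots> = (\<Sum>L. \<Sum>j. ennreal (f L j))"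
    by (rule suminf_ennreal_swap)
  also have "\<dots> = (\<Sum>L. ennreal (g L))"
  proof (rule suminf_cong)
    fix L
    have "(\<Sum>j. ennreal (f L j)) = (\<Sum>j\<le>L. ennreal (f L j))"
      by (intro suminf_finite) (auto simp: f_def)
    also have "\<dots> = ennreal (\<Sum>j\<le>L. f L j)"
      using f0 by (intro sum_ennreal) auto
    also have "(\<Sum>j\<le>L. f L j) = g L"
      unfolding g_def sum_divide_distrib sum_distrib_right
    proof (rule sum.cong)
      fix j assume "j \<in> {..L}"
      then have j: "j \<le> L" by simp
      have "u ^ L = u ^ j * u ^ (L - j)" using j by (simp add: power_add [symmetric])
      then show "f L j = delta_cir j L v * \<gamma> ^ (L - j) * \<beta> ^ j / fact L * u ^ L"
        using j by (simp add: f_def delta_cir_pochhammer w_def power_mult_distrib)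
    qed simp
    finally show "(\<Sum>j. ennreal (f L j)) = ennreal (g L)" .
  qed
  finally have "ennreal G = (\<Sum>L. ennreal (g L))" .
  from sums_of_suminf_ennreal [OF g0 this [symmetric]] have "g sums G"
    by (simp add: G_def)
  then show ?thesis by (simp add: g_def [abs_def] G_def w_def)
qed

context cir_solution
begin

text \<open>exp(u X_t) is expanded under the expectation. Its generating function is the one of
  \<open>delta_cir\<close> with \<gamma> = \<sigma>^2 \<open>psi k t\<close> / 2 and \<beta> =
  exp(-k t) x, so coefficients may be compared on [0, \<epsilon>].\<close>

lemma has_bochner_integral_power:
  assumes \<sigma>: "\<sigma> > 0" and a: "a > 0" and x: "x \<ge> 0" and t: "t > 0"
  shows "has_bochner_integral M (\<lambda>\<omega>. X t \<omega> ^ L)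
    (\<Sum>j\<le>L. delta_cir j L (2 * a / \<sigma>\<^sup>2) * (\<sigma>\<^sup>2 * psi k t / 2) ^ (L - j) * (exp (- k * t) * x) ^ j)"
proof -
  define v where "v = 2 * a / \<sigma>\<^sup>2"
  define \<gamma> where "\<gamma> = \<sigma>\<^sup>2 * psi k t / 2"
  define \<beta> where "\<beta> = exp (- k * t) * x"
  define m where "m L = (\<integral>\<^sup>+ \<omega>. ennreal (X t \<omega> ^ L) \<partial>M)" for L
  define p where "p L = (\<Sum>j\<le>L. delta_cir j L v * \<gamma> ^ (L - j) * \<beta> ^ j)" for L
  define G where "G u = (1 - \<gamma> * u) powr (- v) * exp (\<beta> * u / (1 - \<gamma> * u))" for u
  have v: "v > 0" using a \<sigma> by (simp add: v_def)
  have \<gamma>: "\<gamma> > 0" using psi_pos [OF t, of k] \<sigma> by (simp add: \<gamma>_def)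
  have \<beta>: "\<beta> \<ge> 0" using x by (simp add: \<beta>_def)
  have [measurable]: "X t \<in> borel_measurable M" using t by (intro X_measurable) simp
  have nn: "AE \<omega> in M. 0 \<le> X t \<omega>"
    using X_nonneg by eventually_elim (use t in auto)
  have p0: "p L \<ge> 0" for L
    unfolding p_def using v \<gamma> \<beta> by (intro sum_nonneg mult_nonneg_nonneg delta_cir_nonneg) auto
  obtain \<epsilon> where \<epsilon>: "\<epsilon> > 0" and mgf: "\<And>u. u \<in> {0..\<epsilon>} \<Longrightarrow> u * \<sigma>\<^sup>2 * psi k t \<le> 1"
      "\<And>u. u \<in> {0..\<epsilon>} \<Longrightarrow> (\<integral>\<^sup>+ \<omega>. ennreal (exp (u * X t \<omega>)) \<partial>M)
        = ennreal (laplace_denom u t powr (- (2 * a / \<sigma>\<^sup>2)) * exp (riccati u t 0 * x))"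
    using nn_integral_exp_eq_mgf [OF \<sigma> a x t] by blast
  have den: "laplace_denom u t = 1 - \<gamma> * u" for u
    by (simp add: laplace_denom_def \<gamma>_def)
  have ser: "(\<Sum>L. ennreal (u ^ L / fact L) * m L) = ennreal (G u)" if u: "u \<in> {0..\<epsilon>}" for u
  proof -
    have "(\<Sum>L. ennreal (u ^ L / fact L) * m L) = (\<Sum>L. \<integral>\<^sup>+ \<omega>. ennreal (u ^ L / fact L) * ennreal (X t \<omega> ^ L) \<partial>M)"
      unfolding m_def by (intro suminf_cong nn_integral_cmult [symmetric]) measurable
    also have "\<dots> = (\<integral>\<^sup>+ \<omega>. (\<Sum>L. ennreal (u ^ L / fact L) * ennreal (X t \<omega> ^ L)) \<partial>M)"
      by (intro nn_integral_suminf [symmetric]) measurable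
    also have "\<dots> = (\<integral>\<^sup>+ \<omega>. ennreal (exp (u * X t \<omega>)) \<partial>M)"
    proof (rule nn_integral_cong_AE, use nn in eventually_elim)
      case (elim \<omega>)
      have "(\<Sum>L. ennreal ((u * X t \<omega>) ^ L /\<^sub>R fact L)) = ennreal (exp (u * X t \<omega>))"
        using u elim by (intro suminf_ennreal_eq exp_converges) auto
      moreover have "ennreal (u ^ L / fact L) * ennreal (X t \<omega> ^ L) = ennreal ((u * X t \<omega>) ^ L /\<^sub>R fact L)" for L
        using u elim by (simp add: ennreal_mult [symmetric] power_mult_distrib divide_inverse mult_ac)
      ultimately show ?case by simp
    qed
    also have "\<dots> = ennreal (G u)"
      by (subst mgf(2) [OF u]) (simp add: den G_def v_def riccati_def \<beta>_def mult_ac)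
    finally show ?thesis .
  qed
  \<comment> \<open>A single term of the convergent series at u = \<epsilon> is finite, and its
    factor is positive.\<close>
  have fin: "m L < \<top>" for L
  proof -
    have "ennreal (\<epsilon> ^ L / fact L) * m L \<le> (\<Sum>L. ennreal (\<epsilon> ^ L / fact L) * m L)"
      using sum_le_suminf [of "\<lambda>L. ennreal (\<epsilon> ^ L / fact L) * m L" "{L}"] by (simp add: summableI)
    also have "\<dots> < \<top>" using ser [of \<epsilon>] \<epsilon> by simp
    finally show ?thesis
      using \<epsilon> by (auto simp: ennreal_mult_less_top)
  qed
  have m: "m L = ennreal (enn2real (m L))" for L
    using fin [of L] by simp
  have "enn2real (m L) / fact L = p L / fact L" for L
  proof (rule powser_eq_imp_coeff_eq [OF \<epsilon>, where G = G])
    fix u assume u: "u \<in> {0..\<epsilon>}"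
    have "u * (2 * \<gamma>) \<le> 1" using mgf(1) [OF u] by (simp add: \<gamma>_def mult_ac)
    then have "\<gamma> * u < 1" by (simp add: mult_ac)
    then show "(\<lambda>n. p n / fact n * u ^ n) sums G u"
      unfolding p_def G_def using v \<beta> \<gamma> u
      by (intro delta_cir_exponential_generating_function) auto
    have "ennreal (u ^ L / fact L) * m L = ennreal (enn2real (m L) / fact L * u ^ L)" for L
      by (subst m) (use u in \<open>simp add: ennreal_mult' [symmetric] mult_ac\<close>)
    then show "(\<lambda>n. enn2real (m n) / fact n * u ^ n) sums G u"
      using ser [OF u] u by (intro sums_of_suminf_ennreal) (auto simp: G_def)
  qed
  then have "m L = ennreal (p L)"
    using m [of L] by simp
  moreover have "AE \<omega> in M. 0 \<le> X t \<omega> ^ L"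
    using nn by eventually_elim simp
  ultimately have "has_bochner_integral M (\<lambda>\<omega>. X t \<omega> ^ L) (p L)"
    unfolding m_def using p0 by (intro has_bochner_integral_nn_integral) simp_all
  then show ?thesis
    by (simp only: p_def v_def \<gamma>_def \<beta>_def)
qed

end

section \<open>Poisson mixtures and the error estimate\<close>

lemma falling_fact_mult_fact: "j \<le> i \<Longrightarrow> falling_fact i j * fact (i - j) = fact i"
proof (induction j)
  case (Suc j)
  then have "fact (i - j) = (real i - real j) * fact (i - Suc j)"
    by (simp add: Suc_diff_Suc [symmetric] of_nat_diff)
  with Suc show ?case by (simp add: falling_fact_def)
qed (simp add: falling_fact_def)

lemma falling_fact_eq_0: "i < j \<Longrightarrow> falling_fact i j = 0"
  by (auto simp: falling_fact_def)

text \<open>The terms with i < j vanish; in the others the falling factorial cancels against the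
  factorial and leaves the exponential series shifted by j.\<close>

lemma poisson_falling_fact_sums:
  "(\<lambda>i. exp (- r) * r ^ i / fact i * falling_fact i j) sums (r ^ j)"
proof -
  have "exp (- r) * r ^ (m + j) / fact (m + j) * falling_fact (m + j) j = exp (- r) * r ^ j * (r ^ m /\<^sub>R fact m)" for m
    using falling_fact_mult_fact [of j "m + j"] by (simp add: power_add field_simps)
  moreover have "(\<lambda>m. exp (- r) * r ^ j * (r ^ m /\<^sub>R fact m)) sums (exp (- r) * r ^ j * exp r)"
    by (intro sums_mult exp_converges)
  moreover have "exp (- r) * r ^ j * exp r = r ^ j"
    by (simp add: exp_minus field_simps)
  ultimately have "(\<lambda>m. exp (- r) * r ^ (m + j) / fact (m + j) * falling_fact (m + j) j) sums (r ^ j)"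
    by simp
  then show ?thesis
    by (subst sums_zero_iff_shift [symmetric, of j]) (auto simp: falling_fact_eq_0)
qed

lemma (in prob_space) nn_integral_poisson:
  assumes P: "poisson_distributed M P r"
  shows "(\<integral>\<^sup>+ \<omega>. g (P \<omega>) \<partial>M) = (\<Sum>i. g i * ennreal (exp (- r) * r ^ i / fact i))"
proof -
  have [measurable]: "P \<in> measurable M (count_space UNIV)"
    using P by (simp add: poisson_distributed_def)
  have "(\<integral>\<^sup>+ \<omega>. g (P \<omega>) \<partial>M) = (\<integral>\<^sup>+ \<omega>. (\<Sum>i. g i * indicator {\<omega>\<in>space M. P \<omega> = i} \<omega>) \<partial>M)"
  proof (rule nn_integral_cong)
    fix \<omega> assume "\<omega> \<in> space M"
    then show "g (P \<omega>) = (\<Sum>i. g i * indicator {\<omega>\<in>space M. P \<omega> = i} \<omega>)"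
      by (subst suminf_finite [of "{P \<omega>}"]) auto
  qed
  also have "\<dots> = (\<Sum>i. \<integral>\<^sup>+ \<omega>. g i * indicator {\<omega>\<in>space M. P \<omega> = i} \<omega> \<partial>M)"
    by (intro nn_integral_suminf) measurable
  also have "\<dots> = (\<Sum>i. g i * ennreal (exp (- r) * r ^ i / fact i))"
    using P by (intro suminf_cong) (simp add: nn_integral_cmult_indicator emeasure_eq_measure poisson_distributed_def)
  finally show ?thesis .
qed

text \<open>The index is independent of the family as a whole, so the family is treated as one
  random element \<open>D\<close> of the product space. Fubini then freezes the index while the
  chosen variable is integrated.\<close>

lemma (in prob_space) nn_integral_independent_index:
  assumes P: "P \<in> measurable M (count_space UNIV)" and Z: "\<And>i. Z i \<in> borel_measurable M"
    and ind: "indep_of_family M P Z"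
    and g: "g \<in> borel_measurable borel"
  shows "(\<integral>\<^sup>+ \<omega>. g (Z (P \<omega>) \<omega>) \<partial>M) = (\<integral>\<^sup>+ \<omega>. (\<integral>\<^sup>+ \<omega>'. g (Z (P \<omega>) \<omega>') \<partial>M) \<partial>M)"
proof -
  note [measurable] = P Z g
  define G where "G = vimage_algebra (space M) P (count_space UNIV)"
  define S where "S = (\<Pi>\<^sub>M i\<in>(UNIV :: nat set). borel :: real measure)"
  define D where "D = (\<lambda>\<omega> i. Z i \<omega>)"
  have D [measurable]: "D \<in> measurable M S"
    unfolding D_def S_def by (rule measurable_PiM_single') auto
  have "sets G \<subseteq> sets M"
    unfolding G_def by (rule sets_image_in_sets [OF refl P])
  then have sub: "subalgebra M G"
    by (simp add: subalgebra_def G_def)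
  have PG: "P \<in> measurable G (count_space UNIV)"
    unfolding G_def by (rule measurable_vimage_algebra1) simp
  have ind': "indep_set (sets G) (sets (vimage_algebra (space M) D S))"
    using ind by (simp add: indep_of_family_def G_def S_def D_def)
  have prod: "distr M (count_space UNIV) P \<Otimes>\<^sub>M distr M S D = distr M (count_space UNIV \<Otimes>\<^sub>M S) (\<lambda>\<omega>. (P \<omega>, D \<omega>))"
    by (rule distr_pair_of_indep_set [OF sub ind' D PG])
  define f where "f = (\<lambda>(i, z :: nat \<Rightarrow> real). g (z i))"
  have [measurable]: "(\<lambda>z. z i) \<in> measurable S borel" for i
    unfolding S_def by (rule measurable_component_singleton) simp
  have f [measurable]: "f \<in> borel_measurable (count_space UNIV \<Otimes>\<^sub>M S)"
    unfolding f_def by (rule measurable_pair_measure_countable1) auto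
  interpret Q: prob_space "distr M S D" by (rule prob_space_distr) simp
  have "(\<integral>\<^sup>+ \<omega>. g (Z (P \<omega>) \<omega>) \<partial>M) = (\<integral>\<^sup>+ \<omega>. f (P \<omega>, D \<omega>) \<partial>M)"
    by (simp add: f_def D_def)
  also have "\<dots> = (\<integral>\<^sup>+ p. f p \<partial>distr M (count_space UNIV \<Otimes>\<^sub>M S) (\<lambda>\<omega>. (P \<omega>, D \<omega>)))"
    by (subst nn_integral_distr) auto
  also have "\<dots> = (\<integral>\<^sup>+ i. (\<integral>\<^sup>+ z. f (i, z) \<partial>distr M S D) \<partial>distr M (count_space UNIV) P)"
    unfolding prod [symmetric] by (intro Q.nn_integral_fst [symmetric]) simp
  also have "\<dots> = (\<integral>\<^sup>+ \<omega>. (\<integral>\<^sup>+ z. f (P \<omega>, z) \<partial>distr M S D) \<partial>M)"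
    by (subst nn_integral_distr) auto
  also have "\<dots> = (\<integral>\<^sup>+ \<omega>. (\<integral>\<^sup>+ \<omega>'. g (Z (P \<omega>) \<omega>') \<partial>M) \<partial>M)"
  proof (rule nn_integral_cong)
    fix \<omega>
    have "(\<integral>\<^sup>+ z. f (P \<omega>, z) \<partial>distr M S D) = (\<integral>\<^sup>+ \<omega>'. f (P \<omega>, D \<omega>') \<partial>M)"
      by (rule nn_integral_distr) measurable
    then show "(\<integral>\<^sup>+ z. f (P \<omega>, z) \<partial>distr M S D) = (\<integral>\<^sup>+ \<omega>'. g (Z (P \<omega>) \<omega>') \<partial>M)"
      by (simp add: f_def D_def)
  qed
  finally show ?thesis .
qed

text \<open>For a frozen index i the moment is a combination of falling factorials of i, and
  averaging over the Poisson law turns the j-th one into r^j.\<close>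

lemma (in prob_space) has_bochner_integral_poisson_mixture:
  assumes r: "r \<ge> 0" and P: "poisson_distributed M P r" and ind: "indep_of_family M P Z"
    and Z: "\<And>i. Z i \<in> borel_measurable M" and pos: "\<And>i. AE \<omega> in M. 0 < Z i \<omega>"
    and moment: "\<And>i. has_bochner_integral M (\<lambda>\<omega>. Z i \<omega> ^ L) (\<Sum>j\<le>L. \<delta> j * falling_fact i j)"
  shows "has_bochner_integral M (\<lambda>\<omega>. Z (P \<omega>) \<omega> ^ L) (\<Sum>j\<le>L. \<delta> j * r ^ j)"
proof -
  note [measurable] = Z
  have [measurable]: "P \<in> measurable M (count_space UNIV)"
    using P by (simp add: poisson_distributed_def)
  define \<mu> where "\<mu> i = (\<Sum>j\<le>L. \<delta> j * falling_fact i j)" for i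
  have nn: "AE \<omega> in M. 0 \<le> Z i \<omega> ^ L" for i
    using pos [of i] by eventually_elim simp
  \<comment> \<open>The \<delta> j may be negative, but the combination is a moment of a positive
    variable; this permits summation in \<open>ennreal\<close>.\<close>
  have \<mu>0: "\<mu> i \<ge> 0" for i
    using integral_nonneg_AE [OF nn, of i] has_bochner_integral_integral_eq [OF moment, of i]
    by (simp add: \<mu>_def)
  have Zi: "(\<integral>\<^sup>+ \<omega>. ennreal (Z i \<omega> ^ L) \<partial>M) = ennreal (\<mu> i)" for i
    using moment [of i] nn_integral_eq_integral [OF _ nn, of i]
    by (simp add: has_bochner_integral_iff \<mu>_def)
  have sums: "(\<lambda>i. \<mu> i * (exp (- r) * r ^ i / fact i)) sums (\<Sum>j\<le>L. \<delta> j * r ^ j)"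
  proof -
    have "(\<Sum>j\<le>L. \<delta> j * (c * falling_fact i j)) = \<mu> i * c" for i c
      by (simp add: \<mu>_def sum_distrib_left mult_ac)
    moreover have "(\<lambda>i. \<Sum>j\<le>L. \<delta> j * (exp (- r) * r ^ i / fact i * falling_fact i j)) sums (\<Sum>j\<le>L. \<delta> j * r ^ j)"
      by (intro sums_sum sums_mult poisson_falling_fact_sums)
    ultimately show ?thesis by (simp only:)
  qed
  have term0: "0 \<le> \<mu> i * (exp (- r) * r ^ i / fact i)" for i
    using \<mu>0 [of i] r by simp
  have g: "(\<lambda>z::real. ennreal (z ^ L)) \<in> borel_measurable borel" by measurable
  have "(\<integral>\<^sup>+ \<omega>. ennreal (Z (P \<omega>) \<omega> ^ L) \<partial>M) = (\<integral>\<^sup>+ \<omega>. ennreal (\<mu> (P \<omega>)) \<partial>M)"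
    by (subst nn_integral_independent_index [OF _ Z ind g]) (simp_all add: Zi)
  also have "\<dots> = (\<Sum>i. ennreal (\<mu> i) * ennreal (exp (- r) * r ^ i / fact i))"
    by (rule nn_integral_poisson [OF P])
  also have "\<dots> = (\<Sum>i. ennreal (\<mu> i * (exp (- r) * r ^ i / fact i)))"
    by (intro suminf_cong ennreal_mult' [symmetric] \<mu>0)
  also have "\<dots> = ennreal (\<Sum>j\<le>L. \<delta> j * r ^ j)"
    by (rule suminf_ennreal_eq [OF term0 sums])
  finally have int: "(\<integral>\<^sup>+ \<omega>. ennreal (Z (P \<omega>) \<omega> ^ L) \<partial>M) = ennreal (\<Sum>j\<le>L. \<delta> j * r ^ j)" .
  have "AE \<omega> in M. \<forall>i. 0 < Z i \<omega>"
    using pos by (simp add: AE_all_countable)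
  then have "AE \<omega> in M. 0 \<le> Z (P \<omega>) \<omega> ^ L"
    by eventually_elim (simp add: less_imp_le)
  moreover have "0 \<le> (\<Sum>j\<le>L. \<delta> j * r ^ j)"
    using sums_le [OF term0 sums_zero sums] .
  moreover have "(\<lambda>\<omega>. Z (P \<omega>) \<omega> ^ L) \<in> borel_measurable M"
    by (rule borel_measurable_power [OF measurable_compose_countable [OF Z]]) simp
  ultimately show ?thesis
    using int by (intro has_bochner_integral_nn_integral)
qed

section \<open>Polynomials in the starting point and their norm\<close>

lemma poly_norm_eq_sum: "degree p \<le> n \<Longrightarrow> poly_norm p = (\<Sum>i\<le>n. \<bar>coeff p i\<bar>)"
  unfolding poly_norm_def by (rule sum.mono_neutral_left) (auto simp: coeff_eq_0)

lemma poly_norm_sum_le: "poly_norm (\<Sum>i\<in>A. p i) \<le> (\<Sum>i\<in>A. poly_norm (p i))"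
proof (cases "finite A")
  case True
  define n where "n = Max (insert 0 (degree ` p ` A))"
  have n: "degree (p i) \<le> n" if "i \<in> A" for i
    unfolding n_def using True that by (intro Max_ge) auto
  have "poly_norm (\<Sum>i\<in>A. p i) = (\<Sum>j\<le>n. \<bar>\<Sum>i\<in>A. coeff (p i) j\<bar>)"
    using True n by (subst poly_norm_eq_sum [of _ n]) (auto intro!: degree_sum_le simp: coeff_sum)
  also have "\<dots> \<le> (\<Sum>j\<le>n. \<Sum>i\<in>A. \<bar>coeff (p i) j\<bar>)"
    by (intro sum_mono sum_abs)
  also have "\<dots> = (\<Sum>i\<in>A. \<Sum>j\<le>n. \<bar>coeff (p i) j\<bar>)"
    by (rule sum.swap)
  also have "\<dots> = (\<Sum>i\<in>A. poly_norm (p i))"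
    by (intro sum.cong refl poly_norm_eq_sum [OF n, symmetric])
  finally show ?thesis .
qed (simp add: poly_norm_def)

lemma poly_norm_smult: "poly_norm (smult c p) = \<bar>c\<bar> * poly_norm p"
  by (simp add: poly_norm_eq_sum [of "smult c p" "degree p"] poly_norm_def sum_distrib_left abs_mult degree_smult_le)

lemma poly_norm_monom: "poly_norm (monom c j) = \<bar>c\<bar>"
  by (subst poly_norm_eq_sum [OF degree_monom_le]) (simp add: if_distrib [of abs] cong: if_cong)

lemma mean_poly_of_moments:
  assumes "\<And>x l. x \<ge> 0 \<Longrightarrow> has_bochner_integral M (\<lambda>\<omega>. Y x \<omega> ^ l) (poly (q l) x)"
  shows "mean_poly M Y f (\<Sum>l\<le>degree f. smult (coeff f l) (q l))"
  unfolding mean_poly_def poly_sum poly_smult poly_altdef [of f]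
  by (intro allI impI has_bochner_integral_sum has_bochner_integral_mult_right assms)

text \<open>The l-th moment of both laws, for \<gamma> = 2/c_t and e = exp(-k t): \<gamma>^l times a
  polynomial in the Poisson parameter e x / \<gamma>, with the powers of \<gamma> already
  cancelled.\<close>

definition moment_poly :: "(nat \<Rightarrow> nat \<Rightarrow> real) \<Rightarrow> real \<Rightarrow> real \<Rightarrow> nat \<Rightarrow> real poly" where
  "moment_poly \<delta> \<gamma> e l = (\<Sum>j\<le>l. monom (\<delta> j l * \<gamma> ^ (l - j) * e ^ j) j)"

lemma poly_moment_poly: "poly (moment_poly \<delta> \<gamma> e l) x = (\<Sum>j\<le>l. \<delta> j l * \<gamma> ^ (l - j) * (e * x) ^ j)"
  by (simp add: moment_poly_def poly_sum poly_monom power_mult_distrib mult_ac)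

lemma degree_moment_poly: "degree (moment_poly \<delta> \<gamma> e l) \<le> l"
  unfolding moment_poly_def
  by (intro degree_sum_le) (auto intro: order_trans [OF degree_monom_le])

text \<open>The mean value theorem gives linear growth in t, uniformly on (0, T]; this is what makes
  \<gamma> = O(t).\<close>

lemma psi_le:
  assumes "0 < t" "t \<le> T"
  shows "psi k t \<le> exp (\<bar>k\<bar> * T) * t"
proof -
  obtain z where z: "0 < z" "z < t" "psi k t - psi k 0 = (t - 0) * exp (- k * z)"
    using MVT2 [OF assms(1), of "psi k" "\<lambda>q. exp (- k * q)"] psi_has_derivative by blast
  have "exp (- k * z) \<le> exp (\<bar>k\<bar> * T)"
    using z assms by (intro exp_mult_le_exp_abs) auto
  then have "t * exp (- k * z) \<le> t * exp (\<bar>k\<bar> * T)"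
    using assms by (intro mult_left_mono) auto
  with z show ?thesis by (simp add: mult.commute)
qed

text \<open>Where the coefficients differ, l - j >= \<nu> + 1, so \<gamma>^(l - j) supplies t^(\<nu>
  + 1); surplus powers of t go into \<open>max 1 T ^ L\<close>. All bases are at least 1, so that
  every power can be raised to L. Truncated subtraction in \<open>l - \<nu>\<close> is the maximum
  with 0.\<close>

lemma poly_norm_moment_poly_diff_le:
  fixes \<gamma> e \<kappa> E t T :: real
  assumes eq: "\<And>j. j \<in> {l - \<nu>..l} \<Longrightarrow> \<delta> j l = \<delta>' j l"
    and l: "l \<le> L" and t: "0 < t" "t \<le> T" and \<gamma>: "0 \<le> \<gamma>" "\<gamma> \<le> \<kappa> * t" and \<kappa>: "1 \<le> \<kappa>"
    and e: "0 \<le> e" "e \<le> E" "1 \<le> E"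
  shows "poly_norm (moment_poly \<delta> \<gamma> e l - moment_poly \<delta>' \<gamma> e l)
    \<le> (\<Sum>j\<le>l. \<bar>\<delta> j l - \<delta>' j l\<bar>) * (\<kappa> ^ L * max 1 T ^ L * E ^ L * t ^ (\<nu> + 1))"
proof -
  have "moment_poly \<delta> \<gamma> e l - moment_poly \<delta>' \<gamma> e l
      = (\<Sum>j\<le>l. monom ((\<delta> j l - \<delta>' j l) * \<gamma> ^ (l - j) * e ^ j) j)"
    by (simp add: moment_poly_def sum_subtractf [symmetric] diff_monom left_diff_distrib)
  then have "poly_norm (moment_poly \<delta> \<gamma> e l - moment_poly \<delta>' \<gamma> e l)
      \<le> (\<Sum>j\<le>l. \<bar>(\<delta> j l - \<delta>' j l) * \<gamma> ^ (l - j) * e ^ j\<bar>)"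
    using poly_norm_sum_le [of "\<lambda>j. monom ((\<delta> j l - \<delta>' j l) * \<gamma> ^ (l - j) * e ^ j) j" "{..l}"]
    by (simp add: poly_norm_monom)
  also have "\<dots> \<le> (\<Sum>j\<le>l. \<bar>\<delta> j l - \<delta>' j l\<bar> * (\<kappa> ^ L * max 1 T ^ L * E ^ L * t ^ (\<nu> + 1)))"
  proof (rule sum_mono)
    fix j assume "j \<in> {..l}"
    show "\<bar>(\<delta> j l - \<delta>' j l) * \<gamma> ^ (l - j) * e ^ j\<bar>
        \<le> \<bar>\<delta> j l - \<delta>' j l\<bar> * (\<kappa> ^ L * max 1 T ^ L * E ^ L * t ^ (\<nu> + 1))"
    proof (cases "j \<in> {l - \<nu>..l}")
      case True
      then show ?thesis by (simp add: eq)
    next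
      case False
      with \<open>j \<in> {..l}\<close> have j: "\<nu> + 1 \<le> l - j" "j \<le> L" "l - j \<le> L" using l by auto
      have "\<gamma> ^ (l - j) \<le> (\<kappa> * t) ^ (l - j)"
        using \<gamma> by (intro power_mono)
      also have "\<dots> = \<kappa> ^ (l - j) * (t ^ (l - j - (\<nu> + 1)) * t ^ (\<nu> + 1))"
        using j(1) by (simp only: power_mult_distrib power_add [symmetric] le_add_diff_inverse2)
      also have "\<dots> \<le> \<kappa> ^ L * (max 1 T ^ L * t ^ (\<nu> + 1))"
      proof (intro mult_mono mult_right_mono)
        show "\<kappa> ^ (l - j) \<le> \<kappa> ^ L" using \<kappa> j by (intro power_increasing) auto
        have "t ^ (l - j - (\<nu> + 1)) \<le> max 1 T ^ (l - j - (\<nu> + 1))"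
          using t by (intro power_mono) auto
        also have "\<dots> \<le> max 1 T ^ L" using j by (intro power_increasing) auto
        finally show "t ^ (l - j - (\<nu> + 1)) \<le> max 1 T ^ L" .
      qed (use t \<kappa> in auto)
      finally have 1: "\<gamma> ^ (l - j) \<le> \<kappa> ^ L * (max 1 T ^ L * t ^ (\<nu> + 1))" .
      have "e ^ j \<le> E ^ j" using e by (intro power_mono)
      also have "\<dots> \<le> E ^ L" using e j by (intro power_increasing) auto
      finally have "\<gamma> ^ (l - j) * e ^ j \<le> \<kappa> ^ L * (max 1 T ^ L * t ^ (\<nu> + 1)) * E ^ L"
        using 1 e \<gamma> t \<kappa> by (intro mult_mono) auto
      then have "\<bar>\<delta> j l - \<delta>' j l\<bar> * (\<gamma> ^ (l - j) * e ^ j)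
          \<le> \<bar>\<delta> j l - \<delta>' j l\<bar> * (\<kappa> ^ L * (max 1 T ^ L * t ^ (\<nu> + 1)) * E ^ L)"
        by (intro mult_left_mono) auto
      then show ?thesis
        using \<gamma> e by (simp add: abs_mult mult_ac)
    qed
  qed
  finally show ?thesis by (simp only: sum_distrib_right)
qed

theorem propositionB3p4:
  fixes a k \<sigma> v T :: real and \<nu> :: nat
    and M :: "'a measure" and F :: "real \<Rightarrow> 'a measure" and W :: "real \<Rightarrow> 'a \<Rightarrow> real"
    and X :: "real \<Rightarrow> real \<Rightarrow> 'a \<Rightarrow> real"
    and N :: "'b measure" and Zt :: "nat \<Rightarrow> 'b \<Rightarrow> real" and P :: "real \<Rightarrow> real \<Rightarrow> 'b \<Rightarrow> nat"
    and \<delta>Z :: "nat \<Rightarrow> nat \<Rightarrow> real"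
    and K :: "'c measure" and Xhat :: "real \<Rightarrow> real \<Rightarrow> 'c \<Rightarrow> real"
  assumes "a > 0" and "\<sigma> > 0" and "v = 2 * a / \<sigma>\<^sup>2" and "T > 0" and "\<nu> \<ge> 1"
    and "prob_space M" and "filtration_on M F" and "brownian_motion M F W"
    and "\<And>x. x \<ge> 0 \<Longrightarrow> cir_process M F W a k \<sigma> x (X x)"
    and "prob_space N"
    and "\<And>i. Zt i \<in> borel_measurable N"
    and "\<And>i. AE \<omega> in N. 0 < Zt i \<omega>"
    and "\<And>i L. L \<ge> 1 \<Longrightarrow>
          has_bochner_integral N (\<lambda>\<omega>. Zt i \<omega> ^ L) (\<Sum>j\<le>L. \<delta>Z j L * falling_fact i j)"
    and "\<And>j L. L \<ge> 1 \<Longrightarrow> j \<in> {L - \<nu>..L} \<Longrightarrow> \<delta>Z j L = delta_cir j L v"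
    and "\<And>t x. 0 < t \<Longrightarrow> t \<le> T \<Longrightarrow> 0 \<le> x \<Longrightarrow>
          poisson_distributed N (P t x) (dd k \<sigma> t * x / 2) \<and> indep_of_family N (P t x) Zt"
    and "prob_space K"
    and "\<And>t x. 0 < t \<Longrightarrow> t \<le> T \<Longrightarrow> 0 \<le> x \<Longrightarrow>
          Xhat t x \<in> borel_measurable K \<and>
          distr K borel (Xhat t x) = distr N borel (\<lambda>\<omega>. 2 / cc k \<sigma> t * Zt (P t x \<omega>) \<omega>)"
  shows "\<forall>L\<ge>1. \<exists>C. \<forall>f :: real poly. \<forall>t. degree f \<le> L \<longrightarrow> 0 < t \<longrightarrow> t \<le> T \<longrightarrow>
           (\<exists>g h. degree g \<le> L \<and> degree h \<le> L \<and>
              mean_poly K (\<lambda>x. Xhat t x) f g \<and> mean_poly M (\<lambda>x. X x t) f h \<and>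
              poly_norm (g - h) \<le> C * t ^ (\<nu> + 1) * poly_norm f)"
proof (intro allI impI)
  fix L :: nat assume L: "L \<ge> 1"
  \<comment> \<open>The moment hypothesis starts at exponent 1. At l = 0 the CIR coefficient, equal
    to 1, is the right one for the constant function on a probability space.\<close>
  define \<delta>' where "\<delta>' j l = (if l = 0 then delta_cir j l v else \<delta>Z j l)" for j l
  define \<delta>c where "\<delta>c j l = delta_cir j l v" for j l
  define E where "E = exp (\<bar>k\<bar> * T)"
  \<comment> \<open>By \<open>psi_le\<close>, \<gamma> <= (\<sigma>^2/2) E t; the maximum with 1
    makes the powers of \<kappa> increasing.\<close>
  define \<kappa> where "\<kappa> = max 1 (\<sigma>\<^sup>2 / 2 * E)"
  define B where "B = \<kappa> ^ L * max 1 T ^ L * E ^ L"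
  \<comment> \<open>One number for all degrees l <= L; it depends on neither t nor f, because the
    coefficients do not.\<close>
  define S where "S = (\<Sum>l\<le>L. \<Sum>j\<le>l. \<bar>\<delta>' j l - \<delta>c j l\<bar>)"
  have E: "E \<ge> 1" using assms(4) by (simp add: E_def)
  have B: "B \<ge> 0" using E by (simp add: B_def \<kappa>_def)
  interpret N: prob_space N by fact
  show "\<exists>C. \<forall>f :: real poly. \<forall>t. degree f \<le> L \<longrightarrow> 0 < t \<longrightarrow> t \<le> T \<longrightarrow>
           (\<exists>g h. degree g \<le> L \<and> degree h \<le> L \<and>
              mean_poly K (\<lambda>x. Xhat t x) f g \<and> mean_poly M (\<lambda>x. X x t) f h \<and>
              poly_norm (g - h) \<le> C * t ^ (\<nu> + 1) * poly_norm f)"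
  proof (intro exI [of _ "S * B"] allI impI)
    fix f :: "real poly" and t :: real
    assume f: "degree f \<le> L" and t: "0 < t" "t \<le> T"
    define \<gamma> where "\<gamma> = \<sigma>\<^sup>2 * psi k t / 2"
    define e where "e = exp (- k * t)"
    have \<gamma>: "\<gamma> > 0" using psi_pos [OF t(1), of k] assms(2) by (simp add: \<gamma>_def)
    have c: "2 / cc k \<sigma> t = \<gamma>" by (simp add: cc_def \<gamma>_def)
    \<comment> \<open>In terms of \<gamma> the Poisson parameter is e x / \<gamma>, so multiplying
      the l-th moment by \<gamma>^l leaves only nonnegative powers of \<gamma>.\<close>
    have d: "dd k \<sigma> t * x / 2 = e * x / \<gamma>" for x
      using \<gamma> by (simp add: dd_def cc_def \<gamma>_def e_def field_simps)
    have X_moment: "has_bochner_integral M (\<lambda>\<omega>. X x t \<omega> ^ l) (poly (moment_poly \<delta>c \<gamma> e l) x)"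
      if x: "x \<ge> 0" for x l
    proof -
      interpret cir_solution M F W a k \<sigma> x "X x"
        using assms(6-9) x by (intro cir_solution.intro cir_solution_axioms.intro) auto
      show ?thesis
        using has_bochner_integral_power [OF assms(2,1) x t(1), of l]
        by (simp add: poly_moment_poly \<delta>c_def \<gamma>_def e_def assms(3))
    qed
    have Xhat_moment: "has_bochner_integral K (\<lambda>\<omega>. Xhat t x \<omega> ^ l) (poly (moment_poly \<delta>' \<gamma> e l) x)"
      if x: "x \<ge> 0" for x l
    proof -
      have P: "poisson_distributed N (P t x) (e * x / \<gamma>)" "indep_of_family N (P t x) Zt"
        using assms(15) [OF t x] by (auto simp: d)
      have XK: "Xhat t x \<in> borel_measurable K"
        and dist: "distr K borel (Xhat t x) = distr N borel (\<lambda>\<omega>. \<gamma> * Zt (P t x \<omega>) \<omega>)"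
        using assms(17) [OF t x] by (auto simp: c)
      have Zm: "(\<lambda>\<omega>. \<gamma> * Zt (P t x \<omega>) \<omega>) \<in> borel_measurable N"
      proof -
        have "P t x \<in> measurable N (count_space UNIV)"
          using P(1) by (simp add: poisson_distributed_def)
        then have "(\<lambda>\<omega>. Zt (P t x \<omega>) \<omega>) \<in> borel_measurable N"
          by (rule measurable_compose_countable [OF assms(11)])
        then show ?thesis by simp
      qed
      have "has_bochner_integral N (\<lambda>\<omega>. (\<gamma> * Zt (P t x \<omega>) \<omega>) ^ l) (poly (moment_poly \<delta>' \<gamma> e l) x)"
      proof (cases "l = 0")
        case True
        then show ?thesis
          by (simp add: moment_poly_def \<delta>'_def delta_cir_def monom_0 N.prob_space has_bochner_integral_iff)
      next
        case False
        have "has_bochner_integral N (\<lambda>\<omega>. Zt (P t x \<omega>) \<omega> ^ l) (\<Sum>j\<le>l. \<delta>Z j l * (e * x / \<gamma>) ^ j)"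
          using False x \<gamma>
          by (intro N.has_bochner_integral_poisson_mixture P assms(11-13)) (auto simp: e_def)
        then have "has_bochner_integral N (\<lambda>\<omega>. \<gamma> ^ l * Zt (P t x \<omega>) \<omega> ^ l) (\<gamma> ^ l * (\<Sum>j\<le>l. \<delta>Z j l * (e * x / \<gamma>) ^ j))"
          by (rule has_bochner_integral_mult_right)
        moreover have "\<gamma> ^ l * (\<Sum>j\<le>l. \<delta>Z j l * (e * x / \<gamma>) ^ j) = poly (moment_poly \<delta>' \<gamma> e l) x"
          unfolding poly_moment_poly sum_distrib_left
        proof (rule sum.cong)
          fix j assume "j \<in> {..l}"
          then have "\<gamma> ^ l = \<gamma> ^ (l - j) * \<gamma> ^ j" by (simp add: power_add [symmetric])
          then show "\<gamma> ^ l * (\<delta>Z j l * (e * x / \<gamma>) ^ j) = \<delta>' j l * \<gamma> ^ (l - j) * (e * x) ^ j"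
            using \<gamma> False by (simp add: \<delta>'_def power_divide)
        qed simp
        ultimately show ?thesis by (simp add: power_mult_distrib)
      qed
      \<comment> \<open>Only the law of \<open>Xhat t x\<close> is prescribed, on a space of its
        own, so the moment is carried from \<open>N\<close> to the common distribution on the line
        and from there to \<open>K\<close>.\<close>
      then have "has_bochner_integral (distr N borel (\<lambda>\<omega>. \<gamma> * Zt (P t x \<omega>) \<omega>)) (\<lambda>y. y ^ l) (poly (moment_poly \<delta>' \<gamma> e l) x)"
        using Zm by (subst has_bochner_integral_distr) auto
      then show ?thesis
        using XK by (simp add: dist [symmetric] has_bochner_integral_iff integrable_distr_eq integral_distr)
    qed
    define g where "g = (\<Sum>l\<le>degree f. smult (coeff f l) (moment_poly \<delta>' \<gamma> e l))"
    define h where "h = (\<Sum>l\<le>degree f. smult (coeff f l) (moment_poly \<delta>c \<gamma> e l))"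
    have deg: "degree (\<Sum>l\<le>degree f. smult (coeff f l) (moment_poly \<delta> \<gamma> e l)) \<le> L" for \<delta>
      using f by (intro degree_sum_le) (auto intro!: order_trans [OF degree_smult_le] order_trans [OF degree_moment_poly])
    have diff: "poly_norm (moment_poly \<delta>' \<gamma> e l - moment_poly \<delta>c \<gamma> e l) \<le> S * (B * t ^ (\<nu> + 1))" if l: "l \<le> L" for l
    proof -
      have "poly_norm (moment_poly \<delta>' \<gamma> e l - moment_poly \<delta>c \<gamma> e l)
          \<le> (\<Sum>j\<le>l. \<bar>\<delta>' j l - \<delta>c j l\<bar>) * (\<kappa> ^ L * max 1 T ^ L * E ^ L * t ^ (\<nu> + 1))"
      proof (rule poly_norm_moment_poly_diff_le [OF _ l t])
        show "\<delta>' j l = \<delta>c j l" if "j \<in> {l - \<nu>..l}" for j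
          using that assms(14) [of l j] by (simp add: \<delta>'_def \<delta>c_def)
        have "\<gamma> \<le> \<sigma>\<^sup>2 / 2 * (E * t)"
          unfolding \<gamma>_def E_def using psi_le [OF t, of k] by (simp add: mult_left_mono)
        also have "\<dots> \<le> \<kappa> * t"
          unfolding mult.assoc [symmetric] using t by (intro mult_right_mono) (auto simp: \<kappa>_def)
        finally show "\<gamma> \<le> \<kappa> * t" .
        show "e \<le> E" unfolding e_def E_def using t by (intro exp_mult_le_exp_abs) auto
      qed (use \<gamma> E in \<open>auto simp: \<kappa>_def e_def\<close>)
      also have "\<dots> = (\<Sum>j\<le>l. \<bar>\<delta>' j l - \<delta>c j l\<bar>) * (B * t ^ (\<nu> + 1))"
        by (simp add: B_def)
      also have "\<dots> \<le> S * (B * t ^ (\<nu> + 1))"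
      proof (intro mult_right_mono)
        show "(\<Sum>j\<le>l. \<bar>\<delta>' j l - \<delta>c j l\<bar>) \<le> S"
          unfolding S_def using l
          by (intro member_le_sum [where f = "\<lambda>l. \<Sum>j\<le>l. \<bar>\<delta>' j l - \<delta>c j l\<bar>"]) (auto intro: sum_nonneg)
      qed (use B t in auto)
      finally show ?thesis .
    qed
    have "g - h = (\<Sum>l\<le>degree f. smult (coeff f l) (moment_poly \<delta>' \<gamma> e l - moment_poly \<delta>c \<gamma> e l))"
      by (simp add: g_def h_def sum_subtractf smult_diff_right)
    then have "poly_norm (g - h)
        \<le> (\<Sum>l\<le>degree f. \<bar>coeff f l\<bar> * poly_norm (moment_poly \<delta>' \<gamma> e l - moment_poly \<delta>c \<gamma> e l))"
      using poly_norm_sum_le [of "\<lambda>l. smult (coeff f l) (moment_poly \<delta>' \<gamma> e l - moment_poly \<delta>c \<gamma> e l)" "{..degree f}"]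
      by (simp add: poly_norm_smult)
    also have "\<dots> \<le> (\<Sum>l\<le>degree f. \<bar>coeff f l\<bar> * (S * (B * t ^ (\<nu> + 1))))"
      using f by (intro sum_mono mult_left_mono diff) auto
    also have "\<dots> = S * B * t ^ (\<nu> + 1) * poly_norm f"
      by (simp only: poly_norm_def sum_distrib_right [symmetric]) (simp only: mult_ac)
    finally have "poly_norm (g - h) \<le> S * B * t ^ (\<nu> + 1) * poly_norm f" .
    moreover have "mean_poly K (\<lambda>x. Xhat t x) f g" "mean_poly M (\<lambda>x. X x t) f h"
      unfolding g_def h_def by (intro mean_poly_of_moments Xhat_moment X_moment; assumption)+
    ultimately show "\<exists>g h. degree g \<le> L \<and> degree h \<le> L \<and>
              mean_poly K (\<lambda>x. Xhat t x) f g \<and> mean_poly M (\<lambda>x. X x t) f h \<and>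
              poly_norm (g - h) \<le> S * B * t ^ (\<nu> + 1) * poly_norm f"
      using deg by (intro exI [of _ g] exI [of _ h]) (auto simp: g_def h_def)
  qed
qed

end
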